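(* Let $\tau\in(2,3)$ and let the weights be $w_i=c_F(n/i)^\alpha$, $i\in[n]$, as described in the context. Let $\eta_s=(3-\tau)/2$ and $\pi_n=\lambda_n n^{-\eta_s}$ with $\lambda_n\to\infty$ and $\lambda_n=o(n^{\eta_s})$. Let $(|\mathscr{C}_{(i)}(\pi_n)|)_{i\ge1}$ and $(|\mathscr{C}^*_{(i)}(\pi_n)|)_{i\ge1}$ be the component sizes, in non-increasing order, of the percolated multigraph $\mathrm{MNR}_n(\boldsymbol{w},\pi_n)$ and of the percolated simple graph $\mathrm{SNR}_n(\boldsymbol{w},\pi_n)$, respectively. Then, as $n\to\infty$, $$\big||\mathscr{C}_{(1)}(\pi_n)|-|\mathscr{C}^*_{(1)}(\pi_n)|\big|=o_{\mathbb{P}}\big(n\pi_n^{1/(3-\tau)}\big).$$ Further, for any $j\ge2$, $|\mathscr{C}^*_{(j)}(\pi_n)|=o_{\mathbb{P}}(n\pi_n^{1/(3-\tau)})$. Here $Y_n=o_{\mathbb{P}}(b_n)$ means $Y_n/b_n\to0$ in probability.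
   Context: Fix $\tau\in(2,3)$ and $\alpha=1/(\tau-1)$. Let $F$ be the distribution function with $1-F(w)=Cw^{-(\tau-1)}$ (for $w\ge C^{1/(\tau-1)}$), $C>0$, and let $w_i=[1-F]^{-1}(i/n)=c_F(n/i)^{\alpha}$ for $i\in[n]=\{1,\dots,n\}$, with $c_F=C^{1/(\tau-1)}$. Write $\boldsymbol{w}=(w_i)_{i\in[n]}$ and $\ell_n=\sum_{i\in[n]}w_i$. The Poissonian random graph (Norros–Reittu model) $\mathrm{MNR}_n(\boldsymbol{w})$ is the random multigraph on $[n]$ with $X_{ij}\sim\mathrm{Poisson}(w_iw_j/\ell_n)$ edges between $i$ and $j$, independently over pairs (self-loops are irrelevant for component sizes). The simple graph $\mathrm{SNR}_n(\boldsymbol{w})$ has an edge between $i\ne j$ precisely when $X_{ij}\ge1$, hence independently with probability $1-\mathrm{e}^{-w_iw_j/\ell_n}$. The percolated graphs $\mathrm{MNR}_n(\boldsymbol{w},\pi)$ and $\mathrm{SNR}_n(\boldsymbol{w},\pi)$ are obtained by keeping each edge of the respective graph (each copy of a multi-edge separately in the multigraph) independently with probability $\pi$, independently of the graph. The two percolated graphs are realized on a common probability space such that every edge of $\mathrm{SNR}_n(\boldsymbol{w},\pi)$ is present in $\mathrm{MNR}_n(\boldsymbol{w},\pi)$ (for instance, keep the edge $\{i,j\}$ of the simple graph iff a distinguished first copy among the $X_{ij}$ copies is kept). Component size means number of vertices; ties in the ordering are broken arbitrarily. *)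

theory Defs
  imports "HOL-Probability.Probability" "HOL-Library.Landau_Symbols"
begin

section \<open>Norros--Reittu graphs with power-law weights\<close>

text \<open>
  The quantile weights \<open>w\<^sub>i = [1 - F]\<^sup>-\<^sup>1(i/n) = c\<^sub>F (n/i)\<^sup>\<alpha>\<close> of the Pareto law
  \<open>1 - F(w) = C w\<^bsup>-(\<tau>-1)\<^esup>\<close>, where \<open>\<alpha> = 1/(\<tau>-1)\<close> and \<open>c\<^sub>F = C\<^bsup>1/(\<tau>-1)\<^esup>\<close>.
\<close>

definition pareto_weight :: "real \<Rightarrow> real \<Rightarrow> nat \<Rightarrow> nat \<Rightarrow> real" where
  "pareto_weight \<tau> C n i = C powr (1 / (\<tau> - 1)) * (real n / real i) powr (1 / (\<tau> - 1))"

definition total_weight :: "nat \<Rightarrow> (nat \<Rightarrow> real) \<Rightarrow> real" where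
  "total_weight n w = (\<Sum>i=1..n. w i)"

text \<open>
  An unordered pair of vertices, possibly equal, is represented by \<open>(i, j)\<close> with \<open>i \<le> j\<close>.
\<close>

definition vertex_pairs :: "nat \<Rightarrow> (nat \<times> nat) set" where
  "vertex_pairs n = {(i, j). 1 \<le> i \<and> i \<le> j \<and> j \<le> n}"

definition NR_multiplicities :: "nat \<Rightarrow> (nat \<Rightarrow> real) \<Rightarrow> (nat \<times> nat \<Rightarrow> nat) pmf" where
  "NR_multiplicities n w =
     Pi_pmf (vertex_pairs n) 0 (\<lambda>(i, j). poisson_pmf (w i * w j / total_weight n w))"

text \<open>
  A multigraph is given by its set of edge copies: \<open>(e, k)\<close> is the \<open>k\<close>-th copy
  (counted from \<open>0\<close>) of an edge between the two vertices in \<open>e\<close>.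
\<close>

definition MNR :: "nat \<Rightarrow> (nat \<Rightarrow> real) \<Rightarrow> ((nat \<times> nat) \<times> nat) set pmf" where
  "MNR n w = map_pmf (\<lambda>X. {(e, k). e \<in> vertex_pairs n \<and> k < X e}) (NR_multiplicities n w)"

definition SNR :: "nat \<Rightarrow> (nat \<Rightarrow> real) \<Rightarrow> (nat \<times> nat) set pmf" where
  "SNR n w = map_pmf (\<lambda>X. {(i, j). (i, j) \<in> vertex_pairs n \<and> i \<noteq> j \<and> X (i, j) \<ge> 1})
                     (NR_multiplicities n w)"

definition percolate :: "real \<Rightarrow> 'e set \<Rightarrow> 'e set pmf" where
  "percolate p E = map_pmf (\<lambda>keep. {e \<in> E. keep e}) (Pi_pmf E False (\<lambda>_. bernoulli_pmf p))"

definition MNR_perc :: "nat \<Rightarrow> (nat \<Rightarrow> real) \<Rightarrow> real \<Rightarrow> ((nat \<times> nat) \<times> nat) set pmf" where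
  "MNR_perc n w p = bind_pmf (MNR n w) (percolate p)"

definition SNR_perc :: "nat \<Rightarrow> (nat \<Rightarrow> real) \<Rightarrow> real \<Rightarrow> (nat \<times> nat) set pmf" where
  "SNR_perc n w p = bind_pmf (SNR n w) (percolate p)"

text \<open>
  A realization of both percolated graphs on one probability space such that every edge of the
  simple graph is present (through at least one copy) in the multigraph. Apart from the two
  marginal laws and this inclusion, the joint law is arbitrary.
\<close>

definition NR_perc_coupling ::
  "nat \<Rightarrow> (nat \<Rightarrow> real) \<Rightarrow> real \<Rightarrow> 'w measure \<Rightarrow>
     ('w \<Rightarrow> ((nat \<times> nat) \<times> nat) set) \<Rightarrow> ('w \<Rightarrow> (nat \<times> nat) set) \<Rightarrow> bool" where
  "NR_perc_coupling n w p \<Omega> G H \<longleftrightarrow>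
     prob_space \<Omega> \<and>
     G \<in> measurable \<Omega> (count_space UNIV) \<and>
     distr \<Omega> (count_space UNIV) G = measure_pmf (MNR_perc n w p) \<and>
     H \<in> measurable \<Omega> (count_space UNIV) \<and>
     distr \<Omega> (count_space UNIV) H = measure_pmf (SNR_perc n w p) \<and>
     (AE \<omega> in \<Omega>. H \<omega> \<subseteq> fst ` G \<omega>)"

section \<open>Component sizes\<close>

definition components :: "'v set \<Rightarrow> ('v \<times> 'v) set \<Rightarrow> 'v set set" where
  "components V E = V // (((E \<union> E\<inverse>)\<^sup>*) \<inter> V \<times> V)"

text \<open>
  The size of the \<open>j\<close>-th largest component, \<open>j \<ge> 1\<close>; it is \<open>0\<close> if there are fewer than \<open>j\<close>
  components.
\<close>

definition comp_size :: "'v set \<Rightarrow> ('v \<times> 'v) set \<Rightarrow> nat \<Rightarrow> nat" where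
  "comp_size V E j =
     (let sizes = rev (sorted_list_of_multiset (image_mset card (mset_set (components V E))))
      in if 1 \<le> j \<and> j \<le> length sizes then sizes ! (j - 1) else 0)"

definition multi_comp_size :: "nat \<Rightarrow> ((nat \<times> nat) \<times> nat) set \<Rightarrow> nat \<Rightarrow> nat" where
  "multi_comp_size n G j = comp_size {1..n} (fst ` G) j"

definition simple_comp_size :: "nat \<Rightarrow> (nat \<times> nat) set \<Rightarrow> nat \<Rightarrow> nat" where
  "simple_comp_size n H j = comp_size {1..n} H j"

section \<open>Stochastic order\<close>

text \<open>\<open>Y\<^sub>n = o\<^sub>P(b\<^sub>n)\<close>, where each \<open>Y\<^sub>n\<close> lives on its own probability space.\<close>

definition small_o_P ::
  "(nat \<Rightarrow> 'w measure) \<Rightarrow> (nat \<Rightarrow> 'w \<Rightarrow> real) \<Rightarrow> (nat \<Rightarrow> real) \<Rightarrow> bool" where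
  "small_o_P \<Omega> Y b \<longleftrightarrow>
     (\<forall>\<epsilon>>0. (\<lambda>n. measure (\<Omega> n) {\<omega> \<in> space (\<Omega> n). \<bar>Y n \<omega> / b n\<bar> > \<epsilon>}) \<longlonglongrightarrow> 0)"

end

theory Submission
  imports Defs
begin

text \<open>
  The percolated multigraph and the percolated simple graph are both sets of independent edges; the
  edge \<open>ij\<close> has probability \<open>1 - exp (- \<pi> w\<^sub>i w\<^sub>j / \<ell>)\<close> in the first and \<open>\<pi> (1 - exp (- w\<^sub>i w\<^sub>j / \<ell>))\<close> in
  the second. Let \<open>u\<close> solve the limiting fixed-point equation
  \<open>u = (\<pi> / \<ell>) \<Sum>\<^sub>i w\<^sub>i (1 - exp (- u w\<^sub>i))\<close>, with the sum replaced by an integral, and let \<open>s = u \<ell>\<close>, which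
  is of order \<open>n \<pi>\<^bsup>1/(3-\<tau>)\<^esup>\<close>. It suffices to bound the number \<open>Z\<close> of vertices in large components of
  the multigraph from above by \<open>s\<close> in expectation, and the largest component of the simple graph from
  below by \<open>s\<close> with high probability: the coupling squeezes both largest components between the two
  bounds and leaves no room for a second large component.

  For the upper bound, exploring one vertex at a time shows that any solution \<open>h\<close> of the one-sided
  branching recursion satisfies \<open>E exp (- t |C(v)|) \<ge> h v\<close>, and \<open>h v = exp (- t - y w\<^sub>v)\<close> is one as soon
  as \<open>y\<close> slightly exceeds \<open>u\<close>.

  For the lower bound, weights above those of the \<open>m\<close> heaviest vertices are truncated, where \<open>m\<close> is a
  small multiple of the number of vertices of weight at least \<open>1/u\<close>. A union bound over all
  subsets shows that this core has a component containing a third of it. The other vertices are cut into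
  many similar blocks. Conditionally on the cluster of the core in the union of all
  blocks but one, the edges into the omitted block are fresh, so a Chernoff bound controls how much of
  that block is reached; iterating over unions of more and more blocks drives the pressure exerted by the
  cluster up to the fixed point. Few blocks are lost since the number of iterations needed does not grow
  with the number of blocks.
\<close>

section \<open>Random subsets with independent elements\<close>

text \<open>The joint law of the two graphs is arbitrary apart from the inclusion, so only the
  marginal laws can be used. Hence one bound is a mean and the other a high-probability statement: a
  variable that is mostly at least \<open>(1 - \<kappa>) * s\<close> with mean at most
  \<open>(1 + \<epsilon>) * s\<close> is concentrated by Markov's inequality alone. The edge
  probabilities of the two graphs agree to first order only where \<open>w i * w j / ell n\<close>
  is small, which fails between hubs. Truncation at weights of order \<open>1 / u\<close> repairs
  this: the largest ratio becomes of order \<open>1 / (n * u^2)\<close>, and the divergence of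
  \<lambda> says precisely that \<open>n * u^2\<close> tends to infinity. The truncated hubs still
  hang together, because cutting at grid position \<open>a\<close> leaves them a mean degree of
  order \<open>a powr (1 - 2 * \<alpha>)\<close>, which is large for small \<open>a\<close> as
  \<open>\<alpha> > 1 / 2\<close>. The limiting pressure map grows like
  \<open>y powr (\<tau> - 2)\<close>, hence sublinearly: slightly above the fixed point there is a
  strict supersolution, slightly below it a strict subsolution. This slack pays for every
  approximation on either side.\<close>

definition random_subset :: "'e set \<Rightarrow> ('e \<Rightarrow> real) \<Rightarrow> 'e set pmf" where
  "random_subset I q = map_pmf (\<lambda>keep. {e \<in> I. keep e}) (Pi_pmf I False (\<lambda>e. bernoulli_pmf (q e)))"

lemma percolate_eq_random_subset: "percolate p E = random_subset E (\<lambda>_. p)"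
  by (simp add: percolate_def random_subset_def)

lemma set_random_subset: "set_pmf (random_subset I q) \<subseteq> Pow I"
  by (auto simp: random_subset_def)

lemma finite_set_random_subset: "finite I \<Longrightarrow> finite (set_pmf (random_subset I q))"
  using finite_subset[OF set_random_subset[of I q]] by simp

lemma integrable_random_subset [simp]:
  fixes f :: "'e set \<Rightarrow> real"
  shows "finite I \<Longrightarrow> integrable (measure_pmf (random_subset I q)) f"
  by (intro integrable_measure_pmf_finite finite_set_random_subset)

lemma random_subset_empty [simp]: "random_subset {} q = return_pmf {}"
  by (simp add: random_subset_def)

lemma random_subset_cong:
  assumes "finite I" "\<And>e. e \<in> I \<Longrightarrow> q e = q' e"
  shows "random_subset I q = random_subset I q'"
proof -
  have "Pi_pmf I False (\<lambda>e. bernoulli_pmf (q e)) = Pi_pmf I False (\<lambda>e. bernoulli_pmf (q' e))"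
    using assms by (intro Pi_pmf_cong) auto
  then show ?thesis by (simp add: random_subset_def)
qed

lemma random_subset_Un:
  assumes "finite I" "finite K" "I \<inter> K = {}"
  shows "random_subset (I \<union> K) q =
    map_pmf (\<lambda>(X, Y). X \<union> Y) (pair_pmf (random_subset I q) (random_subset K q))"
  using assms
  by (simp add: random_subset_def Pi_pmf_union map_pmf_comp case_prod_unfold map_pair[symmetric])
     (intro map_pmf_cong refl, auto)

lemma map_Int_random_subset:
  assumes "finite I" "J \<subseteq> I"
  shows "map_pmf (\<lambda>X. X \<inter> J) (random_subset I q) = random_subset J q"
proof -
  have "random_subset J q = map_pmf (\<lambda>k. {e \<in> J. k e})
      (map_pmf (\<lambda>f x. if x \<in> J then f x else False) (Pi_pmf I False (\<lambda>e. bernoulli_pmf (q e))))"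
    using Pi_pmf_subset[OF assms, of False "\<lambda>e. bernoulli_pmf (q e)"]
    by (simp add: random_subset_def)
  also have "\<dots> = map_pmf (\<lambda>X. X \<inter> J) (random_subset I q)"
    using assms(2) unfolding random_subset_def map_pmf_comp
    by (intro map_pmf_cong refl) auto
  finally show ?thesis ..
qed

text \<open>An element of probability 0 is never kept, so it can be added to the ground set freely.
  This puts percolation on a random edge set onto the fixed ground set of all vertex pairs, where
  the randomness of the edge set becomes randomness of the probabilities.\<close>

lemma random_subset_zero_outside:
  assumes "finite I" "J \<subseteq> I"
  shows "random_subset J q = random_subset I (\<lambda>e. if e \<in> J then q e else 0)"
proof -
  have z: "bernoulli_pmf 0 = return_pmf False"
  proof (rule pmf_eqI)
    show "pmf (bernoulli_pmf 0) i = pmf (return_pmf False) i" for i by (cases i) auto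
  qed
  have "Pi_pmf I False (\<lambda>e. bernoulli_pmf (if e \<in> J then q e else 0))
      = Pi_pmf J False (\<lambda>e. bernoulli_pmf (if e \<in> J then q e else 0))"
    using assms z by (intro Pi_pmf_subset') auto
  also have "\<dots> = Pi_pmf J False (\<lambda>e. bernoulli_pmf (q e))"
    by (intro Pi_pmf_cong) auto
  finally have *: "Pi_pmf I False (\<lambda>e. bernoulli_pmf (if e \<in> J then q e else 0)) = \<dots>" .
  have "map_pmf (\<lambda>k. {e \<in> I. k e}) (Pi_pmf J False (\<lambda>e. bernoulli_pmf (q e)))
      = map_pmf (\<lambda>k. {e \<in> J. k e}) (Pi_pmf J False (\<lambda>e. bernoulli_pmf (q e)))"
  proof (intro map_pmf_cong refl)
    fix k assume "k \<in> set_pmf (Pi_pmf J False (\<lambda>e. bernoulli_pmf (q e)))"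
    then show "{e \<in> I. k e} = {e \<in> J. k e}"
      using set_Pi_pmf_subset[of J False] assms by (fastforce dest: finite_subset)
  qed
  then show ?thesis by (simp add: random_subset_def *)
qed

lemma expectation_pair_pmf_finite:
  fixes f :: "'a \<times> 'b \<Rightarrow> real"
  assumes "finite (set_pmf p)" "finite (set_pmf r)"
  shows "measure_pmf.expectation (pair_pmf p r) f =
    measure_pmf.expectation p (\<lambda>x. measure_pmf.expectation r (\<lambda>y. f (x, y)))"
proof -
  have "measure_pmf.expectation (pair_pmf p r) f =
      (\<Sum>z\<in>set_pmf p \<times> set_pmf r. f z * pmf (pair_pmf p r) z)"
    using assms by (intro integral_measure_pmf_real) auto
  also have "\<dots> = (\<Sum>x\<in>set_pmf p. (\<Sum>y\<in>set_pmf r. f (x, y) * pmf r y) * pmf p x)"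
    unfolding sum_distrib_right sum.cartesian_product
    by (intro sum.cong refl) (auto simp: pmf_pair)
  also have "\<dots> = (\<Sum>x\<in>set_pmf p. measure_pmf.expectation r (\<lambda>y. f (x, y)) * pmf p x)"
    using assms by (intro sum.cong refl arg_cong2[of _ _ _ _ "(*)"] integral_measure_pmf_real[symmetric]) auto
  also have "\<dots> = measure_pmf.expectation p (\<lambda>x. measure_pmf.expectation r (\<lambda>y. f (x, y)))"
    using assms by (intro integral_measure_pmf_real[symmetric]) auto
  finally show ?thesis .
qed

text \<open>Exposure in two stages: the inner expectation is conditional on the part already seen.
  Both explorations rest on this form.\<close>

lemma expectation_random_subset_Un:
  fixes f :: "'e set \<Rightarrow> real"
  assumes "finite I" "finite K" "I \<inter> K = {}"
  shows "measure_pmf.expectation (random_subset (I \<union> K) q) f =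
    measure_pmf.expectation (random_subset I q)
      (\<lambda>X. measure_pmf.expectation (random_subset K q) (\<lambda>Y. f (X \<union> Y)))"
  using assms
  by (simp add: random_subset_Un expectation_pair_pmf_finite finite_set_random_subset)

text \<open>A generating function, by independence. Values 0 and 1 of \<open>h\<close> give void
  probabilities, exponentials give Chernoff bounds, and a solution of the branching recursion gives
  one exploration step.\<close>

lemma expectation_random_subset_prod:
  fixes h :: "'e \<Rightarrow> real"
  assumes "finite I" "\<And>e. e \<in> I \<Longrightarrow> 0 \<le> q e \<and> q e \<le> 1" "\<And>e. e \<in> I \<Longrightarrow> 0 \<le> h e"
  shows "measure_pmf.expectation (random_subset I q) (\<lambda>X. \<Prod>e\<in>X. h e) =
    (\<Prod>e\<in>I. 1 - q e * (1 - h e))"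
proof -
  have "measure_pmf.expectation (random_subset I q) (\<lambda>X. \<Prod>e\<in>X. h e) =
    measure_pmf.expectation (Pi_pmf I False (\<lambda>e. bernoulli_pmf (q e)))
      (\<lambda>k. \<Prod>e\<in>I. if k e then h e else 1)"
    unfolding random_subset_def integral_map_pmf
    using assms(1) by (intro Bochner_Integration.integral_cong refl) (simp add: prod.If_cases Int_def)
  also have "\<dots> = (\<Prod>e\<in>I. measure_pmf.expectation (bernoulli_pmf (q e)) (\<lambda>b. if b then h e else 1))"
    using assms by (intro expectation_prod_Pi_pmf) (auto intro!: integrable_measure_pmf_finite)
  also have "\<dots> = (\<Prod>e\<in>I. 1 - q e * (1 - h e))"
    using assms(2) by (intro prod.cong refl) (auto simp: algebra_simps)
  finally show ?thesis .
qed

lemma prob_random_subset_disjoint: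
  assumes "finite I" "\<And>e. e \<in> I \<Longrightarrow> 0 \<le> q e \<and> q e \<le> 1" "J \<subseteq> I"
  shows "measure_pmf.prob (random_subset I q) {X. X \<inter> J = {}} = (\<Prod>e\<in>J. 1 - q e)"
proof -
  have "measure_pmf.prob (random_subset I q) {X. X \<inter> J = {}} =
     measure_pmf.expectation (random_subset I q) (indicator {X. X \<inter> J = {}})"
    by simp
  also have "\<dots> = measure_pmf.expectation (random_subset I q)
      (\<lambda>X. \<Prod>e\<in>X. if e \<in> J then 0 else 1)"
  proof (intro integral_cong_AE AE_pmfI)
    fix X assume "X \<in> set_pmf (random_subset I q)"
    then have "finite X" using set_random_subset[of I q] assms(1) by (auto dest: finite_subset)
    then show "indicator {X. X \<inter> J = {}} X = (\<Prod>e\<in>X. if e \<in> J then 0 else 1 :: real)"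
      by (auto simp: indicator_def intro!: prod.neutral)
  qed auto
  also have "\<dots> = (\<Prod>e\<in>I. 1 - q e * (1 - (if e \<in> J then 0 else 1)))"
    using assms by (intro expectation_random_subset_prod) auto
  also have "\<dots> = (\<Prod>e\<in>J. 1 - q e)"
    using assms by (intro prod.mono_neutral_cong_right) auto
  finally show ?thesis .
qed

lemma bool_pmf_eqI:
  fixes p q :: "bool pmf"
  assumes "pmf p False = pmf q False"
  shows "p = q"
proof (rule pmf_eqI)
  have T: "pmf p True = 1 - pmf p False" for p
  proof -
    have "set_pmf p \<subseteq> {False, True}" by auto
    then have "(\<Sum>x\<in>{False, True}. pmf p x) = 1" by (intro sum_pmf_eq_1) auto
    then show ?thesis by simp
  qed
  show "pmf p i = pmf q i" for i using assms T[of p] T[of q] by (cases i) auto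
qed

text \<open>The fibres of \<open>g\<close> are disjoint, so the events that they are hit are
  independent. This merges the copies of an edge, and later passes from edges to the neighbours that
  they lead to.\<close>

lemma map_image_random_subset:
  assumes "finite J" "finite I" "g ` I \<subseteq> J" "\<And>e. e \<in> I \<Longrightarrow> 0 \<le> q e \<and> q e \<le> 1"
  shows "map_pmf (\<lambda>X. g ` X) (random_subset I q) =
    random_subset J (\<lambda>j. 1 - (\<Prod>e | e \<in> I \<and> g e = j. 1 - q e))"
  using assms
proof (induction J arbitrary: I rule: finite_induct)
  case empty
  then show ?case by simp
next
  case (insert j J)
  define I1 I2 where "I1 = {e \<in> I. g e = j}" and "I2 = {e \<in> I. g e \<noteq> j}"
  have fin: "finite I1" "finite I2" "I1 \<inter> I2 = {}" "I = I1 \<union> I2"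
    using insert.prems by (auto simp: I1_def I2_def)
  let ?r = "\<lambda>j. 1 - (\<Prod>e | e \<in> I \<and> g e = j. 1 - q e)"
  have b: "0 \<le> ?r j \<and> ?r j \<le> 1"
    using insert.prems by (auto intro!: prod_le_1 prod_nonneg)
  have one: "map_pmf (\<lambda>X. g ` X) (random_subset I1 q) = random_subset {j} ?r"
  proof -
    have bool: "map_pmf (\<lambda>X. X \<noteq> {}) (random_subset I1 q) = bernoulli_pmf (?r j)"
    proof (rule bool_pmf_eqI)
      have "pmf (map_pmf (\<lambda>X. X \<noteq> {}) (random_subset I1 q)) False
          = measure_pmf.prob (random_subset I1 q) ((\<lambda>X. X \<noteq> {}) -` {False})"
        by (subst pmf_map) auto
      also have "\<dots> = measure_pmf.prob (random_subset I1 q) {X. X \<inter> I1 = {}}"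
        using set_random_subset[of I1 q] by (intro measure_pmf.finite_measure_eq_AE AE_pmfI) auto
      also have "\<dots> = (\<Prod>e\<in>I1. 1 - q e)"
        using insert.prems fin by (intro prob_random_subset_disjoint) auto
      also have "\<dots> = pmf (bernoulli_pmf (?r j)) False"
        using b by (simp add: I1_def)
      finally show "pmf (map_pmf (\<lambda>X. X \<noteq> {}) (random_subset I1 q)) False = pmf (bernoulli_pmf (?r j)) False" .
    qed
    have "map_pmf (\<lambda>X. g ` X) (random_subset I1 q)
        = map_pmf (\<lambda>b. if b then {j} else {}) (map_pmf (\<lambda>X. X \<noteq> {}) (random_subset I1 q))"
      unfolding map_pmf_comp using set_random_subset[of I1 q]
      by (intro map_pmf_cong refl) (auto simp: I1_def)
    also have "\<dots> = map_pmf (\<lambda>b. if b then {j} else {}) (bernoulli_pmf (?r j))"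
      by (simp only: bool)
    also have "\<dots> = random_subset {j} ?r"
      unfolding random_subset_def Pi_pmf_singleton map_pmf_comp
      by (rule arg_cong[of _ _ "\<lambda>f. map_pmf f _"]) (auto simp: fun_eq_iff)
    finally show ?thesis .
  qed
  have two: "map_pmf (\<lambda>X. g ` X) (random_subset I2 q) = random_subset J ?r"
  proof -
    have "map_pmf (\<lambda>X. g ` X) (random_subset I2 q)
        = random_subset J (\<lambda>j. 1 - (\<Prod>e | e \<in> I2 \<and> g e = j. 1 - q e))"
      using insert.prems by (intro insert.IH) (auto simp: I2_def)
    also have "\<dots> = random_subset J ?r"
      using insert.hyps
      by (intro random_subset_cong) (auto simp: I2_def intro!: prod.cong)
    finally show ?thesis .
  qed
  have "map_pmf (\<lambda>X. g ` X) (random_subset I q) =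
     map_pmf (\<lambda>(X, Y). X \<union> Y) (pair_pmf (map_pmf (\<lambda>X. g ` X) (random_subset I1 q)) (map_pmf (\<lambda>X. g ` X) (random_subset I2 q)))"
    unfolding fin(4) random_subset_Un[OF fin(1-3)] map_pair[symmetric] map_pmf_comp
    by (intro map_pmf_cong refl) (auto simp: image_Un)
  also have "\<dots> = random_subset ({j} \<union> J) ?r"
    unfolding one two using insert.hyps by (subst random_subset_Un) auto
  finally show ?case by simp
qed

section \<open>Percolated Norros--Reittu graphs as random subsets\<close>

lemma finite_vertex_pairs [simp]: "finite (vertex_pairs n)"
  by (rule finite_subset[of _ "{1..n} \<times> {1..n}"]) (auto simp: vertex_pairs_def)

lemma vertex_pairs_subset: "vertex_pairs n \<subseteq> {1..n} \<times> {1..n}"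
  by (auto simp: vertex_pairs_def)

text \<open>The coordinates are independent both in the mixing variable and in the thinning, so the
  mixture can be taken coordinate by coordinate. This integrates out the Poisson
  multiplicities.\<close>

lemma bind_Pi_pmf_random_subset:
  assumes "finite I" "\<And>e. e \<in> I \<Longrightarrow> bind_pmf (m e) (\<lambda>k. bernoulli_pmf (f e k)) = bernoulli_pmf (q e)"
  shows "bind_pmf (Pi_pmf I d m) (\<lambda>X. random_subset I (\<lambda>e. f e (X e))) = random_subset I q"
proof -
  have "bind_pmf (Pi_pmf I d m) (\<lambda>X. random_subset I (\<lambda>e. f e (X e))) =
      map_pmf (\<lambda>keep. {e \<in> I. keep e}) (Pi_pmf I False (\<lambda>e. bind_pmf (m e) (\<lambda>k. bernoulli_pmf (f e k))))"
    using assms(1) by (simp add: random_subset_def Pi_pmf_bind[where d' = d] map_bind_pmf)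
  also have "Pi_pmf I False (\<lambda>e. bind_pmf (m e) (\<lambda>k. bernoulli_pmf (f e k)))
      = Pi_pmf I False (\<lambda>e. bernoulli_pmf (q e))"
    using assms by (intro Pi_pmf_cong) auto
  finally show ?thesis by (simp add: random_subset_def)
qed

lemma expectation_poisson_power:
  assumes r: "0 < r" and s: "0 \<le> s" "s \<le> 1"
  shows "measure_pmf.expectation (poisson_pmf r) (\<lambda>k. s ^ k) = exp (- ((1 - s) * r))"
proof -
  have sm: "summable (\<lambda>k. (s * r) ^ k / fact k)"
    using summable_exp[of "s * r"] by (simp add: field_simps)
  have "(\<integral>\<^sup>+k. ennreal (s ^ k) \<partial>measure_pmf (poisson_pmf r)) =
      (\<integral>\<^sup>+k. ennreal ((s * r) ^ k / fact k * exp (- r)) \<partial>count_space UNIV)"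
    using assms by (simp add: nn_integral_measure_pmf ennreal_mult'[symmetric] field_simps)
  also have "\<dots> = (\<Sum>k. ennreal ((s * r) ^ k / fact k * exp (- r)))"
    by (simp add: nn_integral_count_space_nat)
  also have "\<dots> = ennreal (\<Sum>k. (s * r) ^ k / fact k * exp (- r))"
    using assms sm by (intro suminf_ennreal2 summable_mult2) auto
  also have "(\<Sum>k. (s * r) ^ k / fact k * exp (- r)) = exp (s * r) * exp (- r)"
    using suminf_mult2[OF sm, of "exp (- r)"] by (simp add: exp_def scaleR_conv_of_real field_simps)
  also have "\<dots> = exp (- ((1 - s) * r))"
    by (simp add: exp_add[symmetric] algebra_simps)
  finally show ?thesis
    using s by (simp add: integral_eq_nn_integral)
qed

lemma bind_poisson_thinning:
  assumes r: "0 < r" and p: "0 \<le> p" "p \<le> 1"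
  shows "bind_pmf (poisson_pmf r) (\<lambda>k. bernoulli_pmf (1 - (1 - p) ^ k)) = bernoulli_pmf (1 - exp (- (p * r)))"
proof (rule bool_pmf_eqI)
  have "pmf (bind_pmf (poisson_pmf r) (\<lambda>k. bernoulli_pmf (1 - (1 - p) ^ k))) False
      = measure_pmf.expectation (poisson_pmf r) (\<lambda>k. (1 - p) ^ k)"
    using p unfolding pmf_bind by (intro Bochner_Integration.integral_cong refl) (simp add: power_le_one)
  also have "\<dots> = pmf (bernoulli_pmf (1 - exp (- (p * r)))) False"
    using assms by (subst expectation_poisson_power) auto
  finally show "pmf (bind_pmf (poisson_pmf r) (\<lambda>k. bernoulli_pmf (1 - (1 - p) ^ k))) False = \<dots>" .
qed

text \<open>\<open>0 ^ k\<close> is 1 for \<open>k = 0\<close> and 0 otherwise, so the Poisson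
  generating function at 0 yields the probability of having no copy.\<close>

lemma bind_poisson_positive:
  assumes r: "0 < r" and p: "0 \<le> p" "p \<le> 1"
  shows "bind_pmf (poisson_pmf r) (\<lambda>k. bernoulli_pmf (if k \<ge> 1 then p else 0))
    = bernoulli_pmf (p * (1 - exp (- r)))"
proof (rule bool_pmf_eqI)
  have b: "0 \<le> p * (1 - exp (- r))" "p * (1 - exp (- r)) \<le> 1"
    using assms by (auto intro!: mult_le_one)
  have "pmf (bind_pmf (poisson_pmf r) (\<lambda>k. bernoulli_pmf (if k \<ge> 1 then p else 0))) False
      = measure_pmf.expectation (poisson_pmf r) (\<lambda>k. (1 - p) + p * 0 ^ k)"
    using p unfolding pmf_bind
    by (intro Bochner_Integration.integral_cong refl) (auto simp: power_0_left Suc_le_eq)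
  also have "\<dots> = (1 - p) + p * measure_pmf.expectation (poisson_pmf r) (\<lambda>k. 0 ^ k)"
  proof -
    have "integrable (measure_pmf (poisson_pmf r)) (\<lambda>k. 0 ^ k :: real)"
      by (intro measure_pmf.integrable_const_bound[where B = 1]) (auto simp: power_0_left)
    then show ?thesis by (subst Bochner_Integration.integral_add) auto
  qed
  also have "\<dots> = pmf (bernoulli_pmf (p * (1 - exp (- r)))) False"
    using r b by (subst expectation_poisson_power) (auto simp: algebra_simps)
  finally show "pmf (bind_pmf (poisson_pmf r) (\<lambda>k. bernoulli_pmf (if k \<ge> 1 then p else 0))) False = \<dots>" .
qed

text \<open>Component sizes see only which pairs carry a kept copy. Given \<open>k\<close> copies
  this has probability \<open>1 - (1 - p) ^ k\<close>, and averaging over a Poisson number of copies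
  multiplies the Poisson rate by \<open>p\<close>.\<close>

lemma map_fst_MNR_perc:
  assumes p: "0 \<le> p" "p \<le> 1"
    and pos: "\<And>i j. (i, j) \<in> vertex_pairs n \<Longrightarrow> 0 < w i * w j / total_weight n w"
  shows "map_pmf (\<lambda>G. fst ` G) (MNR_perc n w p) =
    random_subset (vertex_pairs n) (\<lambda>(i, j). 1 - exp (- (p * (w i * w j / total_weight n w))))"
proof -
  let ?I = "vertex_pairs n"
  have *: "map_pmf (\<lambda>G. fst ` G) (random_subset {(e, k). e \<in> ?I \<and> k < X e} (\<lambda>_. p))
      = random_subset ?I (\<lambda>e. 1 - (1 - p) ^ X e)" for X :: "nat \<times> nat \<Rightarrow> nat"
  proof -
    have S: "{(e, k). e \<in> ?I \<and> k < X e} = Sigma ?I (\<lambda>e. {..<X e})" by auto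
    have "map_pmf (\<lambda>G. fst ` G) (random_subset (Sigma ?I (\<lambda>e. {..<X e})) (\<lambda>_. p)) =
        random_subset ?I (\<lambda>j. 1 - (\<Prod>e | e \<in> Sigma ?I (\<lambda>e. {..<X e}) \<and> fst e = j. 1 - p))"
      using p by (intro map_image_random_subset) auto
    also have "\<dots> = random_subset ?I (\<lambda>e. 1 - (1 - p) ^ X e)"
    proof (intro random_subset_cong)
      fix j assume "j \<in> ?I"
      then have "{e. e \<in> Sigma ?I (\<lambda>e. {..<X e}) \<and> fst e = j} = Pair j ` {..<X j}" by auto
      then have "card {e. e \<in> Sigma ?I (\<lambda>e. {..<X e}) \<and> fst e = j} = X j"
        by (simp add: card_image inj_on_def)
      then show "1 - (\<Prod>e | e \<in> Sigma ?I (\<lambda>e. {..<X e}) \<and> fst e = j. 1 - p) = 1 - (1 - p) ^ X j"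
        by (simp only: prod_constant)
    qed simp
    finally show ?thesis by (simp add: S)
  qed
  show ?thesis
    unfolding MNR_perc_def MNR_def NR_multiplicities_def percolate_eq_random_subset
      bind_map_pmf map_bind_pmf *
  proof (intro bind_Pi_pmf_random_subset finite_vertex_pairs)
    fix e assume "e \<in> ?I"
    then show "(case e of (i, j) \<Rightarrow> poisson_pmf (w i * w j / total_weight n w)) \<bind>
          (\<lambda>k. bernoulli_pmf (1 - (1 - p) ^ k)) =
        bernoulli_pmf (case e of (i, j) \<Rightarrow> 1 - exp (- (p * (w i * w j / total_weight n w))))"
      using bind_poisson_thinning[OF pos p] by (cases e) (metis (no_types, lifting) prod.case)
  qed
qed

lemma SNR_perc_eq_random_subset:
  assumes p: "0 \<le> p" "p \<le> 1"
    and pos: "\<And>i j. (i, j) \<in> vertex_pairs n \<Longrightarrow> 0 < w i * w j / total_weight n w"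
  shows "SNR_perc n w p = random_subset (vertex_pairs n)
    (\<lambda>(i, j). if i = j then 0 else p * (1 - exp (- (w i * w j / total_weight n w))))"
proof -
  let ?I = "vertex_pairs n"
  have *: "random_subset {(i, j). (i, j) \<in> ?I \<and> i \<noteq> j \<and> 1 \<le> X (i, j)} (\<lambda>_. p)
      = random_subset ?I (\<lambda>e. if fst e \<noteq> snd e \<and> 1 \<le> X e then p else 0)" for X :: "nat \<times> nat \<Rightarrow> nat"
    by (subst random_subset_zero_outside[of ?I]) (auto intro!: random_subset_cong)
  show ?thesis
    unfolding SNR_perc_def SNR_def NR_multiplicities_def percolate_eq_random_subset bind_map_pmf *
  proof (intro bind_Pi_pmf_random_subset finite_vertex_pairs)
    fix e assume e: "e \<in> ?I"
    obtain i j where ij: "e = (i, j)" by (cases e)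
    show "(case e of (i, j) \<Rightarrow> poisson_pmf (w i * w j / total_weight n w)) \<bind>
          (\<lambda>k. bernoulli_pmf (if fst e \<noteq> snd e \<and> 1 \<le> k then p else 0)) =
        bernoulli_pmf (case e of (i, j) \<Rightarrow> if i = j then 0 else p * (1 - exp (- (w i * w j / total_weight n w))))"
    proof (cases "i = j")
      case False
      define r where "r = w i * w j / total_weight n w"
      have "0 < r" using pos e ij by (simp add: r_def)
      from bind_poisson_positive[OF this p] show ?thesis
        unfolding ij prod.case fst_conv snd_conv r_def[symmetric] using False by simp
    qed (simp add: ij)
  qed
qed

section \<open>Reachability and component sizes\<close>

definition adjacent :: "('v \<times> 'v) set \<Rightarrow> 'v \<Rightarrow> 'v \<Rightarrow> bool" where
  "adjacent E x y \<longleftrightarrow> (x, y) \<in> E \<or> (y, x) \<in> E"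

text \<open>The start is a set because an exploration that has processed some vertices continues
  from all those found so far, inside the vertices still left in \<open>V\<close>.\<close>

definition reach :: "'v set \<Rightarrow> 'v set \<Rightarrow> ('v \<times> 'v) set \<Rightarrow> 'v set" where
  "reach V A E = {(x, y). x \<in> V \<and> y \<in> V \<and> adjacent E x y}\<^sup>* `` A"

lemma reach_incl: "A \<subseteq> reach V A E"
  by (auto simp: reach_def)

lemma reach_step: "x \<in> reach V A E \<Longrightarrow> x \<in> V \<Longrightarrow> y \<in> V \<Longrightarrow> adjacent E x y \<Longrightarrow> y \<in> reach V A E"
  unfolding reach_def by (auto intro: rtrancl_into_rtrancl)

lemma reach_least:
  assumes "A \<subseteq> X" "\<And>x y. x \<in> X \<Longrightarrow> x \<in> V \<Longrightarrow> y \<in> V \<Longrightarrow> adjacent E x y \<Longrightarrow> y \<in> X"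
  shows "reach V A E \<subseteq> X"
proof
  fix y assume "y \<in> reach V A E"
  then obtain a where a: "a \<in> A" "(a, y) \<in> {(x, y). x \<in> V \<and> y \<in> V \<and> adjacent E x y}\<^sup>*"
    by (auto simp: reach_def)
  from a(2) show "y \<in> X"
    by (induction rule: rtrancl_induct) (use a(1) assms in auto)
qed

lemma reach_subset: "A \<subseteq> V \<Longrightarrow> reach V A E \<subseteq> V"
  by (rule reach_least) auto

lemma reach_mono:
  assumes "V \<subseteq> V'" "A \<subseteq> A'" "E \<subseteq> E'"
  shows "reach V A E \<subseteq> reach V' A' E'"
proof (rule reach_least)
  fix x y assume "x \<in> reach V' A' E'" "x \<in> V" "y \<in> V" "adjacent E x y"
  moreover from this have "adjacent E' x y" using assms by (auto simp: adjacent_def)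
  ultimately show "y \<in> reach V' A' E'" using assms reach_step[of x V' A' E' y] by auto
qed (use assms reach_incl[of A' V' E'] in auto)

lemma reach_Int_Times: "reach V A (E \<inter> V \<times> V) = reach V A E"
proof -
  have "{(x, y). x \<in> V \<and> y \<in> V \<and> adjacent (E \<inter> V \<times> V) x y} = {(x, y). x \<in> V \<and> y \<in> V \<and> adjacent E x y}"
    by (auto simp: adjacent_def)
  then show ?thesis by (simp add: reach_def)
qed

text \<open>Cut a path at its last visit to \<open>v\<close>: what remains avoids \<open>v\<close>
  and starts in \<open>A\<close> or at a neighbour of \<open>v\<close>. Once \<open>v\<close> is
  processed, the edges at \<open>v\<close> are therefore used up.\<close>

lemma reach_explore:
  assumes "v \<in> A" "A \<subseteq> V"
  shows "reach V A E \<subseteq> insert v (reach (V - {v}) (A - {v} \<union> {y \<in> V - {v}. adjacent E v y}) E)"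
proof -
  define N where "N = {y \<in> V - {v}. adjacent E v y}"
  define R where "R = reach (V - {v}) (A - {v} \<union> N) E"
  have incl: "A - {v} \<subseteq> R" "N \<subseteq> R"
    using reach_incl[of "A - {v} \<union> N" "V - {v}" E] unfolding R_def by blast+
  have "reach V A E \<subseteq> insert v R"
  proof (rule reach_least)
    show "A \<subseteq> insert v R" using incl by blast
  next
    fix x y assume *: "x \<in> insert v R" "x \<in> V" "y \<in> V" "adjacent E x y"
    show "y \<in> insert v R"
    proof (cases "y = v \<or> x = v")
      case True
      then show ?thesis using * incl by (auto simp: N_def)
    next
      case False
      then have "x \<in> R" "x \<in> V - {v}" "y \<in> V - {v}" using * by auto
      then show ?thesis using *(4) reach_step unfolding R_def by fast
    qed
  qed
  then show ?thesis by (simp only: R_def N_def)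
qed

lemma reach_sym:
  assumes "x \<in> V" "y \<in> reach V {x} E"
  shows "x \<in> reach V {y} E"
proof -
  let ?r = "{(x, y). x \<in> V \<and> y \<in> V \<and> adjacent E x y}"
  have "sym (?r\<^sup>*)" by (intro sym_rtrancl) (auto simp: sym_def adjacent_def)
  then show ?thesis using assms by (auto simp: reach_def sym_def)
qed

lemma reach_trans: "y \<in> reach V {x} E \<Longrightarrow> reach V {y} E \<subseteq> reach V {x} E"
  by (rule reach_least) (simp, erule (3) reach_step)

lemma reach_eq:
  assumes "x \<in> V" "y \<in> reach V {x} E"
  shows "reach V {y} E = reach V {x} E"
  using assms reach_trans[of y V x E] reach_trans[of x V y E] reach_sym[of x V y E] by blast

section \<open>Components, their sizes and the vertices in large components\<close>

lemma components_eq_reach: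
  assumes "E \<subseteq> V \<times> V"
  shows "components V E = (\<lambda>v. reach V {v} E) ` V"
proof -
  let ?s = "{(x, y). x \<in> V \<and> y \<in> V \<and> adjacent E x y}"
  have "E \<union> E\<inverse> = ?s" using assms by (auto simp: adjacent_def)
  then have "((E \<union> E\<inverse>)\<^sup>* \<inter> V \<times> V) `` {v} = reach V {v} E" if "v \<in> V" for v
    using that reach_subset[of "{v}" V E] by (auto simp: reach_def)
  then show ?thesis by (auto simp: components_def quotient_def)
qed

text \<open>Counting vertices instead of components makes the cardinality a sum over vertices, so
  its mean involves only the law of single clusters, while it still dominates the joint size of any
  two large components.\<close>

definition large_vertices :: "'v set \<Rightarrow> ('v \<times> 'v) set \<Rightarrow> nat \<Rightarrow> 'v set" where
  "large_vertices V E k = {v \<in> V. k \<le> card (reach V {v} E)}"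

lemma large_vertices_mono:
  assumes "finite V" "E \<subseteq> E'"
  shows "large_vertices V E k \<subseteq> large_vertices V E' k"
proof
  fix v assume v: "v \<in> large_vertices V E k"
  then have "card (reach V {v} E) \<le> card (reach V {v} E')"
    using assms reach_subset[of "{v}" V E'] finite_subset
    by (intro card_mono reach_mono) (auto simp: large_vertices_def)
  with v show "v \<in> large_vertices V E' k" by (auto simp: large_vertices_def)
qed

context
  fixes V :: "'v set" and E :: "('v \<times> 'v) set"
  assumes fin: "finite V" and E: "E \<subseteq> V \<times> V"
begin

lemma card_large_vertices_components:
  "card (large_vertices V E k) = (\<Sum>K | K \<in> components V E \<and> k \<le> card K. card K)"
proof -
  let ?C = "{K \<in> components V E. k \<le> card K}"
  have U: "large_vertices V E k = \<Union>?C"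
  proof -
    have "v \<in> large_vertices V E k" if "v \<in> reach V {x} E" "x \<in> V" "k \<le> card (reach V {x} E)" for v x
      using that reach_eq[of x V v E] reach_subset[of "{x}" V E] by (auto simp: large_vertices_def)
    moreover have "\<exists>x\<in>V. v \<in> reach V {x} E \<and> k \<le> card (reach V {x} E)" if "v \<in> large_vertices V E k" for v
      using that reach_incl[of "{v}" V E] by (auto simp: large_vertices_def)
    ultimately have "v \<in> large_vertices V E k \<longleftrightarrow> (\<exists>x\<in>V. v \<in> reach V {x} E \<and> k \<le> card (reach V {x} E))" for v
      by blast
    then show ?thesis unfolding components_eq_reach[OF E] by blast
  qed
  show ?thesis unfolding U
  proof (rule card_Union_disjoint)
    show "pairwise disjnt ?C"
    proof (rule pairwiseI)
      fix A B assume AB: "A \<in> ?C" "B \<in> ?C" "A \<noteq> B"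
      then obtain x y where xy: "x \<in> V" "y \<in> V" "A = reach V {x} E" "B = reach V {y} E"
        by (auto simp: components_eq_reach[OF E])
      have "A = B" if "z \<in> A" "z \<in> B" for z
        using that xy reach_eq[of x V z E] reach_eq[of y V z E] by simp
      with AB(3) show "disjnt A B" by (auto simp: disjnt_def)
    qed
    fix A assume "A \<in> ?C"
    then obtain x where "x \<in> V" "A = reach V {x} E" by (auto simp: components_eq_reach[OF E])
    then have "A \<subseteq> V" using reach_subset[of "{x}" V E] by simp
    then show "finite A" using fin finite_subset by blast
  qed
qed

text \<open>Different ranks are different positions of the sorted list of sizes, hence different
  components even when sizes tie, and both consist of vertices counted on the right. The condition
  \<open>k > 0\<close> excludes the default value 0 of a missing rank.\<close>

lemma comp_size_sum_le:
  assumes ij: "i \<ge> 1" "j \<ge> 1" "i \<noteq> j" and k: "k > 0" "k \<le> comp_size V E i" "k \<le> comp_size V E j"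
  shows "comp_size V E i + comp_size V E j \<le> card (large_vertices V E k)"
proof -
  let ?M = "image_mset card (mset_set (components V E))"
  define s where "s = rev (sorted_list_of_multiset ?M)"
  have cs: "comp_size V E l = (if 1 \<le> l \<and> l \<le> length s then s ! (l - 1) else 0)" for l
    by (simp add: comp_size_def s_def Let_def)
  have le: "i \<le> length s" "j \<le> length s" using k cs[of i] cs[of j] by (auto split: if_splits)
  have finC: "finite (components V E)" using fin by (simp add: components_eq_reach[OF E])
  have "card (large_vertices V E k) = sum_mset (filter_mset ((\<le>) k) ?M)"
    unfolding card_large_vertices_components using finC
    by (simp add: filter_mset_image_mset sum_unfold_sum_mset filter_mset_mset_set comp_def)
  also have "?M = mset s" by (simp add: s_def)
  also have "sum_mset (filter_mset ((\<le>) k) (mset s)) = (\<Sum>x\<leftarrow>s. if k \<le> x then x else 0)"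
    by (induction s) auto
  also have "\<dots> = (\<Sum>l<length s. if k \<le> s ! l then s ! l else 0)"
    by (simp add: sum_list_sum_nth atLeast0LessThan)
  also have "\<dots> \<ge> (\<Sum>l\<in>{i - 1, j - 1}. if k \<le> s ! l then s ! l else 0)"
    using le ij by (intro sum_mono2) auto
  also have "(\<Sum>l\<in>{i - 1, j - 1}. if k \<le> s ! l then s ! l else 0) = s ! (i - 1) + s ! (j - 1)"
    using k le ij cs[of i] cs[of j] by (subst sum.insert) auto
  finally show ?thesis using cs le ij by simp
qed

lemma comp_size_1_le:
  assumes "k > 0" "k \<le> comp_size V E 1"
  shows "comp_size V E 1 \<le> card (large_vertices V E k)"
proof -
  let ?M = "image_mset card (mset_set (components V E))"
  define s where "s = rev (sorted_list_of_multiset ?M)"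
  have cs: "comp_size V E 1 = (if 1 \<le> length s then s ! 0 else 0)"
    by (simp add: comp_size_def s_def Let_def)
  have ne: "1 \<le> length s" using assms cs by (auto split: if_splits)
  have "s ! 0 \<in># ?M"
  proof -
    have "s ! 0 \<in> set s" using ne by (intro nth_mem) auto
    also have "set s = set_mset ?M" by (simp add: s_def)
    finally show ?thesis .
  qed
  moreover have finC: "finite (components V E)" using fin by (simp add: components_eq_reach[OF E])
  ultimately obtain K where K: "K \<in> components V E" "card K = s ! 0" by auto
  then have "card K \<le> (\<Sum>K | K \<in> components V E \<and> k \<le> card K. card K)"
    using assms cs ne finC by (intro member_le_sum) auto
  then show ?thesis using K cs ne by (simp add: card_large_vertices_components)
qed

lemma card_reach_le_comp_size_1:
  assumes "v \<in> V"
  shows "card (reach V {v} E) \<le> comp_size V E 1"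
proof -
  let ?M = "image_mset card (mset_set (components V E))"
  define s where "s = sorted_list_of_multiset ?M"
  have finC: "finite (components V E)" using fin by (simp add: components_eq_reach[OF E])
  have "card (reach V {v} E) \<in># ?M"
    using assms finC by (simp add: components_eq_reach[OF E])
  also have "set_mset ?M = set s" by (simp add: s_def)
  finally have m: "card (reach V {v} E) \<in> set s" .
  then have "s \<noteq> []" by auto
  moreover have "sorted s" by (simp add: s_def)
  ultimately have "x \<le> last s" if "x \<in> set s" for x
    using that sorted_nth_mono[of s _ "length s - 1"] by (fastforce simp: in_set_conv_nth last_conv_nth)
  then have "card (reach V {v} E) \<le> last s" using m by blast
  also have "last s = comp_size V E 1"
    using \<open>s \<noteq> []\<close> by (simp add: comp_size_def s_def[symmetric] hd_rev[symmetric] hd_conv_nth Let_def Suc_le_eq)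
  finally show ?thesis .
qed

end

lemma comp_size_1_mono:
  assumes "finite V" "E \<subseteq> E'" "E' \<subseteq> V \<times> V"
  shows "comp_size V E 1 \<le> comp_size V E' 1"
proof (cases "comp_size V E 1 = 0")
  case False
  let ?k = "comp_size V E 1"
  have "?k \<le> card (large_vertices V E ?k)" using assms False by (intro comp_size_1_le) auto
  then have "large_vertices V E ?k \<noteq> {}" using False by auto
  then obtain v where v: "v \<in> V" "?k \<le> card (reach V {v} E')"
    using large_vertices_mono[OF assms(1,2), of ?k] by (auto simp: large_vertices_def)
  then show ?thesis using card_reach_le_comp_size_1[of V E' v] assms by simp
qed auto

section \<open>Upper bound: vertices in large components\<close>

definition pairs :: "nat set \<Rightarrow> (nat \<times> nat) set" where
  "pairs V = {(i, j). i \<in> V \<and> j \<in> V \<and> i \<le> j}"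

definition edge :: "nat \<Rightarrow> nat \<Rightarrow> nat \<times> nat" where
  "edge i j = (min i j, max i j)"

lemma vertex_pairs_eq_pairs: "vertex_pairs n = pairs {1..n}"
  by (auto simp: vertex_pairs_def pairs_def)

lemma finite_pairs [simp]: "finite V \<Longrightarrow> finite (pairs V)"
  by (rule finite_subset[of _ "V \<times> V"]) (auto simp: pairs_def)

lemma pairs_mono: "U \<subseteq> V \<Longrightarrow> pairs U \<subseteq> pairs V"
  by (auto simp: pairs_def)

lemma edge_in_pairs [simp]: "edge i j \<in> pairs V \<longleftrightarrow> i \<in> V \<and> j \<in> V"
  by (auto simp: edge_def pairs_def min_def max_def)

lemma inj_edge: "inj (edge v)"
  by (auto simp: inj_def edge_def min_def max_def split: if_splits)

lemma adjacent_iff_edge: "X \<subseteq> pairs V \<Longrightarrow> adjacent X i j \<longleftrightarrow> edge i j \<in> X"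
  by (auto simp: adjacent_def edge_def pairs_def min_def max_def)

text \<open>Induction on \<open>V\<close>, processing one vertex \<open>v\<close> of
  \<open>A\<close>. Given the edges at \<open>v\<close>, the rest of the cluster lies in the cluster
  of \<open>A - {v}\<close> and the new neighbours within \<open>V - {v}\<close>, where all edges
  are still fresh, so the induction hypothesis applies; averaging over the edges at \<open>v\<close>
  produces the product in \<open>sol\<close>. The recursion is imposed once on the ambient set
  \<open>W\<close> and survives the shrinking of \<open>V\<close> because all factors are at most 1.
  Cycles help: a vertex found twice costs one factor of \<open>h\<close> instead of two.\<close>

lemma expectation_exp_reach_ge:
  fixes t :: real
  assumes W: "finite W" "V \<subseteq> W" and A: "A \<subseteq> V" and th: "t \<ge> 0"
    and q: "\<And>e. e \<in> pairs W \<Longrightarrow> 0 \<le> q e \<and> q e \<le> 1"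
    and h: "\<And>v. v \<in> W \<Longrightarrow> 0 \<le> h v \<and> h v \<le> 1"
    and sol: "\<And>v. v \<in> W \<Longrightarrow> h v \<le> exp (- t) * (\<Prod>j\<in>W - {v}. 1 - q (edge v j) * (1 - h j))"
  shows "(\<Prod>v\<in>A. h v) \<le>
    measure_pmf.expectation (random_subset (pairs V) q) (\<lambda>E. exp (- t * card (reach V A E)))"
proof -
  have "finite V" using W finite_subset by auto
  then show ?thesis using W(2) A
  proof (induction V arbitrary: A rule: finite_psubset_induct)
    case (psubset V)
    show ?case
    proof (cases "A = {}")
      case True
      have "reach V {} E = {}" for E by (simp add: reach_def)
      then show ?thesis using True by simp
    next
      case False
      then obtain v where v: "v \<in> A" by auto
      let ?U = "V - {v}" and ?inc = "{e \<in> pairs V. fst e = v \<or> snd e = v}"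
      let ?N = "\<lambda>X. {y \<in> ?U. adjacent X v y}"
      let ?h = "\<lambda>(i, j). if i = j then 1 else if i = v then h j else h i"
      let ?E = "measure_pmf.expectation (random_subset (pairs ?U) q)"
        and ?F = "measure_pmf.expectation (random_subset ?inc q)"
        and ?p = "\<Prod>y\<in>A - {v}. h y" and ?f = "\<lambda>j. 1 - q (edge v j) * (1 - h j)"
      have [simp]: "finite V" "v \<in> V" using psubset v by auto
      have sp: "pairs V = ?inc \<union> pairs ?U" by (auto simp: pairs_def)
      have dj: "?inc \<inter> pairs ?U = {}" by (auto simp: pairs_def)
      have fin: "finite ?inc" "finite (pairs ?U)" by auto
      have hW: "0 \<le> h y \<and> h y \<le> 1" if "y \<in> V" for y using that h psubset by auto
      have hedge: "?h (edge v j) = h j" if "j \<noteq> v" for j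
        using that by (auto simp: edge_def min_def max_def)
      have img: "?inc - {(v, v)} = edge v ` ?U"
      proof (intro equalityI subsetI)
        fix e assume "e \<in> ?inc - {(v, v)}"
        moreover obtain i j where "e = (i, j)" by (cases e)
        ultimately have e: "e = (i, j)" "i \<in> V" "j \<in> V" "i \<le> j" "i = v \<or> j = v" "(i, j) \<noteq> (v, v)"
          by (auto simp: pairs_def)
        then have "e = edge v (if i = v then j else i)" "(if i = v then j else i) \<in> ?U"
          by (auto simp: edge_def)
        then show "e \<in> edge v ` ?U" by (rule image_eqI)
      next
        fix e assume "e \<in> edge v ` ?U"
        then obtain j where "e = edge v j" "j \<in> V" "j \<noteq> v" by auto
        then show "e \<in> ?inc - {(v, v)}"
          by (auto simp: edge_def pairs_def min_def max_def)
      qed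
      have step: "?p * exp (- t) * (\<Prod>e\<in>X. ?h e) \<le>
         ?E (\<lambda>Y. exp (- t * card (reach V A (X \<union> Y))))"
        if X: "X \<in> set_pmf (random_subset ?inc q)" for X
      proof -
        have Xs: "X \<subseteq> ?inc" using X set_random_subset by blast
        have finX: "finite X" using Xs fin finite_subset by blast
        have eX: "X - {(v, v)} = edge v ` ?N X"
        proof -
          have "adjacent X v y \<longleftrightarrow> edge v y \<in> X" for y
            using Xs by (intro adjacent_iff_edge[of _ V]) auto
          then have "edge v ` ?N X = edge v ` ?U \<inter> X" by auto
          moreover have "X - {(v, v)} = (?inc - {(v, v)}) \<inter> X" using Xs by blast
          ultimately show ?thesis by (simp only: img)
        qed
        have "(\<Prod>e\<in>X. ?h e) = (\<Prod>e\<in>X - {(v, v)}. ?h e)"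
          using finX by (intro prod.mono_neutral_right) auto
        also have "\<dots> = (\<Prod>y\<in>?N X. h y)"
          unfolding eX by (subst prod.reindex) (auto intro!: prod.cong simp: hedge inj_on_subset[OF inj_edge])
        finally have pX: "(\<Prod>e\<in>X. ?h e) = (\<Prod>y\<in>?N X. h y)" .
        let ?B = "A - {v} \<union> ?N X"
        \<comment> \<open>A neighbour that already lies in \<open>A\<close> has its factor counted
          twice on the left, and factors are at most 1.\<close>
        have "?p * (\<Prod>y\<in>?N X. h y) \<le> (\<Prod>y\<in>?B. h y)"
        proof -
          have fA: "finite (A - {v})" "finite (?N X)"
            using psubset.prems by (auto intro: finite_subset[of _ V])
          have "?p * (\<Prod>y\<in>?N X. h y) = (\<Prod>y\<in>?B. h y) * (\<Prod>y\<in>(A - {v}) \<inter> ?N X. h y)"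
            using fA by (simp add: prod.union_inter)
          also have "\<dots> \<le> (\<Prod>y\<in>?B. h y) * 1"
            using psubset.prems hW by (intro mult_left_mono prod_le_1 prod_nonneg) auto
          finally show ?thesis by simp
        qed
        also have "\<dots> \<le> ?E (\<lambda>Y. exp (- t * card (reach ?U ?B Y)))"
          using psubset.prems by (intro psubset.IH) auto
        finally have IH: "?p * (\<Prod>y\<in>?N X. h y) \<le> \<dots>" .
        have "?p * exp (- t) * (\<Prod>e\<in>X. ?h e) =
           exp (- t) * (?p * (\<Prod>y\<in>?N X. h y))" by (simp add: pX)
        also have "\<dots> \<le> exp (- t) * ?E (\<lambda>Y. exp (- t * card (reach ?U ?B Y)))"
          by (intro mult_left_mono IH) auto
        also have "\<dots> = ?E (\<lambda>Y. exp (- t * (1 + card (reach ?U ?B Y))))"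
        proof -
          have "exp (- t * (1 + real c)) = exp (- t) * exp (- t * c)" for c :: nat
            by (simp add: mult_exp_exp algebra_simps)
          then show ?thesis by (simp only: of_nat_add of_nat_1 integral_mult_right_zero)
        qed
        also have "\<dots> \<le> ?E (\<lambda>Y. exp (- t * card (reach V A (X \<union> Y))))"
        proof (intro integral_mono_AE AE_pmfI)
          fix Y assume "Y \<in> set_pmf (random_subset (pairs ?U) q)"
          then have Ys: "Y \<subseteq> pairs ?U" using set_random_subset by blast
          have NB: "?N (X \<union> Y) = ?N X" using Ys by (auto simp: adjacent_def pairs_def)
          \<comment> \<open>Every edge of \<open>X\<close> touches \<open>v\<close>, so none of them
            acts inside \<open>V - {v}\<close>.\<close>
          have "reach ?U ?B (X \<union> Y) = reach ?U ?B Y"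
          proof -
            have "(X \<union> Y) \<inter> ?U \<times> ?U = Y \<inter> ?U \<times> ?U" using Xs by auto
            then have "reach ?U ?B ((X \<union> Y) \<inter> ?U \<times> ?U) = reach ?U ?B (Y \<inter> ?U \<times> ?U)" by (rule arg_cong)
            then show ?thesis unfolding reach_Int_Times .
          qed
          then have "reach V A (X \<union> Y) \<subseteq> insert v (reach ?U ?B Y)"
            using reach_explore[of v A V "X \<union> Y"] v psubset.prems NB by simp
          moreover have finR: "finite (reach ?U ?B Y)"
          proof (rule finite_subset)
            show "reach ?U ?B Y \<subseteq> ?U" using psubset.prems by (intro reach_subset) auto
          qed simp
          ultimately have "card (reach V A (X \<union> Y)) \<le> card (insert v (reach ?U ?B Y))"
            by (intro card_mono) simp_all
          also have "\<dots> \<le> Suc (card (reach ?U ?B Y))"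
            using finR by (simp add: card_insert_if)
          finally have "real (card (reach V A (X \<union> Y))) \<le> 1 + card (reach ?U ?B Y)" by simp
          then show "exp (- t * (1 + card (reach ?U ?B Y))) \<le> exp (- t * card (reach V A (X \<union> Y)))"
            using th by (simp add: mult_left_mono)
        qed auto
        finally show ?thesis .
      qed
      have "(\<Prod>y\<in>A. h y) = ?p * h v"
        using v psubset.prems by (subst prod.remove[of A v]) (auto intro: finite_subset[of _ V])
      also have "\<dots> \<le> ?p * (exp (- t) * (\<Prod>j\<in>W - {v}. ?f j))"
        using sol[of v] psubset.prems v hW by (intro mult_left_mono prod_nonneg) auto
      \<comment> \<open>The dropped factors belong to vertices of \<open>W\<close> outside
        \<open>V\<close> and are at most 1.\<close>
      also have "\<dots> \<le> ?p * (exp (- t) * (\<Prod>j\<in>?U. ?f j))"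
      proof (intro mult_left_mono)
        have f: "0 \<le> ?f j \<and> ?f j \<le> 1" if "j \<in> W" for j
        proof -
          have "v \<in> W" using psubset.prems v by auto
          then show ?thesis using q[of "edge v j"] h[of j] that by (auto intro!: mult_le_one)
        qed
        have "(\<Prod>j\<in>W - {v}. ?f j) =
            (\<Prod>j\<in>W - {v} - ?U. ?f j) * (\<Prod>j\<in>?U. ?f j)"
          using W psubset.prems by (intro prod.subset_diff) auto
        also have "\<dots> \<le> 1 * (\<Prod>j\<in>?U. ?f j)"
          using f psubset.prems by (intro mult_right_mono prod_le_1 prod_nonneg) auto
        finally show "(\<Prod>j\<in>W - {v}. ?f j) \<le> (\<Prod>j\<in>?U. ?f j)"
          by simp
      qed (use psubset.prems hW in \<open>auto intro!: prod_nonneg\<close>)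
      also have "(\<Prod>j\<in>?U. ?f j) = (\<Prod>e\<in>?inc. 1 - q e * (1 - ?h e))"
      proof -
        have "(\<Prod>e\<in>?inc. 1 - q e * (1 - ?h e)) = (\<Prod>e\<in>?inc - {(v, v)}. 1 - q e * (1 - ?h e))"
          using fin by (intro prod.mono_neutral_right) auto
        also have "\<dots> = (\<Prod>j\<in>?U. ?f j)"
          unfolding img by (subst prod.reindex) (auto intro!: prod.cong simp: hedge inj_on_subset[OF inj_edge])
        finally show ?thesis ..
      qed
      also have "(\<Prod>e\<in>?inc. 1 - q e * (1 - ?h e)) = ?F (\<lambda>X. \<Prod>e\<in>X. ?h e)"
      proof (rule expectation_random_subset_prod[symmetric, OF fin(1)])
        show "0 \<le> q e \<and> q e \<le> 1" if "e \<in> ?inc" for e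
          using q[of e] pairs_mono[OF psubset.prems(1)] that by blast
        show "0 \<le> ?h e" if "e \<in> ?inc" for e
          using that hW by (auto simp: pairs_def)
      qed
      also have "?p * (exp (- t) * \<dots>) =
          ?F (\<lambda>X. ?p * exp (- t) * (\<Prod>e\<in>X. ?h e))"
        by simp
      also have "\<dots> \<le> ?F
          (\<lambda>X. ?E (\<lambda>Y. exp (- t * card (reach V A (X \<union> Y)))))"
        using fin by (intro integral_mono_AE AE_pmfI step) auto
      also have "\<dots> = measure_pmf.expectation (random_subset (pairs V) q) (\<lambda>E. exp (- t * card (reach V A E)))"
        unfolding arg_cong[OF sp, of "\<lambda>I. random_subset I q"]
        by (rule expectation_random_subset_Un[OF fin dj, symmetric])
      finally show ?thesis .
    qed
  qed
qed

text \<open>\<open>1 - exp (- t * k)\<close> times the indicator of a cluster of size at least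
  \<open>k\<close> is at most \<open>1 - exp (- t * size)\<close>, and the mean of the latter is at
  most \<open>1 - h v\<close>. So \<open>t\<close> acts as a killing rate that detects clusters of
  size well above \<open>1 / t\<close>.\<close>

lemma expectation_large_vertices_le:
  fixes t :: real
  assumes V: "finite V" and th: "t \<ge> 0"
    and q: "\<And>e. e \<in> pairs V \<Longrightarrow> 0 \<le> q e \<and> q e \<le> 1"
    and h: "\<And>v. v \<in> V \<Longrightarrow> 0 \<le> h v \<and> h v \<le> 1"
    and sol: "\<And>v. v \<in> V \<Longrightarrow> h v \<le> exp (- t) * (\<Prod>j\<in>V - {v}. 1 - q (edge v j) * (1 - h j))"
  shows "(1 - exp (- t * k)) * measure_pmf.expectation (random_subset (pairs V) q) (\<lambda>E. card (large_vertices V E k))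
    \<le> (\<Sum>v\<in>V. 1 - h v)"
proof -
  let ?M = "measure_pmf (random_subset (pairs V) q)"
  have fin: "finite (pairs V)" using V by simp
  let ?c = "\<lambda>v E. card (reach V {v} E)"
  have c: "real (card (large_vertices V E k)) = (\<Sum>v\<in>V. if k \<le> ?c v E then 1 else 0)" for E
    using V by (simp add: large_vertices_def sum.If_cases Int_def)
  have "(1 - exp (- t * k)) * (\<integral>E. card (large_vertices V E k) \<partial>?M)
     = (\<integral>E. (\<Sum>v\<in>V. (1 - exp (- t * k)) * (if k \<le> ?c v E then 1 else 0)) \<partial>?M)"
    by (simp only: c sum_distrib_left[symmetric] integral_mult_right_zero)
  also have "\<dots> \<le> (\<integral>E. (\<Sum>v\<in>V. 1 - exp (- t * ?c v E)) \<partial>?M)"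
  proof (intro integral_mono sum_mono)
    fix E v assume "v \<in> V"
    show "(1 - exp (- t * k)) * (if k \<le> ?c v E then 1 else 0) \<le> 1 - exp (- t * ?c v E)"
      using th by (auto simp: mult_left_mono)
  qed (use fin in auto)
  also have "\<dots> = (\<Sum>v\<in>V. 1 - (\<integral>E. exp (- t * ?c v E) \<partial>?M))"
    using fin by (simp add: Bochner_Integration.integral_sum Bochner_Integration.integral_diff)
  also have "\<dots> \<le> (\<Sum>v\<in>V. 1 - h v)"
  proof (intro sum_mono diff_left_mono)
    fix v assume "v \<in> V"
    then show "h v \<le> (\<integral>E. exp (- t * ?c v E) \<partial>?M)"
      using expectation_exp_reach_ge[OF V order_refl, of "{v}" t q h] assms by auto
  qed
  finally show ?thesis .
qed

text \<open>The chord of the convex exponential between \<open>- x\<close> and 0. It replaces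
  Bernoulli neighbours by Poisson ones below, and later gives the concavity of reaching
  probabilities in the pressure.\<close>

lemma exp_chord:
  fixes t x :: real
  assumes "0 \<le> t \<and> t \<le> 1"
  shows "exp (- (x * (1 - t))) \<le> 1 - (1 - exp (- x)) * (1 - t)"
proof -
  have "exp ((1 - t) *\<^sub>R (- x) + t *\<^sub>R 0) \<le> (1 - t) * exp (- x) + t * exp 0"
    using assms convex_onD[OF exp_convex, of t "- x" 0] by simp
  then show ?thesis by (simp add: algebra_simps)
qed

text \<open>The edge rates have rank one, so the ansatz \<open>exp (- t - u * w v)\<close> collapses
  the recursion for a function on the vertices to the single scalar inequality \<open>sol\<close>
  for \<open>u\<close>.\<close>

lemma rank_one_large_vertices_le:
  fixes t u b :: real
  assumes V: "finite V" and th: "t \<ge> 0" and u: "u \<ge> 0" and b: "b \<ge> 0"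
    and w: "\<And>v. v \<in> V \<Longrightarrow> 0 \<le> w v"
    and sol: "b * (\<Sum>j\<in>V. w j * (1 - exp (- t - u * w j))) \<le> u"
  shows "(1 - exp (- t * k)) * measure_pmf.expectation
      (random_subset (pairs V) (\<lambda>(i, j). 1 - exp (- (b * (w i * w j))))) (\<lambda>E. card (large_vertices V E k))
    \<le> t * card V + u * (\<Sum>v\<in>V. w v)"
proof -
  let ?q = "\<lambda>(i, j). 1 - exp (- (b * (w i * w j)))" and ?h = "\<lambda>v. exp (- t - u * w v)"
  have h: "0 \<le> ?h v \<and> ?h v \<le> 1" if "v \<in> V" for v
    using th mult_nonneg_nonneg[OF u w[OF that]] by auto
  have "(1 - exp (- t * k)) * measure_pmf.expectation (random_subset (pairs V) ?q) (\<lambda>E. card (large_vertices V E k))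
      \<le> (\<Sum>v\<in>V. 1 - ?h v)"
  proof (rule expectation_large_vertices_le[OF V th _ h])
    fix v assume v: "v \<in> V"
    have f: "exp (- (b * (w v * w j) * (1 - ?h j))) \<le> 1 - ?q (edge v j) * (1 - ?h j)" if "j \<in> V" for j
    proof -
      have "?q (edge v j) = 1 - exp (- (b * (w v * w j)))"
        by (auto simp: edge_def min_def max_def mult.commute)
      then show ?thesis using exp_chord[of "?h j" "b * (w v * w j)"] h[OF that] by (simp only:)
    qed
    have "- (u * w v) \<le> - (b * w v * (\<Sum>j\<in>V. w j * (1 - ?h j)))"
      using mult_left_mono[OF sol w[OF v]] by (simp add: algebra_simps)
    also have "\<dots> \<le> - (\<Sum>j\<in>V - {v}. b * (w v * w j) * (1 - ?h j))"
    proof -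
      have "(\<Sum>j\<in>V - {v}. b * (w v * w j) * (1 - ?h j)) \<le> (\<Sum>j\<in>V. b * (w v * w j) * (1 - ?h j))"
        using V b w h v by (intro sum_mono2) (auto intro!: mult_nonneg_nonneg)
      then show ?thesis by (simp add: sum_distrib_left mult_ac)
    qed
    also have "\<dots> = (\<Sum>j\<in>V - {v}. - (b * (w v * w j) * (1 - ?h j)))" by (simp add: sum_negf)
    finally have "?h v \<le> exp (- t) * exp (\<Sum>j\<in>V - {v}. - (b * (w v * w j) * (1 - ?h j)))"
      by (simp add: exp_add[symmetric])
    also have "\<dots> = exp (- t) * (\<Prod>j\<in>V - {v}. exp (- (b * (w v * w j) * (1 - ?h j))))"
      using V by (simp add: exp_sum)
    also have "\<dots> \<le> exp (- t) * (\<Prod>j\<in>V - {v}. 1 - ?q (edge v j) * (1 - ?h j))"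
      using f by (intro mult_left_mono prod_mono) auto
    finally show "?h v \<le> exp (- t) * (\<Prod>j\<in>V - {v}. 1 - ?q (edge v j) * (1 - ?h j))" .
  qed (use b w in \<open>auto simp: pairs_def\<close>)
  also have "\<dots> \<le> (\<Sum>v\<in>V. t + u * w v)"
  proof (intro sum_mono)
    fix v show "1 - ?h v \<le> t + u * w v" using exp_ge_add_one_self[of "- t - u * w v"] by linarith
  qed
  also have "\<dots> = t * card V + u * (\<Sum>v\<in>V. w v)" by (simp add: sum.distrib sum_distrib_left)
  finally show ?thesis .
qed

section \<open>Lower bound: neighbours of an explored set\<close>

lemma one_minus_exp_ge:
  fixes y :: real
  assumes "y \<ge> 0"
  shows "y - y\<^sup>2 / 2 \<le> 1 - exp (- y)"
proof -
  have pos: "0 < 1 + y + y\<^sup>2 / 2" using assms by (simp add: add_pos_nonneg)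
  have "exp (- y) = 1 / exp y" by (simp add: exp_minus divide_inverse)
  also have "\<dots> \<le> 1 / (1 + y + y\<^sup>2 / 2)"
    using exp_lower_Taylor_quadratic[OF assms] pos by (intro divide_left_mono) auto
  also have "\<dots> \<le> 1 - y + y\<^sup>2 / 2"
  proof -
    have "(1 - y + y\<^sup>2 / 2) * (1 + y + y\<^sup>2 / 2) = 1 + (y\<^sup>2)\<^sup>2 / 4"
      by (simp add: algebra_simps power2_eq_square)
    then have "1 \<le> (1 - y + y\<^sup>2 / 2) * (1 + y + y\<^sup>2 / 2)" by simp
    then show ?thesis using pos by (simp add: divide_le_eq)
  qed
  finally show ?thesis by simp
qed

text \<open>Exponential moments for the lower tail. The true probabilities \<open>r\<close> enter
  through lower bounds \<open>s\<close>, because the edge probabilities will be known from below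
  only.\<close>

lemma random_subset_Chernoff:
  fixes x r s :: "'e \<Rightarrow> real"
  assumes B: "finite B" and r: "\<And>j. j \<in> B \<Longrightarrow> r j \<le> 1" and s: "\<And>j. j \<in> B \<Longrightarrow> 0 \<le> s j \<and> s j \<le> r j"
    and x: "\<And>j. j \<in> B \<Longrightarrow> 0 \<le> x j \<and> x j \<le> b" and b: "b > 0" and eps: "0 \<le> \<epsilon>"
  defines "m \<equiv> \<Sum>j\<in>B. x j * s j"
  shows "measure_pmf.prob (random_subset B r) {N. (\<Sum>j\<in>N. x j) \<le> (1 - \<epsilon>) * m} \<le> exp (- (\<epsilon>\<^sup>2 * m / (2 * b)))"
proof -
  let ?P = "random_subset B r"
  \<comment> \<open>With this tilt \<open>t * x j\<close> is at most \<epsilon>, so the quadratic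
    term of the exponential loses at most the fraction \<open>\<epsilon> / 2\<close>. The deviation
    gains the fraction \<epsilon>, which leaves \<open>t * \<epsilon> * m / 2\<close> in the
    exponent.\<close>
  define t where "t = \<epsilon> / b"
  have t: "t \<ge> 0" "t * b = \<epsilon>" using eps b by (auto simp: t_def)
  have "measure_pmf.prob ?P {N. (\<Sum>j\<in>N. x j) \<le> (1 - \<epsilon>) * m}
      = measure_pmf.expectation ?P (indicator {N. (\<Sum>j\<in>N. x j) \<le> (1 - \<epsilon>) * m})" by simp
  also have "\<dots> \<le> measure_pmf.expectation ?P (\<lambda>N. exp (t * (1 - \<epsilon>) * m) * (\<Prod>j\<in>N. exp (- (t * x j))))"
  proof (intro integral_mono_AE AE_pmfI)
    fix N assume "N \<in> set_pmf ?P"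
    then have "finite N" using set_random_subset[of B r] B finite_subset by blast
    then have "exp (t * (1 - \<epsilon>) * m) * (\<Prod>j\<in>N. exp (- (t * x j))) = exp (t * ((1 - \<epsilon>) * m - (\<Sum>j\<in>N. x j)))"
      by (simp add: exp_sum[symmetric] sum_negf sum_distrib_left[symmetric] mult_exp_exp algebra_simps)
    then show "indicator {N. (\<Sum>j\<in>N. x j) \<le> (1 - \<epsilon>) * m} N \<le> exp (t * (1 - \<epsilon>) * m) * (\<Prod>j\<in>N. exp (- (t * x j)))"
      using t by (auto simp: indicator_def)
  qed (use B in auto)
  also have "\<dots> = exp (t * (1 - \<epsilon>) * m) * (\<Prod>j\<in>B. 1 - r j * (1 - exp (- (t * x j))))"
  proof -
    have "measure_pmf.expectation ?P (\<lambda>N. \<Prod>j\<in>N. exp (- (t * x j)))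
        = (\<Prod>j\<in>B. 1 - r j * (1 - exp (- (t * x j))))"
    proof (rule expectation_random_subset_prod[OF B])
      show "0 \<le> r j \<and> r j \<le> 1" if "j \<in> B" for j using r[OF that] s[OF that] by linarith
    qed simp
    then show ?thesis by (simp only: integral_mult_right_zero)
  qed
  also have "\<dots> \<le> exp (t * (1 - \<epsilon>) * m) * (\<Prod>j\<in>B. exp (- (t * (1 - \<epsilon> / 2) * (x j * s j))))"
  proof (intro mult_left_mono prod_mono conjI)
    fix j assume j: "j \<in> B"
    have y: "0 \<le> t * x j" "t * x j \<le> \<epsilon>"
      using t x[OF j] mult_left_mono[of "x j" b t] by auto
    have e: "0 \<le> 1 - exp (- (t * x j))" "1 - exp (- (t * x j)) \<le> 1" using y by auto
    show "0 \<le> 1 - r j * (1 - exp (- (t * x j)))"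
      using r[OF j] s[OF j] e mult_le_one[of "r j" "1 - exp (- (t * x j))"] by auto
    have "t * x j * (1 - \<epsilon> / 2) \<le> t * x j - (t * x j)\<^sup>2 / 2"
      using mult_left_mono[OF y(2,1)] by (simp add: power2_eq_square algebra_simps)
    also have "\<dots> \<le> 1 - exp (- (t * x j))" by (rule one_minus_exp_ge[OF y(1)])
    finally have "s j * (t * x j * (1 - \<epsilon> / 2)) \<le> s j * (1 - exp (- (t * x j)))"
      using s[OF j] by (intro mult_left_mono) auto
    also have "\<dots> \<le> r j * (1 - exp (- (t * x j)))" using s[OF j] e by (intro mult_right_mono) auto
    finally have "1 - r j * (1 - exp (- (t * x j))) \<le> 1 + (- (t * (1 - \<epsilon> / 2) * (x j * s j)))"
      by (simp add: algebra_simps)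
    also have "\<dots> \<le> exp (- (t * (1 - \<epsilon> / 2) * (x j * s j)))" by (rule exp_ge_add_one_self)
    finally show "1 - r j * (1 - exp (- (t * x j))) \<le> exp (- (t * (1 - \<epsilon> / 2) * (x j * s j)))" .
  qed auto
  also have "(\<Prod>j\<in>B. exp (- (t * (1 - \<epsilon> / 2) * (x j * s j)))) = exp (- (t * (1 - \<epsilon> / 2) * m))"
    using B by (simp add: exp_sum[symmetric] sum_negf m_def sum_distrib_left)
  also have "exp (t * (1 - \<epsilon>) * m) * exp (- (t * (1 - \<epsilon> / 2) * m)) = exp (- (\<epsilon>\<^sup>2 * m / (2 * b)))"
    using b by (simp add: mult_exp_exp t_def power2_eq_square field_simps)
  finally show ?thesis .
qed

section \<open>Neighbours of a set in a disjoint block\<close>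

lemma prod_one_minus_le_exp:
  fixes q :: "'a \<Rightarrow> real"
  assumes "finite S" "\<And>s. s \<in> S \<Longrightarrow> l s \<le> q s \<and> q s \<le> 1"
  shows "(\<Prod>s\<in>S. 1 - q s) \<le> exp (- (\<Sum>s\<in>S. l s))"
proof -
  have "(\<Prod>s\<in>S. 1 - q s) \<le> (\<Prod>s\<in>S. exp (- l s))"
  proof (intro prod_mono conjI)
    fix s assume "s \<in> S"
    then show "0 \<le> 1 - q s" "1 - q s \<le> exp (- l s)"
      using assms(2)[of s] exp_ge_add_one_self[of "- l s"] by auto
  qed
  then show ?thesis using assms(1) by (simp add: exp_sum[symmetric] sum_negf)
qed

text \<open>The edges from \<open>S\<close> to different vertices of \<open>B\<close> form disjoint
  sets, so these vertices are hit independently, \<open>j\<close> with probability at least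
  \<open>1 - exp (- (\<beta> * v j * \<mu>))\<close>, and the Chernoff bound applies to the set of
  those hit. The ground set \<open>I\<close> stands for the edges not yet exposed.\<close>

lemma prob_few_neighbours:
  fixes x v :: "nat \<Rightarrow> real"
  assumes V: "finite V" "S \<subseteq> V" "B \<subseteq> V" "S \<inter> B = {}"
    and I: "I \<subseteq> pairs V" "\<And>s j. s \<in> S \<Longrightarrow> j \<in> B \<Longrightarrow> edge s j \<in> I"
    and q: "\<And>e. e \<in> pairs V \<Longrightarrow> 0 \<le> q e \<and> q e \<le> 1"
    and lower: "\<And>s j. s \<in> S \<Longrightarrow> j \<in> B \<Longrightarrow> \<beta> * v s * v j \<le> q (edge s j)"
    and v: "\<And>j. j \<in> B \<Longrightarrow> 0 \<le> v j" and \<beta>: "\<beta> \<ge> 0"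
    and x: "\<And>j. j \<in> B \<Longrightarrow> 0 \<le> x j \<and> x j \<le> b" and b: "b > 0" and eps: "0 \<le> \<epsilon>"
    and mu: "0 \<le> \<mu>" "\<mu> \<le> (\<Sum>s\<in>S. v s)"
  defines "m \<equiv> \<Sum>j\<in>B. x j * (1 - exp (- (\<beta> * v j * \<mu>)))"
  shows "measure_pmf.prob (random_subset I q) {E. (\<Sum>j | j \<in> B \<and> (\<exists>s\<in>S. adjacent E s j). x j) \<le> (1 - \<epsilon>) * m}
    \<le> exp (- (\<epsilon>\<^sup>2 * m / (2 * b)))"
proof -
  let ?A = "{E. (\<Sum>j | j \<in> B \<and> (\<exists>s\<in>S. adjacent E s j). x j) \<le> (1 - \<epsilon>) * m}"
  define D where "D = (\<lambda>(s, j). edge s j) ` (S \<times> B)"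
  \<comment> \<open>The end of an edge that lies in \<open>B\<close>; unambiguous on
    \<open>D\<close> because \<open>S\<close> and \<open>B\<close> are disjoint.\<close>
  define g where "g = (\<lambda>(i, j). if i \<in> B then i else j :: nat)"
  have finI: "finite I" "finite B" "finite S" using V I finite_subset finite_pairs by metis+
  have DI: "D \<subseteq> I" using I by (auto simp: D_def)
  have g: "g (edge s j) = j" if "s \<in> S" "j \<in> B" for s j
    using that V by (auto simp: g_def edge_def min_def max_def)
  define r where "r j = 1 - (\<Prod>e | e \<in> D \<and> g e = j. 1 - q e)" for j
  have qD: "0 \<le> q e \<and> q e \<le> 1" if "e \<in> D" for e using that DI I q by blast
  have rj: "1 - exp (- (\<beta> * v j * \<mu>)) \<le> r j" if j: "j \<in> B" for j
  proof -
    have "{e. e \<in> D \<and> g e = j} = edge j ` S"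
    proof -
      have sym: "edge s j = edge j s" for s j by (auto simp: edge_def min_def max_def)
      have "e \<in> edge j ` S" if "e \<in> D" "g e = j" for e
      proof -
        obtain s i where s: "s \<in> S" "i \<in> B" "e = edge s i" using \<open>e \<in> D\<close> by (auto simp: D_def)
        then have "e = edge j s" using g[of s i] \<open>g e = j\<close> sym[of s i] by simp
        then show ?thesis using s(1) by (rule image_eqI)
      qed
      moreover have "e \<in> D \<and> g e = j" if e: "e \<in> edge j ` S" for e
      proof -
        obtain s where s: "s \<in> S" "e = edge j s" using e by blast
        then have "e = edge s j" by (simp only: sym[of s j])
        then show ?thesis using g[of s j] s(1) j by (auto simp: D_def)
      qed
      ultimately show ?thesis by blast
    qed
    then have "(\<Prod>e | e \<in> D \<and> g e = j. 1 - q e) = (\<Prod>s\<in>S. 1 - q (edge j s))"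
      by (simp add: prod.reindex[OF inj_on_subset[OF inj_edge]])
    also have "\<dots> \<le> exp (- (\<Sum>s\<in>S. \<beta> * v j * v s))"
    proof (rule prod_one_minus_le_exp)
      fix s assume s: "s \<in> S"
      have "edge j s = edge s j" by (auto simp: edge_def min_def max_def)
      then show "\<beta> * v j * v s \<le> q (edge j s) \<and> q (edge j s) \<le> 1"
        using lower[OF s j] q[OF subsetD[OF I(1) I(2)[OF s j]]] by (simp add: mult_ac)
    qed (use finI in auto)
    also have "\<dots> \<le> exp (- (\<beta> * v j * \<mu>))"
      using mult_left_mono[OF mu(2), of "\<beta> * v j"] \<beta> v[OF j] by (simp add: sum_distrib_left)
    finally show ?thesis by (simp add: r_def)
  qed
  have r1: "r j \<le> 1" for j using qD by (auto simp: r_def intro!: prod_nonneg)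
  have law: "map_pmf (\<lambda>E. g ` (E \<inter> D)) (random_subset I q) = random_subset B r"
  proof -
    have "map_pmf (\<lambda>E. g ` (E \<inter> D)) (random_subset I q) = map_pmf (\<lambda>X. g ` X) (random_subset D q)"
      unfolding map_Int_random_subset[OF finI(1) DI, symmetric] map_pmf_comp ..
    also have "\<dots> = random_subset B r"
      unfolding r_def using finI qD g
      by (intro map_image_random_subset) (auto simp: D_def)
    finally show ?thesis .
  qed
  have "measure_pmf.prob (random_subset I q) ?A
     = measure_pmf.prob (random_subset I q) ((\<lambda>E. g ` (E \<inter> D)) -` {N. (\<Sum>j\<in>N. x j) \<le> (1 - \<epsilon>) * m})"
  proof (intro measure_pmf.finite_measure_eq_AE AE_pmfI)
    fix E assume "E \<in> set_pmf (random_subset I q)"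
    then have E: "E \<subseteq> pairs V" using set_random_subset[of I q] I by blast
    have "{j. j \<in> B \<and> (\<exists>s\<in>S. adjacent E s j)} = g ` (E \<inter> D)"
      unfolding adjacent_iff_edge[OF E] using g by (force simp: D_def image_iff)
    then show "E \<in> ?A \<longleftrightarrow>
       E \<in> (\<lambda>E. g ` (E \<inter> D)) -` {N. (\<Sum>j\<in>N. x j) \<le> (1 - \<epsilon>) * m}"
      by simp
  qed auto
  also have "\<dots> = measure_pmf.prob (random_subset B r) {N. (\<Sum>j\<in>N. x j) \<le> (1 - \<epsilon>) * m}"
    by (simp add: law[symmetric])
  also have "\<dots> \<le> exp (- (\<epsilon>\<^sup>2 * m / (2 * b)))"
    unfolding m_def using rj r1 v \<beta> mu x b eps finI
    by (intro random_subset_Chernoff) auto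
  finally show ?thesis .
qed

text \<open>\<open>T\<close> is determined by the edges inside \<open>U\<close>. Given these, the
  edges from \<open>T E\<close> to \<open>B\<close> are fresh and \<open>T E\<close> acts as a
  deterministic set. The mass condition on \<open>T E\<close> is random and therefore part of the
  event; where it fails, the event is empty.\<close>

lemma prob_few_fresh_neighbours:
  fixes x v :: "nat \<Rightarrow> real" and T :: "(nat \<times> nat) set \<Rightarrow> nat set"
  assumes V: "finite V" "U \<subseteq> V" "B \<subseteq> V" "U \<inter> B = {}"
    and T: "\<And>E. T E \<subseteq> U" "\<And>E. E \<subseteq> pairs V \<Longrightarrow> T (E \<inter> pairs U) = T E"
    and q: "\<And>e. e \<in> pairs V \<Longrightarrow> 0 \<le> q e \<and> q e \<le> 1"
    and lower: "\<And>s j. s \<in> U \<Longrightarrow> j \<in> B \<Longrightarrow> \<beta> * v s * v j \<le> q (edge s j)"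
    and v: "\<And>j. j \<in> B \<Longrightarrow> 0 \<le> v j" and \<beta>: "\<beta> \<ge> 0"
    and x: "\<And>j. j \<in> B \<Longrightarrow> 0 \<le> x j \<and> x j \<le> b" and b: "b > 0" and eps: "0 \<le> \<epsilon>"
    and mu: "0 \<le> \<mu>"
  defines "m \<equiv> \<Sum>j\<in>B. x j * (1 - exp (- (\<beta> * v j * \<mu>)))"
  shows "measure_pmf.prob (random_subset (pairs V) q)
      {E. \<mu> \<le> (\<Sum>s\<in>T E. v s) \<and> (\<Sum>j | j \<in> B \<and> (\<exists>s\<in>T E. adjacent E s j). x j) \<le> (1 - \<epsilon>) * m}
    \<le> exp (- (\<epsilon>\<^sup>2 * m / (2 * b)))"
proof -
  let ?A = "{E. \<mu> \<le> (\<Sum>s\<in>T E. v s) \<and> (\<Sum>j | j \<in> B \<and> (\<exists>s\<in>T E. adjacent E s j). x j) \<le> (1 - \<epsilon>) * m}"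
  let ?I = "pairs V - pairs U"
  let ?R = "measure_pmf.expectation (random_subset ?I q)"
  let ?c = "exp (- (\<epsilon>\<^sup>2 * m / (2 * b)))"
  have "finite U" using V(1,2) by (rule finite_subset[rotated])
  then have fin: "finite (pairs U)" "finite ?I" using V(1) by simp_all
  have sp: "pairs V = pairs U \<union> ?I" using pairs_mono[OF V(2)] by auto
  have "measure_pmf.prob (random_subset (pairs V) q) ?A = measure_pmf.expectation (random_subset (pairs V) q) (indicator ?A)"
    by simp
  also have "\<dots> = measure_pmf.expectation (random_subset (pairs U) q)
      (\<lambda>X. ?R (\<lambda>Y. indicator ?A (X \<union> Y)))"
    unfolding arg_cong[OF sp, of "\<lambda>I. random_subset I q"]
    by (rule expectation_random_subset_Un) (use fin in auto)
  also have "\<dots> \<le> measure_pmf.expectation (random_subset (pairs U) q) (\<lambda>X. ?c)"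
  proof (intro integral_mono_AE AE_pmfI)
    fix X assume "X \<in> set_pmf (random_subset (pairs U) q)"
    then have X: "X \<subseteq> pairs U" using set_random_subset by blast
    show "?R (\<lambda>Y. indicator ?A (X \<union> Y)) \<le> ?c"
    proof (cases "\<mu> \<le> (\<Sum>s\<in>T X. v s)")
      case True
      have "?R (\<lambda>Y. indicator ?A (X \<union> Y))
         \<le> ?R
            (indicator {Y. (\<Sum>j | j \<in> B \<and> (\<exists>s\<in>T X. adjacent Y s j). x j) \<le> (1 - \<epsilon>) * m} :: _ \<Rightarrow> real)"
      proof (intro integral_mono_AE AE_pmfI)
        fix Y assume "Y \<in> set_pmf (random_subset ?I q)"
        then have Y: "Y \<subseteq> ?I" using set_random_subset by blast
        have "(X \<union> Y) \<inter> pairs U = X" using X Y by blast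
        moreover have "X \<union> Y \<subseteq> pairs V" using X Y sp by blast
        ultimately have TX: "T (X \<union> Y) = T X" using T(2)[of "X \<union> Y"] by simp
        have "adjacent (X \<union> Y) s j \<longleftrightarrow> adjacent Y s j" if "j \<in> B" for s j
          using that X V(4) by (auto simp: adjacent_def pairs_def)
        then have "{j. j \<in> B \<and> (\<exists>s\<in>T X. adjacent (X \<union> Y) s j)} = {j. j \<in> B \<and> (\<exists>s\<in>T X. adjacent Y s j)}"
          by blast
        then show "indicator ?A (X \<union> Y) \<le> (indicator {Y. (\<Sum>j | j \<in> B \<and> (\<exists>s\<in>T X. adjacent Y s j). x j) \<le> (1 - \<epsilon>) * m} Y :: real)"
          by (simp add: TX indicator_def)
      qed (use fin in auto)
      also have "\<dots> = measure_pmf.prob (random_subset ?I q) {Y. (\<Sum>j | j \<in> B \<and> (\<exists>s\<in>T X. adjacent Y s j). x j) \<le> (1 - \<epsilon>) * m}"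
        by simp
      also have "\<dots> \<le> ?c"
        unfolding m_def
      proof (rule prob_few_neighbours[where V = V and v = v])
        show "T X \<subseteq> V" "T X \<inter> B = {}" using T(1)[of X] V by auto
        show "edge s j \<in> ?I" if "s \<in> T X" "j \<in> B" for s j
          using that T(1)[of X] V by auto
        show "\<beta> * v s * v j \<le> q (edge s j)" if "s \<in> T X" "j \<in> B" for s j
          using that T(1)[of X] lower by auto
      qed (use V q v \<beta> x b eps mu True in auto)
      finally show ?thesis .
    next
      case False
      have "?R (\<lambda>Y. indicator ?A (X \<union> Y))
         = ?R (\<lambda>Y. 0 :: real)"
      proof (intro integral_cong_AE AE_pmfI)
        fix Y assume "Y \<in> set_pmf (random_subset ?I q)"
        then have Y: "Y \<subseteq> ?I" using set_random_subset by blast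
        have "(X \<union> Y) \<inter> pairs U = X" using X Y by blast
        moreover have "X \<union> Y \<subseteq> pairs V" using X Y sp by blast
        ultimately have "T (X \<union> Y) = T X" using T(2)[of "X \<union> Y"] by simp
        then show "indicator ?A (X \<union> Y) = (0::real)" using False by simp
      qed auto
      then show ?thesis by simp
    qed
  qed (use fin in auto)
  finally show ?thesis by simp
qed

section \<open>Connectivity of the core\<close>

definition cut_edges :: "nat set \<Rightarrow> nat set \<Rightarrow> (nat \<times> nat) set" where
  "cut_edges D X = (\<lambda>(i, j). edge i j) ` (X \<times> (D - X))"

lemma mem_cut_edges: "e \<in> cut_edges D X \<longleftrightarrow> (\<exists>i\<in>X. \<exists>j\<in>D - X. e = edge i j)"
  by (auto simp: cut_edges_def)

text \<open>Among the unions of components with at most two thirds of the vertices let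
  \<open>X\<close> be a largest. By the cut condition it has less than one third. Adding any further
  component overshoots two thirds, so that component exceeds one third.\<close>

lemma exists_large_component:
  assumes D: "finite D" "D \<noteq> {}"
    and no: "\<And>X. X \<subseteq> D \<Longrightarrow> card D \<le> 3 * card X \<Longrightarrow> 3 * card X \<le> 2 * card D \<Longrightarrow> E \<inter> cut_edges D X \<noteq> {}"
  shows "\<exists>v\<in>D. card D \<le> 3 * card (reach D {v} E)"
proof -
  define closed where "closed X \<longleftrightarrow> X \<subseteq> D \<and> (\<forall>x\<in>X. \<forall>y\<in>D. adjacent E x y \<longrightarrow> y \<in> X)" for X
  define F where "F = {X. closed X \<and> 3 * card X \<le> 2 * card D}"
  have "F \<subseteq> Pow D" by (auto simp: F_def closed_def)
  then have finF: "finite F" using D finite_subset by blast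
  have neF: "{} \<in> F" by (simp add: F_def closed_def)
  obtain X where X: "X \<in> F" "\<And>Y. Y \<in> F \<Longrightarrow> card Y \<le> card X"
    using finF neF Max_in[of "card ` F"] Max_ge[of "card ` F"]
    by (metis (no_types, lifting) empty_iff finite_imageI image_iff)
  have Xs: "X \<subseteq> D" "closed X" "3 * card X \<le> 2 * card D" using X(1) by (auto simp: F_def closed_def)
  have "E \<inter> cut_edges D X = {}"
  proof (rule ccontr)
    assume "E \<inter> cut_edges D X \<noteq> {}"
    then obtain i j where ij: "i \<in> X" "j \<in> D - X" "edge i j \<in> E" by (metis disjoint_iff mem_cut_edges)
    then have "adjacent E i j" by (auto simp: adjacent_def edge_def min_def max_def split: if_splits)
    then show False using ij Xs by (auto simp: closed_def)
  qed
  then have small: "3 * card X < card D" using no[of X] Xs by force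
  have "X \<noteq> D" using small by auto
  then obtain v where v: "v \<in> D" "v \<notin> X" using Xs by auto
  let ?C = "reach D {v} E"
  have C: "?C \<subseteq> D" using v by (intro reach_subset) auto
  have cl: "closed (X \<union> ?C)"
    unfolding closed_def
  proof (intro conjI ballI impI)
    fix x y assume "x \<in> X \<union> ?C" "y \<in> D" "adjacent E x y"
    then show "y \<in> X \<union> ?C"
      using Xs C reach_step[of x D "{v}" E y] by (auto simp: closed_def)
  qed (use Xs C in auto)
  have fin: "finite X" "finite ?C" using D Xs C finite_subset by blast+
  have "card X < card (X \<union> ?C)"
    using v reach_incl[of "{v}" D E] fin by (intro psubset_card_mono) auto
  then have "X \<union> ?C \<notin> F" using X(2) by (meson not_less)
  then have "2 * card D < 3 * card (X \<union> ?C)" using cl by (simp add: F_def)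
  also have "\<dots> \<le> 3 * card X + 3 * card ?C" using card_Un_le[of X ?C] by simp
  finally have "card D \<le> 3 * card ?C" using small by linarith
  then show ?thesis using v by blast
qed

text \<open>A set with between one and two thirds of the core has at least
  \<open>2 / 9 * (card D)\<^sup>2\<close> cut pairs, so by the density condition its cut is empty
  with probability at most \<open>exp (- (8 / 9 * card D))\<close>. This beats the
  \<open>2 ^ card D\<close> choices of the set because \<open>ln 2\<close> is below
  \<open>8 / 9 - 1 / 10\<close>.\<close>

lemma prob_no_large_component_le:
  fixes c :: real
  assumes V: "finite V" "D \<subseteq> V" "D \<noteq> {}"
    and q: "\<And>e. e \<in> pairs V \<Longrightarrow> 0 \<le> q e \<and> q e \<le> 1"
    and lower: "\<And>i j. i \<in> D \<Longrightarrow> j \<in> D \<Longrightarrow> i \<noteq> j \<Longrightarrow> c \<le> q (edge i j)" and c: "4 \<le> c * card D"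
  shows "measure_pmf.prob (random_subset (pairs V) q) {E. \<not> (\<exists>v\<in>D. card D \<le> 3 * card (reach D {v} E))}
    \<le> exp (- (card D / 10))"
proof -
  let ?P = "random_subset (pairs V) q" and ?pr = "measure_pmf.prob (random_subset (pairs V) q)" and ?m = "real (card D)"
  let ?A = "{E. \<not> (\<exists>v\<in>D. card D \<le> 3 * card (reach D {v} E))}"
  define F where "F = {X. X \<subseteq> D \<and> card D \<le> 3 * card X \<and> 3 * card X \<le> 2 * card D}"
  have finD: "finite D" using V finite_subset by blast
  have finF: "finite F" "F \<subseteq> Pow D" using finD by (auto simp: F_def intro: finite_subset[of _ "Pow D"])
  have m: "?m > 0" using V finD by (simp add: card_gt_0_iff)
  have one: "?pr {E. E \<inter> cut_edges D X = {}} \<le> exp (- (8 / 9 * ?m))" if X: "X \<in> F" for X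
  proof -
    have XD: "X \<subseteq> D" and finX: "finite X" using X finD finite_subset by (auto simp: F_def)
    have inj: "inj_on (\<lambda>(i, j). edge i j) (X \<times> (D - X))"
      by (auto simp: inj_on_def edge_def min_def max_def split: if_splits)
    have cV: "cut_edges D X \<subseteq> pairs V"
    proof
      fix e assume "e \<in> cut_edges D X"
      then obtain i j where "i \<in> X" "j \<in> D" "e = edge i j" unfolding mem_cut_edges by blast
      then show "e \<in> pairs V" using XD V(2) edge_in_pairs[of i j V] by blast
    qed
    have cc: "card (cut_edges D X) = card X * (card D - card X)"
      unfolding cut_edges_def card_image[OF inj] using finX finD XD by (simp add: card_cartesian_product card_Diff_subset)
    have "?pr {E. E \<inter> cut_edges D X = {}} = (\<Prod>e\<in>cut_edges D X. 1 - q e)"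
      by (rule prob_random_subset_disjoint[OF finite_pairs[OF V(1)] q cV])
    also have "\<dots> \<le> exp (- (\<Sum>e\<in>cut_edges D X. c))"
    proof (rule prod_one_minus_le_exp)
      show "finite (cut_edges D X)" using finX finD by (simp add: cut_edges_def)
      fix e assume e: "e \<in> cut_edges D X"
      then obtain i j where "i \<in> X" "j \<in> D - X" "e = edge i j" unfolding mem_cut_edges by blast
      then have "c \<le> q e" using lower[of i j] XD by auto
      then show "c \<le> q e \<and> q e \<le> 1" using q[of e] cV e by blast
    qed
    also have "(\<Sum>e\<in>cut_edges D X. c) = c * (real (card X) * (?m - real (card X)))"
      using card_mono[OF finD XD] by (simp add: cc of_nat_diff)
    also have "exp (- (c * (real (card X) * (?m - real (card X))))) \<le> exp (- (8 / 9 * ?m))"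
    proof -
      have "card D \<le> 3 * card X" "3 * card X \<le> 2 * card D" using X by (auto simp: F_def)
      then have a: "?m \<le> 3 * real (card X)" "3 * real (card X) \<le> 2 * ?m" by linarith+
      \<comment> \<open>Concavity of \<open>x * (m - x)\<close>: between \<open>m / 3\<close> and
        \<open>2 * m / 3\<close> it is smallest at the ends.\<close>
      have "0 \<le> (3 * real (card X) - ?m) * (2 * ?m - 3 * real (card X))" using a by (intro mult_nonneg_nonneg) auto
      then have b: "2 / 9 * ?m\<^sup>2 \<le> real (card X) * (?m - real (card X))"
        by (simp add: algebra_simps power2_eq_square)
      have "0 < c * ?m" using c by linarith
      then have c0: "c \<ge> 0" using m by (simp add: zero_less_mult_iff)
      have "8 / 9 * ?m = 2 / 9 * 4 * ?m" by simp
      also have "\<dots> \<le> 2 / 9 * (c * ?m) * ?m" using c m by (intro mult_right_mono) auto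
      also have "\<dots> = c * (2 / 9 * ?m\<^sup>2)" by (simp add: power2_eq_square)
      also have "\<dots> \<le> c * (real (card X) * (?m - real (card X)))" using b c0 by (rule mult_left_mono)
      finally show ?thesis by simp
    qed
    finally show ?thesis .
  qed
  have "?pr ?A
     \<le> ?pr (\<Union>X\<in>F. {E. E \<inter> cut_edges D X = {}})"
  proof (rule measure_pmf.finite_measure_mono)
    show "?A \<subseteq> (\<Union>X\<in>F. {E. E \<inter> cut_edges D X = {}})"
    proof
      fix E assume "E \<in> ?A"
      then show "E \<in> (\<Union>X\<in>F. {E. E \<inter> cut_edges D X = {}})"
        using exists_large_component[OF finD V(3), of E] by (auto simp: F_def)
    qed
  qed simp
  also have "\<dots> \<le> (\<Sum>X\<in>F. ?pr {E. E \<inter> cut_edges D X = {}})"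
    using finF by (intro measure_pmf.finite_measure_subadditive_finite) auto
  also have "\<dots> \<le> (\<Sum>X\<in>F. exp (- (8 / 9 * ?m)))" by (intro sum_mono one)
  also have "\<dots> \<le> 2 ^ card D * exp (- (8 / 9 * ?m))"
  proof -
    have "card F \<le> 2 ^ card D" using card_mono[OF _ finF(2)] finD by (simp add: card_Pow)
    then have "real (card F) \<le> real (2 ^ card D)" by (simp only: of_nat_le_iff)
    then show ?thesis by simp
  qed
  also have "(2::real) ^ card D = exp (?m * ln 2)" by (simp add: exp_of_nat_mult)
  also have "exp (?m * ln 2) * exp (- (8 / 9 * ?m)) = exp (?m * (ln 2 - 8 / 9))"
    by (simp add: mult_exp_exp algebra_simps)
  also have "\<dots> \<le> exp (- (?m / 10))"
  proof -
    have "?m * (ln 2 - 8 / 9) \<le> ?m * (- (1 / 10))"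
      using ln2_le_25_over_36 m by (intro mult_left_mono) auto
    then show ?thesis by simp
  qed
  finally show ?thesis .
qed

text \<open>Call \<beta> times the \<open>v\<close>-mass of a set its pressure. By
  \<open>growth\<close>, pressure \<open>y\<close> creates pressure
  \<open>(1 + \<delta>) * y / R\<close> in each single block. Edges into block \<open>r\<close> are
  fresh only for a cluster that avoids block \<open>r\<close>, so all subsets of blocks are treated
  at once: the cluster over any \<open>K\<close> with at least \<open>R - 1 - J + j\<close> blocks
  has pressure at least \<open>y0 * (1 + \<delta> / 2) ^ j\<close>, capped at \<open>Q\<close>. Each
  step in \<open>j\<close> uses up one block, and the last hypothesis says that even
  \<open>R - J\<close> blocks yield the factor \<open>1 + \<delta> / 2\<close>. The exceptional
  events are indexed by \<open>K\<close>, \<open>r\<close> and \<open>j\<close>, so their number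
  depends on \<open>R\<close> and \<open>J\<close> only.\<close>

lemma layered_giant_component:
  fixes v :: "nat \<Rightarrow> real" and B :: "nat \<Rightarrow> nat set" and \<beta> M y0 Q \<epsilon> \<delta> :: real
  assumes V: "finite V" "D \<subseteq> V" "D \<noteq> {}"
    and B: "\<And>r. r < R \<Longrightarrow> B r \<subseteq> V" "\<And>r. r < R \<Longrightarrow> D \<inter> B r = {}"
      "\<And>r r'. r < R \<Longrightarrow> r' < R \<Longrightarrow> r \<noteq> r' \<Longrightarrow> B r \<inter> B r' = {}"
    and q: "\<And>e. e \<in> pairs V \<Longrightarrow> 0 \<le> q e \<and> q e \<le> 1"
    and lower: "\<And>i j. i \<in> V \<Longrightarrow> j \<in> V \<Longrightarrow> i \<noteq> j \<Longrightarrow> \<beta> * v i * v j \<le> q (edge i j)"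
    and v: "\<And>j. j \<in> V \<Longrightarrow> 0 \<le> v j \<and> v j \<le> M" "\<And>i. i \<in> D \<Longrightarrow> v i = M" and M: "M > 0" and \<beta>: "\<beta> > 0"
    and core: "4 \<le> \<beta> * M * M * card D"
    and y0: "0 < y0" "y0 \<le> Q" "y0 \<le> \<beta> * M * card D / 3"
    and eps: "0 < \<epsilon>" "\<epsilon> < 1" and \<delta>: "\<delta> > 0"
    and growth: "\<And>y r. 0 < y \<Longrightarrow> y \<le> Q \<Longrightarrow> r < R \<Longrightarrow>
      (1 + \<delta>) * y / R \<le> (1 - \<epsilon>) * \<beta> * (\<Sum>i\<in>B r. v i * (1 - exp (- (v i * y))))"
    and J: "Q \<le> y0 * (1 + \<delta> / 2) ^ J" "J < R" "(1 + \<delta> / 2) * R \<le> (real R - J) * (1 + \<delta>)"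
  shows "measure_pmf.prob (random_subset (pairs V) q)
      {E. \<not> (\<exists>s\<in>V. (1 - \<epsilon>) * (\<Sum>r<R. \<Sum>i\<in>B r. 1 - exp (- (v i * Q))) \<le> card (reach V {s} E))}
    \<le> exp (- (card D / 10)) + real (2 ^ R * R * (J + 2)) * exp (- (\<epsilon>\<^sup>2 * y0 / (2 * M * R * \<beta>)))"
proof -
  let ?P = "random_subset (pairs V) q" and ?pr = "measure_pmf.prob (random_subset (pairs V) q)"
  let ?N = "(1 - \<epsilon>) * (\<Sum>r<R. \<Sum>i\<in>B r. 1 - exp (- (v i * Q)))"
  let ?I = "Pow {..<R} \<times> {..<R} \<times> {..J}"
  \<comment> \<open>The starting vertex depends on the edges inside \<open>D\<close> alone, so it
    reveals nothing about the blocks.\<close>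
  define c where "c E = (SOME u. u \<in> D \<and> card D \<le> 3 * card (reach D {u} E))" for E
  define U where "U K = D \<union> (\<Union>r\<in>K. B r)" for K
  \<comment> \<open>Without a large core component \<open>SOME\<close> may leave \<open>D\<close>;
    the intersection keeps \<open>S K E\<close> inside \<open>U K\<close> for every
    \<open>E\<close>, as the fresh-edge lemma requires.\<close>
  define S where "S K E = reach (U K) ({c E} \<inter> D) E" for K E
  define nb where "nb K r E = {j \<in> B r. \<exists>s\<in>S (K - {r}) E. adjacent E s j}" for K r E
  \<comment> \<open>Capped at \<open>Q\<close>, up to which \<open>growth\<close> is
    assumed.\<close>
  define y where "y j = min Q (y0 * (1 + \<delta> / 2) ^ j)" for j :: nat
  have R: "R > 0" using J by simp
  have yj: "0 < y j" "y j \<le> Q" "y0 \<le> y j" for j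
  proof -
    have "1 \<le> (1 + \<delta> / 2) ^ j" using \<delta> by (intro one_le_power) auto
    then have "y0 * 1 \<le> y0 * (1 + \<delta> / 2) ^ j" using y0 by (intro mult_left_mono) auto
    then show "0 < y j" "y j \<le> Q" "y0 \<le> y j" using y0 by (auto simp: y_def)
  qed
  have yJ: "y J = Q" using J by (simp add: y_def)
  have finB: "finite (B r)" if "r < R" for r using B(1)[OF that] V finite_subset by blast
  have UV: "U K \<subseteq> V" if "K \<subseteq> {..<R}" for K using that B(1) V by (auto simp: U_def)
  have SU: "S K E \<subseteq> U K" for K E by (auto simp: S_def U_def intro!: reach_subset)
  define mean where "mean r z = (\<Sum>i\<in>B r. v i * (1 - exp (- (v i * z))))" for r z
  \<comment> \<open>Gives away the factors \<open>1 + \<delta>\<close> and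
    \<open>1 - \<epsilon>\<close> of \<open>growth\<close> to get a plain lower bound for the
    Chernoff exponent.\<close>
  have mean: "z / (R * \<beta>) \<le> mean r z" if "0 < z" "z \<le> Q" "r < R" for r z
  proof -
    have m0: "0 \<le> mean r z" unfolding mean_def using v B(1)[OF that(3)] that
      by (intro sum_nonneg mult_nonneg_nonneg) auto
    have "z / R \<le> (1 + \<delta>) * z / R" using \<delta> that R by (simp add: field_simps)
    also have "\<dots> \<le> (1 - \<epsilon>) * (\<beta> * mean r z)" using growth[OF that] by (simp add: mean_def mult_ac)
    also have "\<dots> \<le> 1 * (\<beta> * mean r z)" using eps \<beta> m0 by (intro mult_right_mono) auto
    finally show ?thesis using \<beta> R by (simp add: field_simps)
  qed
  define X where "X = exp (- (\<epsilon>\<^sup>2 * y0 / (2 * M * R * \<beta>)))"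
  define bad where "bad K r j = {E. y j / \<beta> \<le> (\<Sum>s\<in>S (K - {r}) E. v s) \<and>
      (\<Sum>i\<in>nb K r E. v i) \<le> (1 - \<epsilon>) * mean r (y j)}" for K r j
  define bad' where "bad' r = {E. Q / \<beta> \<le> (\<Sum>s\<in>S ({..<R} - {r}) E. v s) \<and>
      (\<Sum>i\<in>nb {..<R} r E. 1) \<le> (1 - \<epsilon>) * (\<Sum>i\<in>B r. 1 - exp (- (v i * Q)))}" for r
  define bad0 where "bad0 = {E. \<not> (\<exists>u\<in>D. card D \<le> 3 * card (reach D {u} E))}"
  \<comment> \<open>Used with \<open>x = v\<close>, \<open>b = M\<close> for the pressure and with
    \<open>x = 1\<close>, \<open>b = 1\<close> for the final count. The lower bound on
    \<open>x\<close> lets the same error \<open>X\<close> serve both.\<close>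
  have fresh: "?pr {E. z / \<beta> \<le> (\<Sum>s\<in>S (K - {r}) E. v s) \<and>
      (\<Sum>i\<in>nb K r E. x i) \<le> (1 - \<epsilon>) * (\<Sum>i\<in>B r. x i * (1 - exp (- (v i * z))))} \<le> X"
    if K: "K \<subseteq> {..<R}" "r < R" and z: "0 < z" "y0 \<le> z" "z \<le> Q"
      and x: "\<And>j. j \<in> B r \<Longrightarrow> v j / M * b \<le> x j \<and> x j \<le> b" and b: "b > 0" for K r z x b
  proof -
    have xn: "0 \<le> x j" if "j \<in> B r" for j
    proof -
      have "0 \<le> v j / M * b" using v B(1)[OF K(2)] that M b by auto
      then show ?thesis using x[OF that] by linarith
    qed
    have Ud: "U (K - {r}) \<inter> B r = {}" using K B(2,3) by (fastforce simp: U_def)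
    have "?pr {E. z / \<beta> \<le> (\<Sum>s\<in>S (K - {r}) E. v s) \<and>
        (\<Sum>i | i \<in> B r \<and> (\<exists>s\<in>S (K - {r}) E. adjacent E s i). x i)
          \<le> (1 - \<epsilon>) * (\<Sum>i\<in>B r. x i * (1 - exp (- (\<beta> * v i * (z / \<beta>)))))}
      \<le> exp (- (\<epsilon>\<^sup>2 * (\<Sum>i\<in>B r. x i * (1 - exp (- (\<beta> * v i * (z / \<beta>))))) / (2 * b)))"
    proof (rule prob_few_fresh_neighbours[where V = V and U = "U (K - {r})" and v = v])
      show "U (K - {r}) \<subseteq> V" using K by (intro UV) auto
      fix E assume E: "E \<subseteq> pairs V"
      let ?U = "U (K - {r})"
      have UU: "?U \<subseteq> V" using K by (intro UV) auto
      have eq: "E \<inter> pairs ?U = E \<inter> ?U \<times> ?U" using E by (auto simp: pairs_def)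
      have "reach D {u} (E \<inter> pairs ?U) = reach D {u} E" for u
      proof -
        have "(E \<inter> pairs ?U) \<inter> D \<times> D = E \<inter> D \<times> D" unfolding eq by (auto simp: U_def)
        then have "reach D {u} ((E \<inter> pairs ?U) \<inter> D \<times> D) = reach D {u} (E \<inter> D \<times> D)" by (rule arg_cong)
        then show ?thesis unfolding reach_Int_Times .
      qed
      then have "c (E \<inter> pairs ?U) = c E" by (simp add: c_def)
      then show "S (K - {r}) (E \<inter> pairs ?U) = S (K - {r}) E"
        unfolding S_def eq reach_Int_Times by simp
    next
      show "\<beta> * v s * v j \<le> q (edge s j)" if "s \<in> U (K - {r})" "j \<in> B r" for s j
      proof (rule lower)
        show "s \<in> V" using that UV[of "K - {r}"] K by auto
        show "j \<in> V" using that B(1)[OF K(2)] by auto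
        show "s \<noteq> j" using that Ud by auto
      qed
      show "0 \<le> v j" if "j \<in> B r" for j using that v B(1)[OF K(2)] by auto
      show "0 \<le> x j \<and> x j \<le> b" if "j \<in> B r" for j using x[OF that] xn[OF that] by simp
    qed (use V B(1)[OF K(2)] Ud SU q \<beta> b eps z in auto)
    moreover have "\<beta> * v i * (z / \<beta>) = v i * z" for i using \<beta> by simp
    ultimately have "?pr {E. z / \<beta> \<le> (\<Sum>s\<in>S (K - {r}) E. v s) \<and>
        (\<Sum>i\<in>nb K r E. x i) \<le> (1 - \<epsilon>) * (\<Sum>i\<in>B r. x i * (1 - exp (- (v i * z))))}
      \<le> exp (- (\<epsilon>\<^sup>2 * (\<Sum>i\<in>B r. x i * (1 - exp (- (v i * z)))) / (2 * b)))"
      unfolding nb_def by simp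
    also have "\<dots> \<le> X"
    proof -
      have "y0 / (R * \<beta>) \<le> z / (R * \<beta>)" using z R \<beta> by (intro divide_right_mono) auto
      also have "\<dots> \<le> mean r z" using mean z K by blast
      finally have "b / M * (y0 / (R * \<beta>)) \<le> b / M * mean r z" using b M by (intro mult_left_mono) auto
      also have "\<dots> = (\<Sum>i\<in>B r. (v i / M * b) * (1 - exp (- (v i * z))))"
        by (simp add: mean_def sum_distrib_left mult_ac)
      also have "\<dots> \<le> (\<Sum>i\<in>B r. x i * (1 - exp (- (v i * z))))"
      proof (intro sum_mono mult_right_mono)
        fix i assume i: "i \<in> B r"
        have "0 \<le> v i * z" using v B(1)[OF K(2)] i z by auto
        then show "0 \<le> 1 - exp (- (v i * z))" by simp
      qed (use x in auto)
      finally have "\<epsilon>\<^sup>2 / (2 * b) * (b / M * (y0 / (R * \<beta>))) \<le> \<epsilon>\<^sup>2 / (2 * b) * (\<Sum>i\<in>B r. x i * (1 - exp (- (v i * z))))"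
        using b by (intro mult_left_mono) auto
      moreover have "\<epsilon>\<^sup>2 / (2 * b) * (b / M * (y0 / (R * \<beta>))) = \<epsilon>\<^sup>2 * y0 / (2 * M * R * \<beta>)"
        using b by simp
      ultimately show ?thesis by (simp add: X_def)
    qed
    finally show ?thesis .
  qed
  have pbad: "?pr (bad K r j) \<le> X" if "K \<subseteq> {..<R}" "r < R" for K r j
    unfolding bad_def mean_def using that yj v B(1)[OF that(2)] M
    by (intro fresh[where b = M]) auto
  have pbad': "?pr (bad' r) \<le> X" if "r < R" for r
  proof -
    have "?pr {E. Q / \<beta> \<le> (\<Sum>s\<in>S ({..<R} - {r}) E. v s) \<and>
      (\<Sum>i\<in>nb {..<R} r E. 1) \<le> (1 - \<epsilon>) * (\<Sum>i\<in>B r. 1 * (1 - exp (- (v i * Q))))} \<le> X"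
      using that y0 v B(1)[OF that] M by (intro fresh[where b = 1]) auto
    then show ?thesis by (simp add: bad'_def)
  qed
  have pbad0: "?pr bad0 \<le> exp (- (card D / 10))"
    unfolding bad0_def
  proof (rule prob_no_large_component_le[where c = "\<beta> * M * M"])
    show "\<beta> * M * M \<le> q (edge i j)" if "i \<in> D" "j \<in> D" "i \<noteq> j" for i j
      using lower[of i j] that V v(2) by auto
  qed (use V q core in auto)
  let ?BAD = "bad0 \<union> ((\<Union>(K, r, j)\<in>?I. bad K r j) \<union> (\<Union>r<R. bad' r))"
  have good: "\<exists>s\<in>V. ?N \<le> card (reach V {s} E)"
    if E: "E \<notin> ?BAD" for E
  proof -
    have "\<exists>u. u \<in> D \<and> card D \<le> 3 * card (reach D {u} E)" using E by (auto simp: bad0_def)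
    then have cE: "c E \<in> D" "card D \<le> 3 * card (reach D {c E} E)"
      unfolding c_def by (rule someI2_ex; blast)+
    have Sc: "S K E = reach (U K) {c E} E" for K using cE by (simp add: S_def)
    have Smono: "S K E \<subseteq> S K' E" if "K \<subseteq> K'" for K K'
      unfolding Sc using that by (intro reach_mono) (auto simp: U_def)
    have finS: "finite (S K E)" if "K \<subseteq> {..<R}" for K
      by (rule finite_subset[OF subset_trans[OF SU UV[OF that]] V(1)])
    have vS: "0 \<le> v s" if "s \<in> S K E" "K \<subseteq> {..<R}" for s K
      using SU[of K E] UV[OF that(2)] that v by auto
    have nbS: "nb K r E \<subseteq> S K E \<inter> B r" if "K \<subseteq> {..<R}" "r \<in> K" for K r
    proof
      fix i assume "i \<in> nb K r E"
      then obtain s where s: "i \<in> B r" "s \<in> S (K - {r}) E" "adjacent E s i" by (auto simp: nb_def)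
      have "s \<in> S K E" using s Smono[of "K - {r}" K] by auto
      moreover have "s \<in> U K" using \<open>s \<in> S K E\<close> SU by auto
      moreover have "i \<in> U K" using s that by (auto simp: U_def)
      ultimately have "i \<in> S K E" using s(3) reach_step[of s "U K" "{c E}" E i] by (simp add: Sc)
      then show "i \<in> S K E \<inter> B r" using s by simp
    qed
    have split: "(\<Sum>r\<in>K. \<Sum>i\<in>nb K r E. x i) \<le> (\<Sum>i\<in>S K E. x i)"
      if K: "K \<subseteq> {..<R}" and x: "\<And>i. i \<in> S K E \<Longrightarrow> 0 \<le> (x i :: real)" for K x
    proof -
      have "(\<Sum>r\<in>K. \<Sum>i\<in>nb K r E. x i) = (\<Sum>i\<in>(\<Union>r\<in>K. nb K r E). x i)"
      proof (rule sum.UNION_disjoint[symmetric])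
        show "finite K" using K finite_subset by blast
        show "\<forall>r\<in>K. finite (nb K r E)" using finB K by (auto simp: nb_def)
        show "\<forall>r\<in>K. \<forall>r'\<in>K. r \<noteq> r' \<longrightarrow> nb K r E \<inter> nb K r' E = {}"
        proof (intro ballI impI)
          fix r r' assume "r \<in> K" "r' \<in> K" "r \<noteq> r'"
          then have "B r \<inter> B r' = {}" using B(3)[of r r'] K by auto
          then show "nb K r E \<inter> nb K r' E = {}" by (auto simp: nb_def)
        qed
      qed
      also have "\<dots> \<le> (\<Sum>i\<in>S K E. x i)"
        using nbS[OF K] finS[OF K] x by (intro sum_mono2) auto
      finally show ?thesis .
    qed
    \<comment> \<open>At \<open>j = J\<close> the threshold is \<open>R - 1\<close>, one less than
      all blocks, so that in the final count every block can be the omitted one.\<close>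
    have mass: "y j / \<beta> \<le> (\<Sum>s\<in>S K E. v s)" if "j \<le> J" "K \<subseteq> {..<R}" "R - 1 - J + j \<le> card K" for j K
      using that
    proof (induction j arbitrary: K)
      case 0
      have sub: "reach D {c E} E \<subseteq> S K E" unfolding Sc by (intro reach_mono) (auto simp: U_def)
      have RD: "reach D {c E} E \<subseteq> D" using cE by (intro reach_subset) auto
      have "y 0 / \<beta> \<le> M * (card D / 3)" using y0 \<beta> by (simp add: y_def field_simps)
      also have "\<dots> \<le> M * card (reach D {c E} E)" using cE(2) M by (intro mult_left_mono) auto
      also have "\<dots> = (\<Sum>s\<in>reach D {c E} E. v s)" using RD v(2) by (simp add: subset_iff)
      also have "\<dots> \<le> (\<Sum>s\<in>S K E. v s)"
        using sub finS[OF 0(2)] vS[OF _ 0(2)] by (intro sum_mono2) auto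
      finally show ?case .
    next
      case (Suc j)
      have finK: "finite K" using Suc.prems finite_subset by blast
      have cK: "real R - J \<le> card K" using Suc.prems J by linarith
      have each: "(1 + \<delta>) * y j / R / \<beta> \<le> (\<Sum>i\<in>nb K r E. v i)" if r: "r \<in> K" for r
      proof -
        have rR: "r < R" using r Suc.prems by auto
        have "y j / \<beta> \<le> (\<Sum>s\<in>S (K - {r}) E. v s)"
          using Suc.prems r finK by (intro Suc.IH) auto
        moreover have "E \<notin> bad K r j" using E Suc.prems rR by auto
        ultimately have "(1 - \<epsilon>) * mean r (y j) < (\<Sum>i\<in>nb K r E. v i)" by (auto simp: bad_def)
        moreover have "(1 + \<delta>) * y j / R / \<beta> \<le> (1 - \<epsilon>) * mean r (y j)"
          using growth[OF yj(1,2)[of j] rR] unfolding mean_def pos_divide_le_eq[OF \<beta>]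
          by (simp only: mult_ac)
        ultimately show ?thesis by simp
      qed
      have "y (Suc j) \<le> (1 + \<delta> / 2) * y j"
      proof -
        define a where "a = y0 * (1 + \<delta> / 2) ^ j"
        have "1 * Q \<le> (1 + \<delta> / 2) * Q" using \<delta> y0 by (intro mult_right_mono) auto
        moreover have "y (Suc j) = min Q ((1 + \<delta> / 2) * a)" "y j = min Q a"
          by (simp_all add: y_def a_def mult_ac)
        ultimately show ?thesis by (simp add: min_def)
      qed
      also have "\<dots> = (1 + \<delta> / 2) * R * (y j / R)" using R by simp
      also have "\<dots> \<le> (real R - J) * (1 + \<delta>) * (y j / R)"
        using J(3) yj(1)[of j] R by (intro mult_right_mono) auto
      also have "\<dots> \<le> card K * (1 + \<delta>) * (y j / R)"
        using cK yj(1)[of j] \<delta> by (intro mult_right_mono) auto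
      finally have "y (Suc j) / \<beta> \<le> card K * (1 + \<delta>) * (y j / R) / \<beta>"
        using \<beta> by (intro divide_right_mono) auto
      also have "\<dots> = (\<Sum>r\<in>K. (1 + \<delta>) * y j / R / \<beta>)" by (simp add: mult_ac)
      also have "\<dots> \<le> (\<Sum>r\<in>K. \<Sum>i\<in>nb K r E. v i)" by (intro sum_mono each)
      also have "\<dots> \<le> (\<Sum>s\<in>S K E. v s)" using Suc.prems vS by (intro split) auto
      finally show ?case .
    qed
    have "?N = (\<Sum>r<R. (1 - \<epsilon>) * (\<Sum>i\<in>B r. 1 - exp (- (v i * Q))))"
      by (simp add: sum_distrib_left)
    also have "\<dots> \<le> (\<Sum>r<R. \<Sum>i\<in>nb {..<R} r E. 1)"
    proof (rule sum_mono)
      fix r assume r: "r \<in> {..<R}"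
      have "y J / \<beta> \<le> (\<Sum>s\<in>S ({..<R} - {r}) E. v s)"
        using r J by (intro mass) auto
      moreover have "E \<notin> bad' r" using E r by blast
      ultimately show "(1 - \<epsilon>) * (\<Sum>i\<in>B r. 1 - exp (- (v i * Q))) \<le> (\<Sum>i\<in>nb {..<R} r E. 1)"
        by (auto simp: bad'_def yJ)
    qed
    also have "\<dots> \<le> (\<Sum>i\<in>S {..<R} E. 1)" by (intro split) auto
    also have "\<dots> = card (S {..<R} E)" by simp
    also have "\<dots> \<le> card (reach V {c E} E)"
    proof -
      have "S {..<R} E \<subseteq> reach V {c E} E" unfolding Sc using UV by (intro reach_mono) auto
      moreover have "finite (reach V {c E} E)"
        using reach_subset[of "{c E}" V E] cE V finite_subset by blast
      ultimately show ?thesis by (simp add: card_mono)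
    qed
    finally show ?thesis using cE V by blast
  qed
  have "?pr {E. \<not> (\<exists>s\<in>V. ?N \<le> card (reach V {s} E))}
     \<le> ?pr ?BAD"
  proof (rule measure_pmf.finite_measure_mono)
    show "{E. \<not> (\<exists>s\<in>V. ?N \<le> card (reach V {s} E))} \<subseteq> ?BAD"
      using good by (intro subsetI, elim CollectE) (rule ccontr, blast)
  qed simp
  also have "\<dots> \<le> ?pr bad0 +
     (?pr (\<Union>(K, r, j)\<in>?I. bad K r j) + ?pr (\<Union>r<R. bad' r))"
    by (intro order_trans[OF measure_Un_le] add_left_mono measure_Un_le) auto
  also have "\<dots> \<le> exp (- (card D / 10)) + (real (2 ^ R * (R * (J + 1))) * X + R * X)"
  proof (intro add_mono pbad0)
    have "?pr (\<Union>(K, r, j)\<in>?I. bad K r j)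
        \<le> (\<Sum>t\<in>?I. ?pr (case t of (K, r, j) \<Rightarrow> bad K r j))"
      by (intro measure_pmf.finite_measure_subadditive_finite) auto
    also have "\<dots> \<le> (\<Sum>t\<in>?I. X)"
      using pbad by (intro sum_mono) auto
    also have "\<dots> = real (2 ^ R * (R * (J + 1))) * X"
      by (simp add: card_cartesian_product card_Pow)
    finally show "?pr (\<Union>(K, r, j)\<in>?I. bad K r j) \<le> \<dots>" .
    have "?pr (\<Union>r<R. bad' r) \<le> (\<Sum>r<R. ?pr (bad' r))"
      by (intro measure_pmf.finite_measure_subadditive_finite) auto
    also have "\<dots> \<le> (\<Sum>r<R. X)" using pbad' by (intro sum_mono) auto
    finally show "?pr (\<Union>r<R. bad' r) \<le> R * X" by simp
  qed
  also have "\<dots> \<le> exp (- (card D / 10)) + real (2 ^ R * R * (J + 2)) * X"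
  proof -
    \<comment> \<open>The \<open>R\<close> events of the final count are absorbed by replacing
      \<open>J + 1\<close> by \<open>J + 2\<close>.\<close>
    have "real R * 1 \<le> real R * 2 ^ R" by (intro mult_left_mono) auto
    then have "real (2 ^ R * (R * (J + 1))) + R \<le> real (2 ^ R * R * (J + 2))"
      by (simp add: algebra_simps)
    then have "(real (2 ^ R * (R * (J + 1))) + R) * X \<le> real (2 ^ R * R * (J + 2)) * X"
      by (intro mult_right_mono) (auto simp: X_def)
    then show ?thesis by (simp add: algebra_simps)
  qed
  finally show ?thesis unfolding X_def .
qed

section \<open>Power-law sums\<close>

lemma integral_le_left_sum:
  fixes f :: "real \<Rightarrow> real"
  assumes f: "\<And>x y. 0 < x \<Longrightarrow> x \<le> y \<Longrightarrow> f y \<le> f x" "continuous_on {0<..} f" and x0: "0 < x0" and d: "0 < d"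
  shows "integral {x0..x0 + real k * d} f \<le> d * (\<Sum>i<k. f (x0 + real i * d))"
proof (induction k)
  case (Suc k)
  let ?b = "x0 + real k * d"
  have b: "0 < ?b" "x0 \<le> ?b" "?b + d = x0 + real (Suc k) * d" using x0 d by (auto simp: add_pos_nonneg algebra_simps)
  have int: "f integrable_on {s..t}" if "0 < s" for s t
    using that by (intro integrable_continuous_interval continuous_on_subset[OF f(2)]) auto
  have "integral {x0..?b + d} f = integral {x0..?b} f + integral {?b..?b + d} f"
    using b x0 d by (intro Henstock_Kurzweil_Integration.integral_combine[symmetric] int) auto
  also have "integral {?b..?b + d} f \<le> integral {?b..?b + d} (\<lambda>_. f ?b)"
    using b d by (intro integral_le int) (auto intro!: f(1))
  also have "\<dots> = d * f ?b" using d by simp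
  finally show ?case using Suc b by (simp add: algebra_simps)
qed simp

text \<open>\<open>f\<close> may be singular at 0, so the first cell is kept apart and the integral
  starts at \<open>h\<close>.\<close>

lemma right_sum_le_integral:
  fixes f :: "real \<Rightarrow> real"
  assumes f: "\<And>x y. 0 < x \<Longrightarrow> x \<le> y \<Longrightarrow> f y \<le> f x" "continuous_on {0<..} f" and h: "0 < h"
  shows "h * (\<Sum>i=1..Suc k. f (real i * h)) \<le> h * f h + integral {h..real (Suc k) * h} f"
proof (induction k)
  case (Suc k)
  let ?b = "real (Suc k) * h"
  have b: "0 < ?b" "h \<le> ?b" "?b + h = real (Suc (Suc k)) * h" using h by (auto simp: algebra_simps add_pos_nonneg)
  have int: "f integrable_on {s..t}" if "0 < s" for s t
    using that by (intro integrable_continuous_interval continuous_on_subset[OF f(2)]) auto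
  have "h * f (?b + h) = integral {?b..?b + h} (\<lambda>_. f (?b + h))" using h by simp
  also have "\<dots> \<le> integral {?b..?b + h} f"
  proof (rule integral_le)
    show "f (?b + h) \<le> f x" if "x \<in> {?b..?b + h}" for x
      using that b(1) unfolding atLeastAtMost_iff by (intro f(1)) linarith+
  qed (use int[OF b(1)] in auto)
  also have "\<dots> = integral {h..?b + h} f - integral {h..?b} f"
    using Henstock_Kurzweil_Integration.integral_combine[of h ?b "?b + h" f] b h int by simp
  finally have "h * f (?b + h) \<le> integral {h..?b + h} f - integral {h..?b} f" .
  then show ?case using Suc unfolding b(3) by (simp add: distrib_left)
qed simp

text \<open>A vertex with \<open>w * y = x powr (- \<alpha>)\<close> contributes
  \<open>w * (1 - exp (- (w * y))) = kern \<alpha> x / y\<close> to the weighted sum at pressure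
  \<open>y\<close>.\<close>

definition kern :: "real \<Rightarrow> real \<Rightarrow> real" where
  "kern \<alpha> x = x powr (- \<alpha>) * (1 - exp (- (x powr (- \<alpha>))))"

text \<open>The kernel is nonnegative, so the supremum over compact intervals is the improper
  integral over the positive half-line. Intervals with \<open>b < a\<close> contribute 0.\<close>

definition kern_total :: "real \<Rightarrow> real" where
  "kern_total \<alpha> = (SUP (a, b) \<in> {0<..} \<times> UNIV. integral {a..b} (kern \<alpha>))"

context
  fixes \<alpha> :: real
  assumes alpha: "1 / 2 < \<alpha>" "\<alpha> < 1"
begin

lemma kern_nonneg: "0 \<le> kern \<alpha> x"
  by (simp add: kern_def)

lemma kern_pos: "0 < x \<Longrightarrow> 0 < kern \<alpha> x"
  by (simp add: kern_def)

lemma kern_antimono: "0 < x \<Longrightarrow> x \<le> y \<Longrightarrow> kern \<alpha> y \<le> kern \<alpha> x"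
  unfolding kern_def using alpha by (intro mult_mono diff_left_mono) (auto intro: powr_mono2')

lemma continuous_on_kern: "continuous_on {0<..} (kern \<alpha>)"
  unfolding kern_def by (intro continuous_intros) auto

lemma kern_le: "kern \<alpha> x \<le> x powr (- \<alpha>)"
  unfolding kern_def by (rule mult_left_le) auto

lemma kern_le2: "kern \<alpha> x \<le> x powr (- (2 * \<alpha>))"
proof -
  have "1 - exp (- (x powr (- \<alpha>))) \<le> x powr (- \<alpha>)"
    using exp_ge_add_one_self[of "- (x powr (- \<alpha>))"] by linarith
  then have "kern \<alpha> x \<le> x powr (- \<alpha>) * x powr (- \<alpha>)"
    unfolding kern_def by (intro mult_left_mono) auto
  also have "\<dots> = x powr (- (2 * \<alpha>))" by (simp add: powr_add[symmetric])
  finally show ?thesis .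
qed

lemma integrable_kern: "0 < a \<Longrightarrow> kern \<alpha> integrable_on {a..b}"
  by (intro integrable_continuous_interval continuous_on_subset[OF continuous_on_kern]) auto

lemma integral_kern_mono:
  assumes "0 < a" "a \<le> a'" "b' \<le> b"
  shows "integral {a'..b'} (kern \<alpha>) \<le> integral {a..b} (kern \<alpha>)"
  using assms by (intro integral_subset_le integrable_kern) (auto simp: kern_nonneg)

lemma integral_powr_interval:
  fixes a b e :: real
  assumes "0 < a" "a \<le> b" "e \<noteq> -1"
  shows "integral {a..b} (\<lambda>x. x powr e) = (b powr (e + 1) - a powr (e + 1)) / (e + 1)"
    and "(\<lambda>x. x powr e) integrable_on {a..b}"
proof -
  have "((\<lambda>x. x powr e) has_integral b powr (e + 1) / (e + 1) - a powr (e + 1) / (e + 1)) {a..b}"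
  proof (rule fundamental_theorem_of_calculus)
    fix x assume "x \<in> {a..b}"
    then show "((\<lambda>x. x powr (e + 1) / (e + 1)) has_vector_derivative x powr e) (at x within {a..b})"
      using assms unfolding has_real_derivative_iff_has_vector_derivative[symmetric]
      by (auto intro!: derivative_eq_intros)
  qed fact
  then show "integral {a..b} (\<lambda>x. x powr e) = (b powr (e + 1) - a powr (e + 1)) / (e + 1)"
    and "(\<lambda>x. x powr e) integrable_on {a..b}"
    by (auto simp: integral_unique diff_divide_distrib)
qed

text \<open>The kernel is at most \<open>x powr (- \<alpha>)\<close>, integrable at 0 because
  \<open>\<alpha> < 1\<close>, and at most \<open>x powr (- (2 * \<alpha>))\<close>, integrable at
  infinity because \<open>2 * \<alpha> > 1\<close>. With \<open>\<alpha> = 1 / (\<tau> - 1)\<close>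
  these two conditions are \<open>2 < \<tau>\<close> and \<open>\<tau> < 3\<close>.\<close>

lemma integral_kern_bounded:
  assumes "0 < a"
  shows "integral {a..b} (kern \<alpha>) \<le> 1 / (1 - \<alpha>) + 1 / (2 * \<alpha> - 1)"
proof -
  define a' b' where "a' = min a 1" and "b' = max b 1"
  have ab: "0 < a'" "a' \<le> 1" "1 \<le> b'" "a' \<le> a" "b \<le> b'" using assms by (auto simp: a'_def b'_def)
  have "integral {a..b} (kern \<alpha>) \<le> integral {a'..b'} (kern \<alpha>)"
    using ab by (intro integral_kern_mono) auto
  also have "\<dots> = integral {a'..1} (kern \<alpha>) + integral {1..b'} (kern \<alpha>)"
    using ab by (intro Henstock_Kurzweil_Integration.integral_combine[symmetric] integrable_kern) auto
  also have "integral {a'..1} (kern \<alpha>) \<le> integral {a'..1} (\<lambda>x. x powr (- \<alpha>))"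
    using ab alpha by (intro integral_le integrable_kern integral_powr_interval kern_le) auto
  also have "\<dots> = (1 - a' powr (1 - \<alpha>)) / (1 - \<alpha>)"
    using ab alpha by (subst integral_powr_interval) (auto simp: add.commute)
  also have "\<dots> \<le> 1 / (1 - \<alpha>)" using alpha by (intro divide_right_mono) auto
  also have "integral {1..b'} (kern \<alpha>) \<le> integral {1..b'} (\<lambda>x. x powr (- (2 * \<alpha>)))"
    using ab alpha by (intro integral_le integrable_kern integral_powr_interval kern_le2) auto
  also have "\<dots> = (1 - b' powr (1 - 2 * \<alpha>)) / (2 * \<alpha> - 1)"
  proof -
    have "integral {1..b'} (\<lambda>x. x powr (- (2 * \<alpha>))) = (b' powr (- (2 * \<alpha>) + 1) - 1 powr (- (2 * \<alpha>) + 1)) / (- (2 * \<alpha>) + 1)"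
      using ab alpha by (intro integral_powr_interval) auto
    also have "\<dots> = (1 - b' powr (1 - 2 * \<alpha>)) / (2 * \<alpha> - 1)"
      using alpha by (simp add: field_simps)
    finally show ?thesis .
  qed
  also have "\<dots> \<le> 1 / (2 * \<alpha> - 1)" using alpha by (intro divide_right_mono) auto
  finally show ?thesis by simp
qed

lemma integral_kern_le_total:
  assumes "0 < a"
  shows "integral {a..b} (kern \<alpha>) \<le> kern_total \<alpha>"
proof -
  have "bdd_above ((\<lambda>(a, b). integral {a..b} (kern \<alpha>)) ` ({0<..} \<times> UNIV))"
    using integral_kern_bounded by (intro bdd_aboveI[where M = "1 / (1 - \<alpha>) + 1 / (2 * \<alpha> - 1)"]) auto
  from cSUP_upper[OF _ this, of "(a, b)"] assms show ?thesis by (simp add: kern_total_def)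
qed

lemma kern_total_pos: "0 < kern_total \<alpha>"
proof -
  have "0 < kern \<alpha> 2" by (simp add: kern_pos)
  also have "\<dots> = integral {1..2::real} (\<lambda>_. kern \<alpha> 2)" by simp
  also have "\<dots> \<le> integral {1..2} (kern \<alpha>)"
    by (intro integral_le integrable_kern) (auto intro: kern_antimono)
  also have "\<dots> \<le> kern_total \<alpha>" by (intro integral_kern_le_total) auto
  finally show ?thesis .
qed

lemma integral_kern_approx:
  assumes "x < kern_total \<alpha>"
  obtains a b where "0 < a" "0 < b" "x < integral {a..b} (kern \<alpha>)"
proof -
  have "\<exists>z\<in>{0<..} \<times> UNIV. x < (\<lambda>(a, b). integral {a..b} (kern \<alpha>)) z"
    using assms unfolding kern_total_def by (intro less_cSUP_iff[THEN iffD1])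
      (auto intro!: bdd_aboveI[where M = "1 / (1 - \<alpha>) + 1 / (2 * \<alpha> - 1)"] integral_kern_bounded)
  then obtain a b where ab: "0 < a" "x < integral {a..b} (kern \<alpha>)" by auto
  have "integral {a..b} (kern \<alpha>) \<le> integral {a..max b 1} (kern \<alpha>)"
    using ab by (intro integral_kern_mono) auto
  then show thesis using that[of a "max b 1"] ab by auto
qed

text \<open>A right Riemann sum of a decreasing function exceeds the integral at most by the first
  cell, which the singularity at 0 makes as large as \<open>h powr (1 - \<alpha>)\<close>.\<close>

lemma kern_sum_le:
  assumes "0 < h"
  shows "h * (\<Sum>i=1..n. kern \<alpha> (real i * h)) \<le> kern_total \<alpha> + h powr (1 - \<alpha>)"
proof (cases n)
  case 0
  then show ?thesis using kern_total_pos by (simp add: add_nonneg_nonneg less_imp_le)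
next
  case (Suc k)
  have "h * kern \<alpha> h \<le> h * h powr (- \<alpha>)" using assms kern_le by (intro mult_left_mono) auto
  also have "\<dots> = h powr (1 - \<alpha>)" using assms by (simp add: powr_diff powr_minus divide_inverse)
  finally show ?thesis
    using right_sum_le_integral[OF kern_antimono continuous_on_kern assms, of k]
      integral_kern_le_total[OF assms, of "real (Suc k) * h"] by (simp add: Suc)
qed

lemma sum_powr_le: "(\<Sum>i=1..n. real i powr (- \<alpha>)) \<le> real n powr (1 - \<alpha>) / (1 - \<alpha>)"
proof (induction n)
  case (Suc n)
  have "real (Suc n) powr (- \<alpha>) \<le> (real (Suc n) powr (1 - \<alpha>) - real n powr (1 - \<alpha>)) / (1 - \<alpha>)"
  proof (cases "n = 0")
    case True
    then show ?thesis using alpha by (simp add: field_simps)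
  next
    case False
    have "real (Suc n) powr (- \<alpha>) = integral {real n..real (Suc n)} (\<lambda>_. real (Suc n) powr (- \<alpha>))" by simp
    also have "\<dots> \<le> integral {real n..real (Suc n)} (\<lambda>x. x powr (- \<alpha>))"
      using False alpha by (intro integral_le integral_powr_interval) (auto intro!: powr_mono2')
    also have "\<dots> = (real (Suc n) powr (- \<alpha> + 1) - real n powr (- \<alpha> + 1)) / (- \<alpha> + 1)"
      using False alpha by (intro integral_powr_interval) auto
    finally show ?thesis by (simp add: add.commute)
  qed
  then show ?case using Suc alpha by (simp add: diff_divide_distrib)
qed simp

end

section \<open>The percolation regime\<close>

locale pareto_weights =
  fixes \<tau> C :: real
  assumes tau: "2 < \<tau>" "\<tau> < 3" and C: "C > 0"
begin

definition \<alpha> where "\<alpha> = 1 / (\<tau> - 1)"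
definition c where "c = C powr \<alpha>"
abbreviation w where "w \<equiv> pareto_weight \<tau> C"
definition ell where "ell n = total_weight n (w n)"

text \<open>With this grid width the weighted terms at pressure \<open>y\<close> are values of the kernel:
  \<open>w\<^sub>i y = (i \<cdot> grid n y)\<^bsup>-\<alpha>\<^esup>\<close>.\<close>

definition grid where "grid n y = 1 / (real n * C * y powr (\<tau> - 1))"

lemma alpha: "1 / 2 < \<alpha>" "\<alpha> < 1" "0 < \<alpha>" "(\<tau> - 1) * \<alpha> = 1"
  using tau by (auto simp: \<alpha>_def field_simps)

lemma c_pos: "c > 0"
  using C by (simp add: c_def)

lemma w_eq: "w n i = c * (real n / real i) powr \<alpha>"
  by (simp add: pareto_weight_def c_def \<alpha>_def)

lemma w_nonneg: "0 \<le> w n i"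
  using c_pos by (simp add: w_eq)

lemma w_pos: "0 < n \<Longrightarrow> 0 < i \<Longrightarrow> 0 < w n i"
  using c_pos by (simp add: w_eq)

lemma w_antimono: "0 < i \<Longrightarrow> i \<le> j \<Longrightarrow> w n j \<le> w n i"
  unfolding w_eq using c_pos alpha
  by (intro mult_left_mono powr_mono2 divide_left_mono) auto

lemma w_ge: "0 < i \<Longrightarrow> i \<le> n \<Longrightarrow> c \<le> w n i"
  using w_antimono[of i n n] by (simp add: w_eq)

lemma sum_w_le: "(\<Sum>i=1..k. w n i) \<le> c * real n powr \<alpha> * (real k powr (1 - \<alpha>) / (1 - \<alpha>))"
proof -
  have "(\<Sum>i=1..k. w n i) = c * real n powr \<alpha> * (\<Sum>i=1..k. real i powr (- \<alpha>))"
    by (simp add: w_eq powr_divide powr_minus_divide sum_distrib_left)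
  also have "\<dots> \<le> c * real n powr \<alpha> * (real k powr (1 - \<alpha>) / (1 - \<alpha>))"
    using sum_powr_le[OF alpha(1,2)] c_pos by (intro mult_left_mono) auto
  finally show ?thesis .
qed

lemma ell_ge: "c * real n \<le> ell n"
proof -
  have "(\<Sum>i=1..n. c) \<le> (\<Sum>i=1..n. w n i)" by (intro sum_mono w_ge) auto
  then show ?thesis by (simp add: ell_def total_weight_def mult.commute)
qed

lemma ell_le: "ell n \<le> c * real n / (1 - \<alpha>)"
proof (cases "n = 0")
  case False
  then have "real n powr \<alpha> * real n powr (1 - \<alpha>) = real n" by (simp add: powr_add[symmetric])
  then show ?thesis using sum_w_le[of n n] by (simp add: ell_def total_weight_def mult.assoc)
qed (simp add: ell_def total_weight_def)

lemma ell_pos: "0 < n \<Longrightarrow> 0 < ell n"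
  using ell_ge[of n] c_pos by (smt (verit, best) mult_pos_pos of_nat_0_less_iff)

lemma grid_pos: "0 < n \<Longrightarrow> 0 < y \<Longrightarrow> 0 < grid n y"
  using C by (simp add: grid_def)

lemma w_grid:
  assumes "0 < n" "0 < i" "0 < y"
  shows "w n i * y = (real i * grid n y) powr (- \<alpha>)"
proof -
  have "(real i * grid n y) powr (- \<alpha>) = (real n * C * y powr (\<tau> - 1) / real i) powr \<alpha>"
    using assms C by (simp add: grid_def powr_minus powr_divide)
  also have "\<dots> = (real n / real i) powr \<alpha> * C powr \<alpha> * (y powr (\<tau> - 1)) powr \<alpha>"
    using assms C by (simp add: powr_mult powr_divide)
  also have "(y powr (\<tau> - 1)) powr \<alpha> = y" using alpha assms by (simp add: powr_powr)
  finally show ?thesis by (simp add: w_eq c_def)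
qed

lemma w_kern:
  assumes "0 < n" "0 < i" "0 < y"
  shows "w n i * (1 - exp (- (w n i * y))) = kern \<alpha> (real i * grid n y) / y"
  using assms unfolding kern_def w_grid[OF assms, symmetric] by simp

lemma grid_inverse: "0 < n \<Longrightarrow> 0 < y \<Longrightarrow> 1 / (y * grid n y) = real n * C * y powr (\<tau> - 2)"
proof -
  assume "0 < n" "0 < y"
  then have "y powr (\<tau> - 1) = y * y powr (\<tau> - 2)"
    using powr_add[of y 1 "\<tau> - 2"] by simp
  then show ?thesis using \<open>0 < y\<close> \<open>0 < n\<close> C by (simp add: grid_def)
qed

text \<open>In the grid variable the sum is a Riemann sum of the kernel with mesh
  \<open>grid n y\<close>, and the prefactor \<open>1 / (y * grid n y)\<close> produces
  \<open>y powr (\<tau> - 2)\<close>. The exponent lies strictly between 0 and 1, which is the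
  sublinearity behind both bounds.\<close>

lemma weighted_sum_le:
  assumes "0 < n" "0 < y"
  shows "(\<Sum>i=1..n. w n i * (1 - exp (- (w n i * y))))
    \<le> real n * C * y powr (\<tau> - 2) * (kern_total \<alpha> + grid n y powr (1 - \<alpha>))"
proof -
  let ?h = "grid n y"
  have h: "0 < ?h" using assms by (rule grid_pos)
  have "(\<Sum>i=1..n. w n i * (1 - exp (- (w n i * y)))) = (\<Sum>i=1..n. kern \<alpha> (real i * ?h) / y)"
    using assms by (intro sum.cong w_kern) auto
  also have "\<dots> = 1 / (y * ?h) * (?h * (\<Sum>i=1..n. kern \<alpha> (real i * ?h)))"
    using assms h by (simp add: sum_divide_distrib[symmetric])
  also have "\<dots> \<le> 1 / (y * ?h) * (kern_total \<alpha> + ?h powr (1 - \<alpha>))"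
    using assms h kern_sum_le[OF alpha(1,2) h] by (intro mult_left_mono) auto
  finally show ?thesis using grid_inverse[OF assms] by simp
qed

end

text \<open>The divergence of \<lambda> enters as \<open>p_lower\<close>, because
  \<open>n * p n powr (2 / (3 - \<tau>))\<close> equals
  \<open>lam n powr (2 / (3 - \<tau>))\<close>; the upper bound on \<lambda> enters as
  \<open>p_0\<close>.\<close>

locale percolation_regime = pareto_weights +
  fixes p :: "nat \<Rightarrow> real"
  assumes p_pos: "eventually (\<lambda>n. 0 < p n) sequentially"
    and p_0: "p \<longlonglongrightarrow> 0"
    and p_lower: "filterlim (\<lambda>n. real n * p n powr (2 / (3 - \<tau>))) at_top sequentially"
begin

abbreviation J where "J \<equiv> kern_total \<alpha>"
text \<open>Solution of \<open>u = p n / ell n * (real n * C * J) * u powr (\<tau> - 2)\<close>,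
  where the Riemann sum of \<open>weighted_sum_le\<close> has been replaced by its limit. Keeping
  the true \<open>ell n\<close> makes \<open>s n\<close> match both bounds to first order without
  identifying any limiting constant.\<close>

definition u where "u n = (p n * real n * C * J / ell n) powr (1 / (3 - \<tau>))"
definition s where "s n = u n * ell n"

abbreviation multi_edges where "multi_edges n \<equiv> random_subset (pairs {1..n})
  (\<lambda>(i, j). 1 - exp (- (p n * (w n i * w n j / ell n))))"
abbreviation simple_edges where "simple_edges n \<equiv> random_subset (pairs {1..n})
  (\<lambda>(i, j). if i = j then 0 else p n * (1 - exp (- (w n i * w n j / ell n))))"

lemma J_pos: "0 < J"
  using kern_total_pos alpha by blast

lemma ev_pos: "eventually (\<lambda>n. 0 < n \<and> 0 < p n \<and> p n < 1 \<and> 0 < ell n \<and> 0 < u n) sequentially"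
proof -
  have "eventually (\<lambda>n. p n < 1) sequentially" using p_0 by (rule order_tendstoD) simp
  then show ?thesis using p_pos eventually_gt_at_top[of 0]
  proof eventually_elim
    case (elim n)
    then show ?case using ell_pos[of n] C J_pos by (simp add: u_def)
  qed
qed

lemma u_powr: "0 < n \<Longrightarrow> 0 < p n \<Longrightarrow> p n / ell n = u n powr (3 - \<tau>) / (real n * C * J)"
  using tau C J_pos ell_pos[of n] by (simp add: u_def powr_powr field_simps)

lemma u_bounds:
  assumes "0 < n" "0 < p n"
  shows "(p n * ((1 - \<alpha>) * C * J / c)) powr (1 / (3 - \<tau>)) \<le> u n"
    and "u n \<le> (p n * (C * J / c)) powr (1 / (3 - \<tau>))"
proof -
  have e: "0 < ell n" using ell_pos assms by simp
  have "p n * ((1 - \<alpha>) * C * J / c) = p n * real n * C * J / (c * real n / (1 - \<alpha>))"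
    using assms c_pos alpha by (simp add: field_simps)
  also have "\<dots> \<le> p n * real n * C * J / ell n"
  proof (rule divide_left_mono)
    have "0 < c * real n / (1 - \<alpha>)" using e ell_le[of n] by linarith
    then show "0 < c * real n / (1 - \<alpha>) * ell n" using e by (rule mult_pos_pos)
  qed (use ell_le[of n] assms C J_pos in auto)
  finally show "(p n * ((1 - \<alpha>) * C * J / c)) powr (1 / (3 - \<tau>)) \<le> u n"
    unfolding u_def using assms C J_pos alpha c_pos tau by (intro powr_mono2) auto
  have "p n * real n * C * J / ell n \<le> p n * real n * C * J / (c * real n)"
    using e ell_ge[of n] assms C J_pos c_pos by (intro divide_left_mono) auto
  also have "\<dots> = p n * (C * J / c)" using assms by simp
  finally show "u n \<le> (p n * (C * J / c)) powr (1 / (3 - \<tau>))"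
    unfolding u_def using assms C J_pos e tau by (intro powr_mono2) auto
qed

lemma u_tendsto_0: "u \<longlonglongrightarrow> 0"
proof (rule tendsto_sandwich)
  show "eventually (\<lambda>n. 0 \<le> u n) sequentially" by (simp add: u_def)
  show "eventually (\<lambda>n. u n \<le> (p n * (C * J / c)) powr (1 / (3 - \<tau>))) sequentially"
    using ev_pos by eventually_elim (rule u_bounds(2); simp)
  have "(\<lambda>n. p n * (C * J / c)) \<longlonglongrightarrow> 0 * (C * J / c)" by (intro tendsto_intros p_0)
  moreover have "eventually (\<lambda>n. 0 \<le> p n * (C * J / c)) sequentially"
    using ev_pos by eventually_elim (use C J_pos c_pos in auto)
  ultimately have "(\<lambda>n. (p n * (C * J / c)) powr (1 / (3 - \<tau>))) \<longlonglongrightarrow> 0 powr (1 / (3 - \<tau>))"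
    using tau by (intro tendsto_powr') auto
  then show "(\<lambda>n. (p n * (C * J / c)) powr (1 / (3 - \<tau>))) \<longlonglongrightarrow> 0" by simp
qed simp

text \<open>\<open>u n\<close> is at least of order \<open>p n powr (1 / (3 - \<tau>))\<close>, so
  this is \<open>p_lower\<close>. It makes \<open>w n i * w n j / ell n\<close> small for weights of
  order \<open>1 / u n\<close>, and \<open>s n\<close> large against \<open>1 / u n\<close>.\<close>

lemma n_u_square: "filterlim (\<lambda>n. real n * (u n)\<^sup>2) at_top sequentially"
proof (rule filterlim_at_top_mono)
  define k where "k = (1 - \<alpha>) * C * J / c"
  have k: "k > 0" using alpha C J_pos c_pos by (simp add: k_def)
  let ?K = "k powr (2 / (3 - \<tau>))"
  have K: "?K > 0" using k by auto
  show "filterlim (\<lambda>n. ?K * (real n * p n powr (2 / (3 - \<tau>)))) at_top sequentially"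
    by (rule filterlim_tendsto_pos_mult_at_top[OF tendsto_const K p_lower])
  show "eventually (\<lambda>n. ?K * (real n * p n powr (2 / (3 - \<tau>))) \<le> real n * (u n)\<^sup>2) sequentially"
    using ev_pos
  proof eventually_elim
    case (elim n)
    have "?K * (real n * p n powr (2 / (3 - \<tau>))) = real n * ((p n * k) powr (1 / (3 - \<tau>))) powr 2"
      using elim k by (simp add: powr_powr powr_mult)
    also have "\<dots> \<le> real n * u n powr 2"
      using elim u_bounds(1)[of n] by (intro mult_left_mono powr_mono2) (auto simp: k_def)
    also have "\<dots> = real n * (u n)\<^sup>2" using elim by simp
    finally show ?case .
  qed
qed

text \<open>Up to constants this is the number of vertices of weight at least
  \<open>1 / u n\<close>, hence the size of the core. It exceeds \<open>n * u^2\<close> once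
  \<open>u n < 1\<close>, because \<open>\<tau> - 1 < 2\<close>.\<close>

lemma n_u_powr: "filterlim (\<lambda>n. real n * u n powr (\<tau> - 1)) at_top sequentially"
proof (rule filterlim_at_top_mono[OF n_u_square])
  have "eventually (\<lambda>n. u n < 1) sequentially" using u_tendsto_0 by (rule order_tendstoD) simp
  then show "eventually (\<lambda>n. real n * (u n)\<^sup>2 \<le> real n * u n powr (\<tau> - 1)) sequentially"
    using ev_pos
  proof eventually_elim
    case (elim n)
    then have "(u n)\<^sup>2 = u n powr 2" by simp
    also have "\<dots> \<le> u n powr (\<tau> - 1)" using elim tau by (intro powr_mono') auto
    finally show ?case by (rule mult_left_mono) simp
  qed
qed

lemma grid_tendsto_0:
  assumes "0 < a"
  shows "(\<lambda>n. grid n (a * u n)) \<longlonglongrightarrow> 0"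
proof -
  have "filterlim (\<lambda>n. C * a powr (\<tau> - 1) * (real n * u n powr (\<tau> - 1))) at_top sequentially"
    using C assms by (intro filterlim_tendsto_pos_mult_at_top[OF tendsto_const _ n_u_powr]) auto
  then have "(\<lambda>n. inverse (C * a powr (\<tau> - 1) * (real n * u n powr (\<tau> - 1)))) \<longlonglongrightarrow> 0"
    by (rule tendsto_inverse_0_at_top)
  moreover have "eventually (\<lambda>n. inverse (C * a powr (\<tau> - 1) * (real n * u n powr (\<tau> - 1))) = grid n (a * u n)) sequentially"
    using ev_pos by eventually_elim (use assms in \<open>simp add: grid_def powr_mult divide_inverse mult_ac\<close>)
  ultimately show ?thesis by (rule Lim_transform_eventually)
qed

lemma s_pos: "eventually (\<lambda>n. 0 < s n) sequentially"
  using ev_pos by eventually_elim (simp add: s_def)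

text \<open>\<open>(1 + e) * u n\<close> is a strict supersolution, as the limiting map scales with
  the power \<open>\<tau> - 2 < 1\<close>. The slack between
  \<open>(1 + e) powr (\<tau> - 2)\<close> and \<open>1 + e\<close> pays for the killing rate and
  for the mesh error.\<close>

lemma expected_large_vertices:
  assumes "0 < \<epsilon>" "0 < \<delta>"
  shows "eventually (\<lambda>n. measure_pmf.expectation
      (multi_edges n)
      (\<lambda>E. card (large_vertices {1..n} E (nat \<lceil>\<delta> * s n\<rceil>))) \<le> (1 + \<epsilon>) * s n) sequentially"
proof -
  \<comment> \<open>One \<open>e\<close> each for the supersolution, for the killing term and for
    the division by \<open>1 - exp (- t n * k)\<close>.\<close>
  define e where "e = \<epsilon> / 3"
  have e: "0 < e" using assms by (simp add: e_def)
  define y where "y n = (1 + e) * u n" for n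
  \<comment> \<open>Small enough that the total killing \<open>t n * n\<close> is at most
    \<open>e * s n\<close>, yet large against \<open>1 / s n\<close>, since \<open>t n * s n\<close>
    is of order \<open>n * u^2\<close>.\<close>
  define t where "t n = c * e * u n" for n
  have lim1: "(\<lambda>n. p n * (c * e) + (1 + e) powr (\<tau> - 2) * (1 + grid n (y n) powr (1 - \<alpha>) / J))
      \<longlonglongrightarrow> 0 * (c * e) + (1 + e) powr (\<tau> - 2) * (1 + 0 / J)"
  proof -
    have "(\<lambda>n. grid n (y n)) \<longlonglongrightarrow> 0" unfolding y_def using e by (intro grid_tendsto_0) auto
    moreover have "eventually (\<lambda>n. 0 \<le> grid n (y n)) sequentially"
      using ev_pos by eventually_elim (use e in \<open>auto simp: y_def intro!: less_imp_le[OF grid_pos]\<close>)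
    ultimately have "(\<lambda>n. grid n (y n) powr (1 - \<alpha>)) \<longlonglongrightarrow> 0 powr (1 - \<alpha>)"
      using alpha by (intro tendsto_powr') auto
    then have "(\<lambda>n. grid n (y n) powr (1 - \<alpha>)) \<longlonglongrightarrow> 0" by simp
    then show ?thesis using J_pos by (intro tendsto_intros p_0) auto
  qed
  have "(1 + e) powr (\<tau> - 2) < (1 + e) powr 1" using e tau by (intro powr_less_mono) auto
  then have ev1: "eventually (\<lambda>n. p n * (c * e) + (1 + e) powr (\<tau> - 2) * (1 + grid n (y n) powr (1 - \<alpha>) / J) < 1 + e) sequentially"
    using e by (intro order_tendstoD(2)[OF lim1]) auto
  have "filterlim (\<lambda>n. c * e * \<delta> * c * (real n * (u n)\<^sup>2)) at_top sequentially"
    using e assms c_pos by (intro filterlim_tendsto_pos_mult_at_top[OF tendsto_const _ n_u_square]) auto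
  \<comment> \<open>Ensures that \<open>exp (- t n * k)\<close> is at most
    \<open>e / (1 + 3 * e)\<close>, so that the prefactor is at least
    \<open>(1 + 2 * e) / (1 + 3 * e)\<close>.\<close>
  then have ev2: "eventually (\<lambda>n. ln ((1 + 3 * e) / e) \<le> c * e * \<delta> * c * (real n * (u n)\<^sup>2)) sequentially"
    by (auto simp: filterlim_at_top)
  show ?thesis using ev_pos ev1 ev2
  proof eventually_elim
    case (elim n)
    let ?k = "nat \<lceil>\<delta> * s n\<rceil>" and ?b = "p n / ell n"
    let ?E = "measure_pmf.expectation
      (random_subset (pairs {1..n}) (\<lambda>(i, j). 1 - exp (- (?b * (w n i * w n j)))))
      (\<lambda>E. card (large_vertices {1..n} E ?k))"
    have n: "0 < n" "0 < p n" "0 < ell n" "0 < u n" "0 < y n" "0 < t n"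
      using elim e c_pos by (auto simp: y_def t_def)
    have main: "?b * (\<Sum>j\<in>{1..n}. w n j * (1 - exp (- t n - y n * w n j))) \<le> y n"
    proof -
      have "(\<Sum>j\<in>{1..n}. w n j * (1 - exp (- t n - y n * w n j)))
          \<le> (\<Sum>j\<in>{1..n}. w n j * t n + w n j * (1 - exp (- (w n j * y n))))"
      proof (rule sum_mono)
        fix j
        have "exp (- t n - y n * w n j) = exp (- t n) * exp (- (w n j * y n))"
          by (simp add: mult_exp_exp mult.commute)
        moreover have "(1 - t n) * exp (- (w n j * y n)) \<le> exp (- t n) * exp (- (w n j * y n))"
          using exp_ge_add_one_self[of "- t n"] by (intro mult_right_mono) auto
        moreover have "t n * exp (- (w n j * y n)) \<le> t n * 1"
          using n w_nonneg[of n j] by (intro mult_left_mono) auto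
        ultimately have "1 - exp (- t n - y n * w n j) \<le> t n + (1 - exp (- (w n j * y n)))"
          by (simp add: algebra_simps)
        from mult_left_mono[OF this w_nonneg[of n j]]
        show "w n j * (1 - exp (- t n - y n * w n j)) \<le> w n j * t n + w n j * (1 - exp (- (w n j * y n)))"
          by (simp only: distrib_left)
      qed
      also have "\<dots> = ell n * t n + (\<Sum>j=1..n. w n j * (1 - exp (- (w n j * y n))))"
        by (simp add: sum.distrib sum_distrib_right ell_def total_weight_def)
      also have "\<dots> \<le> ell n * t n + real n * C * y n powr (\<tau> - 2) * (J + grid n (y n) powr (1 - \<alpha>))"
        using n by (intro add_left_mono weighted_sum_le) auto
      finally have "?b * (\<Sum>j\<in>{1..n}. w n j * (1 - exp (- t n - y n * w n j)))
         \<le> ?b * (ell n * t n + real n * C * y n powr (\<tau> - 2) * (J + grid n (y n) powr (1 - \<alpha>)))"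
        using n by (intro mult_left_mono) auto
      also have "\<dots> = p n * t n + ?b * (real n * C * J) * y n powr (\<tau> - 2) * (1 + grid n (y n) powr (1 - \<alpha>) / J)"
        using n J_pos by (simp add: field_simps)
      also have "?b * (real n * C * J) = u n powr (3 - \<tau>)"
        unfolding u_powr[OF n(1,2)] using n C J_pos by simp
      also have "u n powr (3 - \<tau>) * y n powr (\<tau> - 2) = u n * (1 + e) powr (\<tau> - 2)"
      proof -
        have "u n powr (3 - \<tau>) * u n powr (\<tau> - 2) = u n" using n by (simp add: powr_add[symmetric])
        then show ?thesis using n e by (simp add: y_def powr_mult mult_ac)
      qed
      also have "p n * t n + u n * (1 + e) powr (\<tau> - 2) * (1 + grid n (y n) powr (1 - \<alpha>) / J)
         = u n * (p n * (c * e) + (1 + e) powr (\<tau> - 2) * (1 + grid n (y n) powr (1 - \<alpha>) / J))"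
        by (simp add: t_def algebra_simps)
      also have "\<dots> \<le> u n * (1 + e)" using elim n by (intro mult_left_mono) auto
      finally show ?thesis by (simp add: y_def mult.commute)
    qed
    have "(1 - exp (- t n * ?k)) * ?E \<le> t n * card {1..n} + y n * (\<Sum>v\<in>{1..n}. w n v)"
      using n w_nonneg main by (intro rank_one_large_vertices_le) auto
    also have "\<dots> = c * real n * e * u n + (1 + e) * s n"
      by (simp add: t_def y_def s_def ell_def total_weight_def)
    also have "\<dots> \<le> ell n * e * u n + (1 + e) * s n"
      using ell_ge[of n] n e by (intro add_right_mono mult_right_mono) auto
    also have "\<dots> = (1 + 2 * e) * s n" by (simp add: s_def algebra_simps)
    finally have up: "(1 - exp (- t n * ?k)) * ?E \<le> (1 + 2 * e) * s n" .
    have "c * e * \<delta> * c * (real n * (u n)\<^sup>2) \<le> t n * (\<delta> * s n)"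
    proof -
      have "c * e * \<delta> * (u n)\<^sup>2 * (c * real n) \<le> c * e * \<delta> * (u n)\<^sup>2 * ell n"
        using ell_ge[of n] c_pos e assms by (intro mult_left_mono) auto
      then show ?thesis by (simp add: t_def s_def power2_eq_square mult_ac)
    qed
    also have "\<dots> \<le> t n * ?k" using n by (intro mult_left_mono) (auto simp: real_nat_ceiling_ge)
    finally have "ln ((1 + 3 * e) / e) \<le> t n * ?k" using elim by simp
    then have "exp (- t n * ?k) \<le> exp (- ln ((1 + 3 * e) / e))" by simp
    also have "\<dots> = e / (1 + 3 * e)" using e by (simp add: exp_minus)
    finally have "(1 + 2 * e) / (1 + 3 * e) \<le> 1 - exp (- t n * ?k)"
      using e by (simp add: field_simps)
    moreover have "0 \<le> ?E" by (intro integral_nonneg_AE AE_pmfI) auto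
    ultimately have "(1 + 2 * e) / (1 + 3 * e) * ?E \<le> (1 - exp (- t n * ?k)) * ?E"
      by (rule mult_right_mono)
    also note up
    finally have "(1 + 2 * e) * ?E \<le> (1 + 2 * e) * ((1 + 3 * e) * s n)"
      using e by (simp add: field_simps)
    then have "?E \<le> (1 + 3 * e) * s n" using e by (subst (asm) mult_le_cancel_left_pos) auto
    moreover have "(\<lambda>(i, j). 1 - exp (- (?b * (w n i * w n j)))) = (\<lambda>(i, j). 1 - exp (- (p n * (w n i * w n j / ell n))))"
      by auto
    ultimately show ?case by (simp add: e_def)
  qed
qed

text \<open>Taking every \<open>d\<close>-th index gives a Riemann sum with mesh
  \<open>d * grid n y\<close>. An arithmetic progression thus carries the fraction
  \<open>1 / d\<close> of the full sum as soon as its grid points cover the window from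
  \<open>a\<close> to \<open>b\<close>.\<close>

lemma w_scaled_sum_ge:
  assumes n: "0 < n" and y: "0 < y" and d: "0 < d" and i0: "0 < i0"
    and a: "real i0 * grid n y \<le> a" and b: "b \<le> real (i0 + K * d) * grid n y"
  shows "real n * C * y powr (\<tau> - 2) / d * integral {a..b} (kern \<alpha>)
    \<le> (\<Sum>k<K. w n (i0 + k * d) * (1 - exp (- (w n (i0 + k * d) * y))))"
proof -
  let ?h = "grid n y"
  let ?f = "\<lambda>k. w n (i0 + k * d) * (1 - exp (- (w n (i0 + k * d) * y)))"
  have h: "0 < ?h" using n y by (rule grid_pos)
  have x0: "0 < real i0 * ?h" using i0 h by simp
  have "integral {a..b} (kern \<alpha>) \<le> integral {real i0 * ?h..real i0 * ?h + real K * (real d * ?h)} (kern \<alpha>)"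
    using x0 a b by (intro integral_kern_mono[OF alpha(1,2)]) (auto simp: algebra_simps)
  also have "\<dots> \<le> real d * ?h * (\<Sum>k<K. kern \<alpha> (real i0 * ?h + real k * (real d * ?h)))"
    using h d x0 by (intro integral_le_left_sum kern_antimono[OF alpha(1,2)] continuous_on_kern[OF alpha(1,2)]) auto
  also have "(\<Sum>k<K. kern \<alpha> (real i0 * ?h + real k * (real d * ?h)))
      = y * (\<Sum>k<K. ?f k)"
    unfolding sum_distrib_left
  proof (rule sum.cong)
    fix k
    have "real i0 * ?h + real k * (real d * ?h) = real (i0 + k * d) * ?h" by (simp add: algebra_simps)
    then show "kern \<alpha> (real i0 * ?h + real k * (real d * ?h)) = y * (?f k)"
      using w_kern[OF n _ y, of "i0 + k * d"] i0 y by simp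
  qed simp
  finally have "1 / (y * ?h) / d * integral {a..b} (kern \<alpha>) \<le> 1 / (y * ?h) / d *
      (real d * ?h * (y * (\<Sum>k<K. ?f k)))"
    using y h by (intro mult_left_mono) auto
  also have "\<dots> = (\<Sum>k<K. ?f k)"
    using y h d by simp
  finally show ?thesis unfolding grid_inverse[OF n y] .
qed

text \<open>The indices up to \<open>\<rho> * n\<close> carry at most the fraction \<kappa> of the
  weight, by \<open>sum_w_le\<close>, and the last \<open>R\<close> have weight at most
  \<open>2 * c\<close> each. The indices in between have bounded weight, so their reaching
  probabilities are nearly linear in it; the last \<open>R\<close> are cut off because blocks of
  equal length may miss them.\<close>

lemma bulk_weight_ge:
  assumes n: "0 < n" and rho: "0 < \<rho>" "\<rho> powr (1 - \<alpha>) / (1 - \<alpha>) \<le> \<kappa>" and R: "2 * real R \<le> \<kappa> * n" "2 * R \<le> n"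
  shows "(1 - 2 * \<kappa>) * ell n \<le> (\<Sum>i | i \<le> n - R \<and> \<rho> * real n < real i. w n i)"
proof -
  let ?k = "nat \<lfloor>\<rho> * real n\<rfloor>" and ?T = "{i. i \<le> n - R \<and> \<rho> * real n < real i}"
  have "0 \<le> \<rho> powr (1 - \<alpha>) / (1 - \<alpha>)" using alpha by simp
  then have \<kappa>: "0 \<le> \<kappa>" using rho by linarith
  have "{1..n} \<subseteq> {1..?k} \<union> ?T \<union> {n - R<..n}"
  proof
    fix i assume i: "i \<in> {1..n}"
    show "i \<in> {1..?k} \<union> ?T \<union> {n - R<..n}"
    proof (cases "real i \<le> \<rho> * real n")
      case True
      then have "i \<le> ?k" by (simp add: le_nat_floor)
      then show ?thesis using i by auto
    qed (use i in auto)
  qed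
  then have "ell n \<le> (\<Sum>i\<in>{1..?k} \<union> ?T \<union> {n - R<..n}. w n i)"
    unfolding ell_def total_weight_def by (intro sum_mono2) (auto simp: w_nonneg)
  also have "\<dots> \<le> (\<Sum>i\<in>{1..?k} \<union> ?T. w n i) + (\<Sum>i\<in>{n - R<..n}. w n i)"
    by (subst sum.union_inter[symmetric]) (auto intro!: sum_nonneg w_nonneg)
  also have "(\<Sum>i\<in>{1..?k} \<union> ?T. w n i) \<le> (\<Sum>i=1..?k. w n i) + (\<Sum>i\<in>?T. w n i)"
    by (subst sum.union_inter[symmetric]) (auto intro!: sum_nonneg w_nonneg)
  also have "(\<Sum>i=1..?k. w n i) \<le> \<kappa> * ell n"
  proof -
    have "(\<Sum>i=1..?k. w n i) \<le> c * real n powr \<alpha> * (real ?k powr (1 - \<alpha>) / (1 - \<alpha>))" by (rule sum_w_le)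
    also have "\<dots> \<le> c * real n powr \<alpha> * ((\<rho> * real n) powr (1 - \<alpha>) / (1 - \<alpha>))"
      using c_pos alpha rho n by (intro mult_left_mono divide_right_mono powr_mono2) auto
    also have "\<dots> = c * (real n powr \<alpha> * real n powr (1 - \<alpha>)) * (\<rho> powr (1 - \<alpha>) / (1 - \<alpha>))"
      using rho by (simp add: powr_mult)
    also have "real n powr \<alpha> * real n powr (1 - \<alpha>) = real n" using n by (simp add: powr_add[symmetric])
    also have "c * real n * (\<rho> powr (1 - \<alpha>) / (1 - \<alpha>)) \<le> c * real n * \<kappa>"
      using rho c_pos by (intro mult_left_mono) auto
    also have "\<dots> \<le> ell n * \<kappa>"
      using \<kappa> by (rule mult_right_mono[OF ell_ge])
    finally show ?thesis by (simp add: mult.commute)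
  qed
  also have "(\<Sum>i\<in>{n - R<..n}. w n i) \<le> (\<Sum>i\<in>{n - R<..n}. 2 * c)"
  proof (rule sum_mono)
    fix i assume i: "i \<in> {n - R<..n}"
    then have "real n / real i \<le> 2" using R by (auto simp: field_simps)
    moreover have "0 < real i" using i by auto
    ultimately have "(real n / real i) powr \<alpha> \<le> 2 powr \<alpha>" using alpha by (intro powr_mono2) auto
    also have "\<dots> \<le> 2 powr 1" using alpha by (intro powr_mono) auto
    finally show "w n i \<le> 2 * c" using c_pos by (simp add: w_eq)
  qed
  also have "\<dots> \<le> \<kappa> * ell n"
  proof -
    have "(\<Sum>i\<in>{n - R<..n}. 2 * c) = c * (2 * real R)" using R by simp
    also have "\<dots> \<le> c * (\<kappa> * n)" using R c_pos by (intro mult_left_mono) auto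
    also have "\<dots> = \<kappa> * (c * n)" by simp
    also have "\<dots> \<le> \<kappa> * ell n"
      using \<kappa> by (rule mult_left_mono[OF ell_ge])
    finally show ?thesis .
  qed
  finally show ?thesis by (simp add: algebra_simps)
qed

text \<open>All constants are fixed before \<open>n\<close>, and their order matters: the slack
  \<delta> comes from \<kappa>, the window and the core from \<delta>, the number \<open>N\<close>
  of iterations from the pressure of the core, and the number \<open>R\<close> of blocks only after
  \<open>N\<close>.\<close>

lemma giant_component:
  assumes \<kappa>: "0 < \<kappa>" "\<kappa> \<le> 1 / 5"
  shows "(\<lambda>n. measure_pmf.prob (simple_edges n)
      {E. \<not> (\<exists>v\<in>{1..n}. (1 - 5 * \<kappa>) * s n \<le> card (reach {1..n} {v} E))}) \<longlonglongrightarrow> 0"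
proof -
  \<comment> \<open>The target pressure is \<open>t * u n\<close>, below the fixed point, where the
    limiting map exceeds the identity by the factor \<open>t powr (- (3 - \<tau>))\<close>.\<close>
  define t where "t = 1 - \<kappa>"
  have t: "1 / 2 \<le> t" "t < 1" "0 < t" using \<kappa> by (auto simp: t_def)
  \<comment> \<open>A fourth root, since the surplus is spent in four equal parts: on the Chernoff
    loss, on the linearised edge probabilities, on cutting the integral to a compact window, and on
    the growth rate itself.\<close>
  define \<delta> where "\<delta> = t powr (- (3 - \<tau>) / 4) - 1"
  have \<delta>4: "(1 + \<delta>) ^ 4 = t powr (- (3 - \<tau>))"
  proof -
    have "(1 + \<delta>) ^ 4 = (t powr (- (3 - \<tau>) / 4)) powr 4" using t by (simp add: \<delta>_def)
    also have "\<dots> = t powr (- (3 - \<tau>) / 4 * 4)" by (rule powr_powr)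
    also have "- (3 - \<tau>) / 4 * 4 = - (3 - \<tau>)" by simp
    finally show ?thesis .
  qed
  have \<delta>: "0 < \<delta>"
  proof -
    have "1 powr (- (3 - \<tau>) / 4) < t powr (- (3 - \<tau>) / 4)"
      using t tau by (intro powr_less_mono2_neg) auto
    then show ?thesis by (simp add: \<delta>_def)
  qed
  define \<epsilon> where "\<epsilon> = min \<kappa> (\<delta> / (1 + \<delta>))"
  have eps: "0 < \<epsilon>" "\<epsilon> < 1" "\<epsilon> \<le> \<kappa>" "\<epsilon> \<le> 1 / 2" using \<kappa> \<delta> by (auto simp: \<epsilon>_def)
  have eps\<delta>: "1 / (1 + \<delta>) \<le> 1 - \<epsilon>"
  proof -
    have "1 / (1 + \<delta>) = 1 - \<delta> / (1 + \<delta>)" using \<delta> by (simp add: field_simps)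
    then show ?thesis by (simp add: \<epsilon>_def)
  qed
  have "J / (1 + \<delta>) < J" using J_pos \<delta> by (simp add: field_simps)
  then obtain a0 L where aL: "0 < a0" "0 < L" "J / (1 + \<delta>) < integral {a0..L} (kern \<alpha>)"
    using integral_kern_approx[OF alpha(1,2)] by metis
  \<comment> \<open>\<open>m n\<close> and \<open>R\<close> both end up at grid position at most
    \<open>a\<close>, and the mesh at \<open>Q n\<close> is at most four times that at
    \<open>u n\<close>; hence \<open>8 * a \<le> a0\<close> lets the blocks start before the window.
    The other bound, with the negative exponent \<open>1 - 2 * \<alpha>\<close>, makes the core
    dense enough for mean degree 4.\<close>
  define a where "a = min (a0 / 8) ((16 * J) powr (1 / (1 - 2 * \<alpha>)))"
  have a: "0 < a" "8 * a \<le> a0" using aL J_pos by (auto simp: a_def)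
  have a16: "16 * J \<le> a powr (1 - 2 * \<alpha>)"
  proof -
    have "16 * J = ((16 * J) powr (1 / (1 - 2 * \<alpha>))) powr (1 - 2 * \<alpha>)"
      using J_pos alpha by (simp add: powr_powr)
    also have "\<dots> \<le> a powr (1 - 2 * \<alpha>)"
      using a alpha by (intro powr_mono2') (auto simp: a_def)
    finally show ?thesis .
  qed
  \<comment> \<open>The first entry bounds from below the pressure of one third of the core in units
    of \<open>u n\<close>; the 6 is that third together with the loss from
    \<open>m n * h n \<ge> a / 2\<close>.\<close>
  define \<xi> where "\<xi> = min ((1 - \<epsilon>) * a powr (1 - \<alpha>) / (6 * J)) t"
  have \<xi>: "0 < \<xi>" "\<xi> \<le> t" "\<xi> \<le> (1 - \<epsilon>) * a powr (1 - \<alpha>) / (6 * J)" using eps a J_pos t by (auto simp: \<xi>_def)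
  obtain N where "t / \<xi> < (1 + \<delta> / 2) ^ N" using real_arch_pow[of "1 + \<delta> / 2" "t / \<xi>"] \<delta> by auto
  then have N: "t \<le> \<xi> * (1 + \<delta> / 2) ^ N" using \<xi> by (simp add: field_simps)
  \<comment> \<open>\<open>N\<close> does not involve \<open>R\<close>, so \<open>R\<close> can be
    so large that losing \<open>N\<close> blocks costs only half of the growth \<delta>.\<close>
  obtain R :: nat where R0: "real N + 1 + 2 * real N * (1 + \<delta>) / \<delta> \<le> real R" using real_arch_simple by blast
  have R: "N < R" "(1 + \<delta> / 2) * R \<le> (real R - N) * (1 + \<delta>)" "0 < R"
  proof -
    have x: "0 \<le> 2 * real N * (1 + \<delta>) / \<delta>" using \<delta> by simp
    then show "N < R" "0 < R" using R0 by linarith+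
    have "2 * real N * (1 + \<delta>) / \<delta> \<le> R" using R0 by linarith
    then have "2 * real N * (1 + \<delta>) \<le> R * \<delta>" using \<delta> by (simp add: divide_le_eq)
    then show "(1 + \<delta> / 2) * R \<le> (real R - N) * (1 + \<delta>)" by (simp add: algebra_simps)
  qed
  define \<rho> where "\<rho> = (\<kappa> * (1 - \<alpha>)) powr (1 / (1 - \<alpha>))"
  have \<rho>: "0 < \<rho>" "\<rho> powr (1 - \<alpha>) / (1 - \<alpha>) \<le> \<kappa>"
    using \<kappa> alpha by (auto simp: \<rho>_def powr_powr)
  define h where "h n = grid n (u n)" for n
  \<comment> \<open>The heaviest vertices, up to grid position \<open>a\<close>. By
    \<open>w_grid\<close> their smallest weight \<open>M n\<close>, the truncation level, is of
    order \<open>1 / u n\<close>.\<close>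
  define m where "m n = nat \<lfloor>a / h n\<rfloor>" for n
  define M where "M n = w n (m n)" for n
  define \<beta> where "\<beta> n = (1 - \<epsilon>) * (p n / ell n)" for n
  define Q where "Q n = t * u n" for n
  define K where "K n = (n - m n) div R" for n
  \<comment> \<open>Residue classes modulo \<open>R\<close> beyond the core, so that each block is a
    sparse copy of the whole weight sequence.\<close>
  define B where "B n r = (\<lambda>k. m n + 1 + r + k * R) ` {..<K n}" for n r
  define v where "v n i = (if i \<le> m n then M n else w n i)" for n i
  define X where "X n = real n * u n powr (\<tau> - 1)" for n
  \<comment> \<open>Chosen such that \<open>k2 * X n\<close> is below the exponent of
    \<open>layered_giant_component\<close>, where \<open>M n\<close> is at most
    \<open>(a / 2) powr (- \<alpha>) / u n\<close> and \<open>\<beta> n\<close> at most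
    \<open>(u n)\<^sup>2 / (C * J * X n)\<close>.\<close>
  define k2 where "k2 = \<epsilon>\<^sup>2 * \<xi> * (a / 2) powr \<alpha> * C * J / (2 * R)"
  have k2: "0 < k2" using eps \<xi> a C J_pos R by (simp add: k2_def)
  define bound where "bound n = exp (- ((a * C * X n - 1) / 10)) + real (2 ^ R * R * (N + 2)) * exp (- (k2 * X n))" for n
  have h0: "h \<longlonglongrightarrow> 0" using grid_tendsto_0[of 1] by (simp add: h_def[abs_def])
  have ev_h: "eventually (\<lambda>n. h n < min (a / 2) (a / R)) sequentially"
    using a R by (intro order_tendstoD(2)[OF h0]) auto
  have up0: "(\<lambda>n. u n powr (\<tau> - 1)) \<longlonglongrightarrow> 0"
  proof -
    have "(\<lambda>n. u n powr (\<tau> - 1)) \<longlonglongrightarrow> 0 powr (\<tau> - 1)"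
      using tau by (intro tendsto_powr' u_tendsto_0 tendsto_const) (auto simp: u_def)
    then show ?thesis by simp
  qed
  have ev_up: "eventually (\<lambda>n. u n powr (\<tau> - 1) < min (\<rho> / 2 / (a * C)) (1 / (2 * C * L))) sequentially"
    using a C \<rho> aL by (intro order_tendstoD(2)[OF up0]) auto
  have ev_n: "eventually (\<lambda>n. 2 / \<rho> + 2 * real R + 2 * real R / \<kappa> \<le> real n) sequentially"
    by (rule eventually_sequentiallyI[of "nat \<lceil>2 / \<rho> + 2 * real R + 2 * real R / \<kappa>\<rceil>"]) linarith
  have ev_nu: "eventually (\<lambda>n. ((a / 2) powr (- \<alpha>))\<^sup>2 / (2 * \<epsilon> * c) \<le> real n * (u n)\<^sup>2) sequentially"
    using n_u_square by (auto simp: filterlim_at_top)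
  have ev_u: "eventually (\<lambda>n. u n < 2 * \<epsilon> * \<rho> powr \<alpha> / c) sequentially"
    using eps \<rho> c_pos by (intro order_tendstoD(2)[OF u_tendsto_0]) auto
  have le_bound: "eventually (\<lambda>n. measure_pmf.prob (simple_edges n)
      {E. \<not> (\<exists>v\<in>{1..n}. (1 - 5 * \<kappa>) * s n \<le> card (reach {1..n} {v} E))} \<le> bound n) sequentially"
    using ev_pos ev_h ev_up ev_n ev_nu ev_u
  proof eventually_elim
    case (elim n)
    let ?q = "\<lambda>(i, j). if i = j then 0 else p n * (1 - exp (- (w n i * w n j / ell n)))"
    have n: "0 < n" "0 < p n" "p n < 1" "0 < ell n" "0 < u n" "0 < Q n" "Q n \<le> u n"
      using elim t by (auto simp: Q_def)
    have h: "0 < h n" "2 * h n \<le> a" "R * h n \<le> a"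
      using n elim a R grid_pos[of n "u n"] by (auto simp: h_def field_simps)
    have mh: "real (m n) * h n \<le> a" "a / 2 \<le> real (m n) * h n"
    proof -
      have ah: "0 \<le> a / h n" using a h by simp
      have "real (m n) \<le> a / h n" unfolding m_def using ah by simp
      then show "real (m n) * h n \<le> a" using h by (simp add: field_simps)
      have "a / h n - 1 \<le> real (m n)" unfolding m_def using ah by linarith
      then have "(a / h n - 1) * h n \<le> real (m n) * h n" using h by (intro mult_right_mono) auto
      then show "a / 2 \<le> real (m n) * h n" using h by (simp add: left_diff_distrib)
    qed
    have hX: "a / h n = a * C * X n" using n C by (simp add: h_def grid_def X_def)
    have m_ge: "a * C * X n - 1 \<le> real (m n)"
    proof -
      have "0 \<le> a / h n" using a h by simp
      then have "a / h n - 1 \<le> real (m n)" unfolding m_def by linarith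
      then show ?thesis by (simp add: hX)
    qed
    have m0: "0 < m n"
    proof (rule ccontr)
      assume "\<not> 0 < m n"
      then show False using mh(2) a by simp
    qed
    have nR: "2 / \<rho> \<le> n" "2 * R \<le> n" "2 * real R \<le> \<kappa> * n"
    proof -
      have "0 < 2 / \<rho>" "0 \<le> 2 * real R" "0 \<le> 2 * real R / \<kappa>" using \<rho> \<kappa> by auto
      then have "2 / \<rho> \<le> n" "2 * real R \<le> n" "2 * real R / \<kappa> \<le> n" using elim(4) by linarith+
      then show "2 / \<rho> \<le> n" "2 * R \<le> n" "2 * real R \<le> \<kappa> * n" using \<kappa> by (auto simp: field_simps)
    qed
    have m\<rho>: "real (m n) + 1 \<le> \<rho> * n"
    proof -
      have "real (m n) \<le> a / h n" using mh(1) h by (simp add: field_simps)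
      also have "\<dots> = a * C * u n powr (\<tau> - 1) * n" by (simp add: hX X_def)
      also have "\<dots> \<le> (\<rho> / 2) * n"
        using elim(3) a C by (intro mult_right_mono) (auto simp: field_simps)
      finally have "real (m n) \<le> \<rho> / 2 * n" .
      moreover have "1 \<le> \<rho> / 2 * n" using nR(1) \<rho> by (simp add: field_simps)
      ultimately show ?thesis by simp
    qed
    have \<rho>1: "\<rho> < 1"
    proof -
      have "\<rho> powr (1 - \<alpha>) \<le> \<kappa> * (1 - \<alpha>)" using \<rho>(2) alpha by (simp add: field_simps)
      also have "\<dots> < 1 * 1" using \<kappa> alpha by (intro mult_strict_mono) auto
      finally have "\<rho> powr (1 - \<alpha>) < 1 powr (1 - \<alpha>)" by simp
      then show ?thesis using \<rho>(1) alpha by (metis not_less powr_mono2 less_eq_real_def diff_gt_0_iff_gt zero_le_one)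
    qed
    have mn: "m n < n"
    proof -
      have "\<rho> * real n \<le> 1 * real n" using \<rho>1 by (intro mult_right_mono) auto
      then show ?thesis using m\<rho> by linarith
    qed
    have Mu: "M n * u n = (real (m n) * h n) powr (- \<alpha>)"
      unfolding M_def h_def using n m0 by (intro w_grid)
    have Mu_le: "M n * u n \<le> (a / 2) powr (- \<alpha>)" and Mu_ge: "a powr (- \<alpha>) \<le> M n * u n"
      unfolding Mu using mh a alpha by (auto intro!: powr_mono2')
    have Mpos: "0 < M n" unfolding M_def using n m0 by (intro w_pos)
    have \<beta>pos: "0 < \<beta> n" using eps n by (simp add: \<beta>_def)
    have \<beta>eq: "\<beta> n = (1 - \<epsilon>) * (u n powr (3 - \<tau>) / (real n * C * J))"
      unfolding \<beta>_def u_powr[OF n(1,2)] ..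
    have e: "u n powr (3 - \<tau>) * u n powr (\<tau> - 1) = (u n)\<^sup>2"
      using n by (simp add: powr_add[symmetric])
    have \<beta>m: "\<beta> n * m n = (1 - \<epsilon>) * (real (m n) * h n) * (u n)\<^sup>2 / J"
    proof -
      have "u n powr (3 - \<tau>) = h n * (real n * C) * (u n)\<^sup>2"
        using n C by (simp add: h_def grid_def e[symmetric])
      then show ?thesis unfolding \<beta>eq using n C J_pos by simp
    qed
    have vle: "0 \<le> v n j \<and> v n j \<le> M n" "v n j \<le> w n j" if "j \<in> {1..n}" for j
      using that Mpos w_nonneg[of n j] w_antimono[of "m n" j n] w_antimono[of j "m n" n] m0
      by (auto simp: v_def M_def)
    have q: "0 \<le> ?q e \<and> ?q e \<le> 1" for e
      using n w_nonneg by (cases e) (auto intro!: mult_le_one)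
    have Bsub: "B n r \<subseteq> {m n + 1 + r..n}" if "r < R" for r
    proof
      fix i assume "i \<in> B n r"
      then obtain k where k: "k < K n" "i = m n + 1 + r + k * R" by (auto simp: B_def)
      have "(k + 1) * R \<le> K n * R" using k by (intro mult_right_mono) auto
      also have "\<dots> \<le> n - m n" by (simp add: K_def)
      finally show "i \<in> {m n + 1 + r..n}" using k that mn by auto
    qed
    have injB: "inj_on (\<lambda>k. m n + 1 + r + k * R) {..<K n}" for r using R by (auto simp: inj_on_def)
    have KR: "n - R \<le> m n + K n * R"
    proof -
      have "n - m n < (K n + 1) * R" unfolding K_def using R
        by (metis Suc_eq_plus1 dividend_less_div_times mult.commute mult_Suc)
      then show ?thesis by simp
    qed
    \<comment> \<open>Computed at \<open>y = Q n\<close>. By concavity in the pressure, the relative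
      growth at smaller \<open>y\<close> is at least as large.\<close>
    have Isum: "(1 + \<delta>) * y / R \<le> (1 - \<epsilon>) * \<beta> n * (\<Sum>i\<in>B n r. v n i * (1 - exp (- (v n i * y))))"
      if y: "0 < y" "y \<le> Q n" and r: "r < R" for y r
    proof -
      let ?i0 = "m n + 1 + r"
      let ?f = "\<lambda>k. w n (?i0 + k * R) * (1 - exp (- (w n (?i0 + k * R) * Q n)))"
        and ?K = "integral {a0..L} (kern \<alpha>)"
      \<comment> \<open>The 4 comes from \<open>t \<ge> 1 / 2\<close> and
        \<open>\<tau> - 1 \<le> 2\<close>.\<close>
      have gQ: "h n \<le> grid n (Q n)" "grid n (Q n) \<le> 4 * h n"
      proof -
        have tp: "1 / 4 \<le> t powr (\<tau> - 1)" "t powr (\<tau> - 1) \<le> 1"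
        proof -
          have "(1/2::real) powr 2 \<le> t powr 2" using t by (intro powr_mono2) auto
          also have "\<dots> \<le> t powr (\<tau> - 1)" using t tau by (intro powr_mono') auto
          finally show "1 / 4 \<le> t powr (\<tau> - 1)" by (simp add: power2_eq_square)
          show "t powr (\<tau> - 1) \<le> 1" using t tau powr_mono2[of "\<tau> - 1" t 1] by simp
        qed
        have "grid n (Q n) = h n / t powr (\<tau> - 1)"
          using t n by (simp add: grid_def Q_def h_def powr_mult)
        then have hT: "h n = t powr (\<tau> - 1) * grid n (Q n)" using t by simp
        have G: "0 \<le> grid n (Q n)" using grid_pos n by (simp add: less_imp_le)
        show "h n \<le> grid n (Q n)" "grid n (Q n) \<le> 4 * h n"
          using mult_right_mono[OF tp(1) G] mult_right_mono[OF tp(2) G] hT by linarith+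
      qed
      have "real ?i0 * grid n (Q n) \<le> real (m n + R) * (4 * h n)"
        using r gQ h by (intro mult_mono) auto
      also have "\<dots> = 4 * (real (m n) * h n) + 4 * (R * h n)" by (simp add: algebra_simps)
      also have "\<dots> \<le> a0" using mh h a by linarith
      finally have left: "real ?i0 * grid n (Q n) \<le> a0" .
      have right: "L \<le> real (?i0 + K n * R) * grid n (Q n)"
      proof -
        have "L \<le> real n / 2 * h n"
        proof -
          have "u n powr (\<tau> - 1) * (2 * C * L) \<le> 1" using elim(3) C aL by (simp add: field_simps)
          then show ?thesis using n C by (simp add: h_def grid_def field_simps)
        qed
        also have "\<dots> \<le> real (?i0 + K n * R) * grid n (Q n)"
        proof (intro mult_mono gQ)
          have "real n / 2 \<le> real (n - R)" using nR(2) by (simp add: of_nat_diff)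
          also have "\<dots> \<le> real (?i0 + K n * R)"           proof (rule of_nat_mono)
            show "n - R \<le> ?i0 + K n * R" using KR by linarith
          qed
          finally show "real n / 2 \<le> real (?i0 + K n * R)" .
        qed (use h in auto)
        finally show ?thesis .
      qed
      have "(1 + \<delta>) * Q n / R \<le> (1 - \<epsilon>) * \<beta> n * (real n * C * Q n powr (\<tau> - 2) / R * ?K)"
      proof -
        have Qp: "Q n powr (\<tau> - 2) = t powr (- (3 - \<tau>)) * Q n / u n powr (3 - \<tau>)"
        proof -
          have "Q n powr (\<tau> - 2) = Q n powr 1 * Q n powr (- (3 - \<tau>))"
            unfolding powr_add[symmetric] by (rule arg_cong[of _ _ "\<lambda>x. Q n powr x"]) simp
          also have "Q n powr (- (3 - \<tau>)) = t powr (- (3 - \<tau>)) * u n powr (- (3 - \<tau>))"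
            using t n by (simp add: Q_def powr_mult)
          finally show ?thesis using n by (simp add: powr_minus_divide del: minus_diff_eq)
        qed
        have upos: "0 < u n powr (3 - \<tau>)" using n by simp
        have "(1 - \<epsilon>) * \<beta> n * (real n * C * Q n powr (\<tau> - 2) / R * ?K)
           = (1 - \<epsilon>) * (1 - \<epsilon>) * t powr (- (3 - \<tau>)) * (?K / J) * (Q n / R)"
          unfolding \<beta>eq Qp using upos n C J_pos by (simp add: mult_ac del: minus_diff_eq)
        \<comment> \<open>Three of the four factors \<open>1 + \<delta>\<close> are given away here;
          the fourth is the growth.\<close>
        also have "\<dots> \<ge> (1 / (1 + \<delta>)) * (1 / (1 + \<delta>)) * (1 + \<delta>) ^ 4 * (1 / (1 + \<delta>)) * (Q n / R)"
        proof -
          have z: "0 \<le> 1 / (1 + \<delta>)" using \<delta> by simp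
          have IJ: "1 / (1 + \<delta>) \<le> ?K / J"
            using aL(3) J_pos by (simp add: pos_le_divide_eq)
          have e0: "0 \<le> 1 - \<epsilon>" "0 \<le> Q n / R" "0 \<le> (1 + \<delta>) ^ 4" using eps n \<delta> by auto
          show ?thesis unfolding \<delta>4[symmetric]
            by (intro mult_right_mono mult_mono eps\<delta> IJ z e0 order_refl mult_nonneg_nonneg)
        qed
        also have "(1 / (1 + \<delta>)) * (1 / (1 + \<delta>)) * (1 + \<delta>) ^ 4 * (1 / (1 + \<delta>)) * (Q n / R) = (1 + \<delta>) * Q n / R"
          using \<delta> by (simp add: power4_eq_xxxx)
        finally show ?thesis .
      qed
      also have "\<dots> \<le> (1 - \<epsilon>) * \<beta> n * (\<Sum>k<K n. ?f k)"
        using eps \<beta>pos n R left right by (intro mult_left_mono w_scaled_sum_ge) auto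
      also have "(\<Sum>k<K n. ?f k) = (\<Sum>i\<in>B n r. w n i * (1 - exp (- (w n i * Q n))))"
        unfolding B_def sum.reindex[OF injB] by (simp only: o_def)
      also have "\<dots> = (\<Sum>i\<in>B n r. v n i * (1 - exp (- (v n i * Q n))))"
        using Bsub[OF r] by (intro sum.cong) (auto simp: v_def)
      finally have atQ: "(1 + \<delta>) * Q n / R \<le> (1 - \<epsilon>) * \<beta> n * (\<Sum>i\<in>B n r. v n i * (1 - exp (- (v n i * Q n))))" .
      have "(1 + \<delta>) * y / R = y / Q n * ((1 + \<delta>) * Q n / R)" using n by simp
      also have "\<dots> \<le> y / Q n * ((1 - \<epsilon>) * \<beta> n * (\<Sum>i\<in>B n r. v n i * (1 - exp (- (v n i * Q n)))))"
        using atQ y n by (intro mult_left_mono) auto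
      also have "\<dots> = (1 - \<epsilon>) * \<beta> n * (\<Sum>i\<in>B n r. v n i * (y / Q n * (1 - exp (- (v n i * Q n)))))"
        by (simp add: sum_distrib_left mult_ac)
      also have "\<dots> \<le> (1 - \<epsilon>) * \<beta> n * (\<Sum>i\<in>B n r. v n i * (1 - exp (- (v n i * y))))"
      proof (intro mult_left_mono sum_mono)
        fix i assume "i \<in> B n r"
        then show "0 \<le> v n i" using Bsub[OF r] w_nonneg by (auto simp: v_def)
        have "exp (- (v n i * Q n * (1 - (1 - y / Q n)))) \<le> 1 - (1 - exp (- (v n i * Q n))) * (1 - (1 - y / Q n))"
          using y n by (intro exp_chord) auto
        then show "y / Q n * (1 - exp (- (v n i * Q n))) \<le> 1 - exp (- (v n i * y))"
          using n by (simp add: mult.commute)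
      qed (use eps \<beta>pos in auto)
      finally show ?thesis .
    qed
    have disj: "B n r \<inter> B n r' = {}" if "r < R" "r' < R" "r \<noteq> r'" for r r'
    proof (rule ccontr)
      assume "B n r \<inter> B n r' \<noteq> {}"
      then obtain k k' where "r + k * R = r' + k' * R" by (auto simp: B_def)
      then have "(r + k * R) mod R = (r' + k' * R) mod R" by simp
      then show False using that by simp
    qed
    have count: "(1 - 5 * \<kappa>) * s n \<le> (1 - \<epsilon>) * (\<Sum>r<R. \<Sum>i\<in>B n r. 1 - exp (- (v n i * Q n)))"
    proof -
      let ?T = "{i. i \<le> n - R \<and> \<rho> * real n < real i}"
      have "finite ?T" by (rule finite_subset[of _ "{..n}"]) auto
      have sub: "?T \<subseteq> (\<Union>r<R. B n r)"
      proof
        fix i assume i: "i \<in> ?T"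
        then have im: "m n + 1 \<le> i" "i \<le> m n + K n * R" using m\<rho> KR by auto
        define d where "d = i - (m n + 1)"
        have "d < K n * R" using im by (simp add: d_def)
        then have "d div R < K n" by (simp add: less_mult_imp_div_less)
        moreover have "i = m n + 1 + d mod R + d div R * R" using im by (simp add: d_def)
        ultimately have "i \<in> B n (d mod R)" unfolding B_def by blast
        then show "i \<in> (\<Union>r<R. B n r)" using R by auto
      qed
      \<comment> \<open>Beyond \<open>\<rho> * n\<close> the weights are bounded, so
        \<open>w n i * Q n\<close> is at most \<open>2 * \<epsilon>\<close> for large
        \<open>n\<close> and the reaching probability can be linearised.\<close>
      have each: "(1 - \<epsilon>) * Q n * w n i \<le> 1 - exp (- (v n i * Q n))" if i: "i \<in> ?T" for i
      proof -
        have im: "m n < i" "0 < real i" using i m\<rho> by auto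
        have "real n / real i \<le> 1 / \<rho>" using i im \<rho> by (simp add: field_simps)
        then have "(real n / real i) powr \<alpha> \<le> (1 / \<rho>) powr \<alpha>"
          using alpha by (intro powr_mono2) auto
        then have "w n i \<le> c * (1 / \<rho>) powr \<alpha>" unfolding w_eq using c_pos by (rule mult_left_mono[OF _ less_imp_le])
        then have "w n i \<le> c / \<rho> powr \<alpha>" by (simp add: powr_divide)
        then have "w n i * Q n \<le> c / \<rho> powr \<alpha> * u n"
          using n w_nonneg[of n i] c_pos by (intro mult_mono) auto
        also have "\<dots> \<le> 2 * \<epsilon>" using elim(6) c_pos \<rho> by (simp add: field_simps)
        finally have x: "w n i * Q n \<le> 2 * \<epsilon>" .
        have x0: "0 \<le> w n i * Q n" using w_nonneg[of n i] n by simp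
        have "(1 - \<epsilon>) * (w n i * Q n) \<le> w n i * Q n - (w n i * Q n)\<^sup>2 / 2"
          using mult_right_mono[OF x x0] by (simp add: power2_eq_square algebra_simps)
        also have "\<dots> \<le> 1 - exp (- (w n i * Q n))" by (rule one_minus_exp_ge[OF x0])
        finally show ?thesis using im by (simp add: v_def mult_ac)
      qed
      have "(1 - 5 * \<kappa>) * s n \<le> (1 - \<epsilon>) * ((1 - \<epsilon>) * Q n * ((1 - 2 * \<kappa>) * ell n))"
      proof -
        \<comment> \<open>One factor \<open>1 - \<kappa>\<close> is the target pressure, two
          dominate the factors \<open>1 - \<epsilon>\<close> for concentration and linearisation,
          and \<open>1 - 2 * \<kappa>\<close> is the discarded weight.\<close>
        have "1 - 5 * \<kappa> \<le> (1 - \<kappa>) * (1 - \<kappa>) * (1 - \<kappa>) * (1 - 2 * \<kappa>)"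
        proof -
          have "1 - 2 * \<kappa> \<le> (1 - \<kappa>) * (1 - \<kappa>)" by (simp add: algebra_simps)
          then have "(1 - 2 * \<kappa>) * ((1 - \<kappa>) * (1 - 2 * \<kappa>)) \<le> (1 - \<kappa>) * (1 - \<kappa>) * ((1 - \<kappa>) * (1 - 2 * \<kappa>))"
            using \<kappa> by (intro mult_right_mono) auto
          moreover have "1 - 3 * \<kappa> \<le> (1 - \<kappa>) * (1 - 2 * \<kappa>)" by (simp add: algebra_simps)
          then have "(1 - 2 * \<kappa>) * (1 - 3 * \<kappa>) \<le> (1 - 2 * \<kappa>) * ((1 - \<kappa>) * (1 - 2 * \<kappa>))"
            using \<kappa> by (intro mult_left_mono) auto
          moreover have "1 - 5 * \<kappa> \<le> (1 - 2 * \<kappa>) * (1 - 3 * \<kappa>)" by (simp add: algebra_simps)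
          ultimately show ?thesis by (simp add: mult.assoc)
        qed
        also have "\<dots> \<le> (1 - \<epsilon>) * (1 - \<epsilon>) * (1 - \<kappa>) * (1 - 2 * \<kappa>)"
          using eps \<kappa> by (intro mult_right_mono mult_mono) auto
        finally have "(1 - 5 * \<kappa>) * s n \<le> (1 - \<epsilon>) * (1 - \<epsilon>) * (1 - \<kappa>) * (1 - 2 * \<kappa>) * s n"
          using n by (intro mult_right_mono) (auto simp: s_def)
        then show ?thesis by (simp add: s_def Q_def t_def mult_ac)
      qed
      also have "\<dots> \<le> (1 - \<epsilon>) * ((1 - \<epsilon>) * Q n * (\<Sum>i\<in>?T. w n i))"
        using eps n nR \<rho> by (intro mult_left_mono bulk_weight_ge) auto
      also have "\<dots> \<le> (1 - \<epsilon>) * (\<Sum>i\<in>?T. 1 - exp (- (v n i * Q n)))"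
        unfolding sum_distrib_left[of "(1 - \<epsilon>) * Q n"] using eps by (intro mult_left_mono sum_mono each) auto
      also have "\<dots> \<le> (1 - \<epsilon>) * (\<Sum>i\<in>(\<Union>r<R. B n r). 1 - exp (- (v n i * Q n)))"
      proof (intro mult_left_mono sum_mono2 sub)
        fix i assume "i \<in> (\<Union>r<R. B n r) - ?T"
        then have "0 \<le> v n i" using Bsub w_nonneg by (fastforce simp: v_def)
        then show "0 \<le> 1 - exp (- (v n i * Q n))" using n by simp
      qed (use eps in \<open>auto simp: B_def\<close>)
      also have "(\<Sum>i\<in>(\<Union>r<R. B n r). 1 - exp (- (v n i * Q n))) = (\<Sum>r<R. \<Sum>i\<in>B n r. 1 - exp (- (v n i * Q n)))"
        using disj by (intro sum.UNION_disjoint) (auto simp: B_def)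
      finally show ?thesis .
    qed
    \<comment> \<open>After truncation the Poisson rate is of order \<open>1 / (n * u^2)\<close>,
      hence at most \<open>2 * \<epsilon>\<close>, and the edge probability of the simple graph
      becomes linear up to the factor \<open>1 - \<epsilon>\<close>.\<close>
    have lower: "\<beta> n * v n i * v n j \<le> ?q (edge i j)" if ij: "i \<in> {1..n}" "j \<in> {1..n}" "i \<noteq> j" for i j
    proof -
      define x where "x = v n i * v n j / ell n"
      have vv: "0 \<le> v n i * v n j" "v n i * v n j \<le> w n i * w n j" "v n i * v n j \<le> M n * M n"
        using vle[OF ij(1)] vle[OF ij(2)] w_nonneg Mpos by (auto intro!: mult_mono)
      have x0: "0 \<le> x" using vv n by (simp add: x_def)
      have "x \<le> 2 * \<epsilon>"
      proof -
        have "M n * M n * (u n)\<^sup>2 = (M n * u n)\<^sup>2" by (simp add: power_mult_distrib power2_eq_square)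
        also have "\<dots> \<le> ((a / 2) powr (- \<alpha>))\<^sup>2" using Mu_le Mpos n by (intro power_mono) auto
        also have "\<dots> \<le> 2 * \<epsilon> * c * (real n * (u n)\<^sup>2)" using elim(5) eps c_pos by (simp add: field_simps)
        finally have "M n * M n \<le> 2 * \<epsilon> * (c * real n)" using n by (simp add: mult_ac)
        also have "\<dots> \<le> 2 * \<epsilon> * ell n" using ell_ge eps by (intro mult_left_mono) auto
        finally show ?thesis using vv n by (simp add: x_def field_simps)
      qed
      then have "(1 - \<epsilon>) * x \<le> x - x\<^sup>2 / 2"
        using mult_right_mono[OF _ x0, of x "2 * \<epsilon>"] by (simp add: power2_eq_square algebra_simps)
      also have "\<dots> \<le> 1 - exp (- x)" by (rule one_minus_exp_ge[OF x0])
      also have "\<dots> \<le> 1 - exp (- (w n i * w n j / ell n))"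
        using vv n by (simp add: x_def divide_right_mono)
      finally have "p n * ((1 - \<epsilon>) * x) \<le> p n * (1 - exp (- (w n i * w n j / ell n)))"
        using n by (intro mult_left_mono) auto
      moreover have "?q (edge i j) = p n * (1 - exp (- (w n i * w n j / ell n)))"
        using ij by (auto simp: edge_def min_def max_def mult.commute)
      moreover have "p n * ((1 - \<epsilon>) * x) = \<beta> n * v n i * v n j" by (simp add: x_def \<beta>_def)
      ultimately show ?thesis by simp
    qed
    \<comment> \<open>This mean degree is at least
      \<open>(1 - \<epsilon>) * a powr (1 - 2 * \<alpha>) / (2 * J)\<close>; the value
      \<open>16 * J\<close> in the choice of \<open>a\<close> allows for
      \<open>1 - \<epsilon> \<ge> 1 / 2\<close> and the other factor 2.\<close>
    have core: "4 \<le> \<beta> n * M n * M n * card {1..m n}"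
    proof -
      have "4 = 1 / 2 * (16 * J) / (2 * J)" using J_pos by simp
      also have "\<dots> \<le> (1 - \<epsilon>) * a powr (1 - 2 * \<alpha>) / (2 * J)"
        using a16 J_pos eps by (intro divide_right_mono mult_mono) auto
      also have "a powr (1 - 2 * \<alpha>) = a * (a powr (- \<alpha>))\<^sup>2"
      proof -
        have "a powr (1 - 2 * \<alpha>) = a powr 1 * (a powr (- \<alpha>) * a powr (- \<alpha>))"
          unfolding powr_add[symmetric] by (rule arg_cong[of _ _ "\<lambda>x. a powr x"]) simp
        then show ?thesis using a by (simp add: power2_eq_square)
      qed
      also have "(1 - \<epsilon>) * (a * (a powr (- \<alpha>))\<^sup>2) / (2 * J) = (1 - \<epsilon>) * (a / 2 * (a powr (- \<alpha>))\<^sup>2) / J" by simp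
      also have "\<dots> \<le> (1 - \<epsilon>) * (real (m n) * h n * (M n * u n)\<^sup>2) / J"
        using eps J_pos mh Mu_ge a h by (intro divide_right_mono mult_left_mono mult_mono power_mono) auto
      also have "\<dots> = (\<beta> n * m n) * M n * M n" unfolding \<beta>m by (simp add: power2_eq_square)
      finally show ?thesis by (simp add: mult_ac)
    qed
    have y0: "\<xi> * u n \<le> \<beta> n * M n * card {1..m n} / 3"
    proof -
      have "\<xi> * u n \<le> (1 - \<epsilon>) * a powr (1 - \<alpha>) / (6 * J) * u n" using \<xi> n by (intro mult_right_mono) auto
      also have "a powr (1 - \<alpha>) = a * a powr (- \<alpha>)" using a by (simp add: powr_diff powr_minus_divide)
      also have "(1 - \<epsilon>) * (a * a powr (- \<alpha>)) / (6 * J) * u n = (1 - \<epsilon>) * (a / 2 * a powr (- \<alpha>)) / (3 * J) * u n" by simp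
      also have "\<dots> \<le> (1 - \<epsilon>) * (real (m n) * h n * (M n * u n)) / (3 * J) * u n"
        using eps J_pos mh Mu_ge a h n by (intro divide_right_mono mult_right_mono mult_left_mono mult_mono) auto
      also have "\<dots> = (\<beta> n * m n) * M n / 3" unfolding \<beta>m by (simp add: power2_eq_square mult_ac)
      finally show ?thesis by (simp add: mult_ac)
    qed
    have "measure_pmf.prob (simple_edges n)
        {E. \<not> (\<exists>v\<in>{1..n}. (1 - 5 * \<kappa>) * s n \<le> card (reach {1..n} {v} E))}
      \<le> measure_pmf.prob (simple_edges n)
        {E. \<not> (\<exists>z\<in>{1..n}. (1 - \<epsilon>) * (\<Sum>r<R. \<Sum>i\<in>B n r. 1 - exp (- (v n i * Q n))) \<le> card (reach {1..n} {z} E))}"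
    proof (rule measure_pmf.finite_measure_mono)
      show "{E. \<not> (\<exists>v\<in>{1..n}. (1 - 5 * \<kappa>) * s n \<le> card (reach {1..n} {v} E))} \<subseteq>
          {E. \<not> (\<exists>z\<in>{1..n}. (1 - \<epsilon>) * (\<Sum>r<R. \<Sum>i\<in>B n r. 1 - exp (- (v n i * Q n))) \<le> card (reach {1..n} {z} E))}"
        using order_trans[OF count] by blast
    qed simp
    also have "\<dots> \<le> exp (- (card {1..m n} / 10)) + real (2 ^ R * R * (N + 2)) * exp (- (\<epsilon>\<^sup>2 * (\<xi> * u n) / (2 * M n * R * \<beta> n)))"
    proof (rule layered_giant_component)
      show "{1..m n} \<subseteq> {1..n}" "{1..m n} \<noteq> {}" using mn m0 by auto
      show "B n r \<subseteq> {1..n}" "{1..m n} \<inter> B n r = {}" if "r < R" for r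
        using Bsub[OF that] by auto
      show "Q n \<le> \<xi> * u n * (1 + \<delta> / 2) ^ N" using N n by (simp add: Q_def mult_ac)
      show "0 < \<xi> * u n" "\<xi> * u n \<le> Q n" using \<xi> n by (auto simp: Q_def)
      show "\<beta> n * v n i * v n j \<le> ?q (edge i j)" if "i \<in> {1..n}" "j \<in> {1..n}" "i \<noteq> j" for i j
        using that by (rule lower)
      show "(1 + \<delta>) * y / R \<le> (1 - \<epsilon>) * \<beta> n * (\<Sum>i\<in>B n r. v n i * (1 - exp (- (v n i * y))))"
        if "0 < y" "y \<le> Q n" "r < R" for y r using that by (rule Isum)
      show "v n i = M n" if "i \<in> {1..m n}" for i using that by (simp add: v_def)
      show "B n r \<inter> B n r' = {}" if "r < R" "r' < R" "r \<noteq> r'" for r r' using that by (rule disj)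
    qed (use q vle Mpos \<beta>pos core y0 eps \<delta> R in auto)
    also have "\<dots> \<le> bound n"
      unfolding bound_def
    proof (intro add_mono mult_left_mono)
      show "exp (- (card {1..m n} / 10)) \<le> exp (- ((a * C * X n - 1) / 10))" using m_ge by simp
      have "k2 * X n \<le> \<epsilon>\<^sup>2 * (\<xi> * u n) / (2 * M n * R * \<beta> n)"
      proof -
        have "M n * u n * (a / 2) powr \<alpha> \<le> (a / 2) powr (- \<alpha>) * (a / 2) powr \<alpha>"
          using Mu_le by (intro mult_right_mono) auto
        also have "\<dots> = 1" using a by (simp add: powr_add[symmetric])
        finally have Ma: "M n * u n * (a / 2) powr \<alpha> \<le> 1" .
        have XB: "C * J * X n * \<beta> n \<le> (u n)\<^sup>2"
        proof -
          have "C * J * X n * \<beta> n = (1 - \<epsilon>) * (u n)\<^sup>2"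
            unfolding \<beta>eq X_def e[symmetric] using n C J_pos by simp
          also have "\<dots> \<le> 1 * (u n)\<^sup>2" using eps by (intro mult_right_mono) auto
          finally show ?thesis by simp
        qed
        have "k2 * X n * (2 * M n * R * \<beta> n) = \<epsilon>\<^sup>2 * \<xi> * ((a / 2) powr \<alpha> * M n) * (C * J * X n * \<beta> n)"
          using R by (simp add: k2_def)
        also have "\<dots> \<le> \<epsilon>\<^sup>2 * \<xi> * ((a / 2) powr \<alpha> * M n) * (u n)\<^sup>2"
          using XB \<xi> Mpos by (intro mult_left_mono) auto
        also have "\<dots> = \<epsilon>\<^sup>2 * \<xi> * (M n * u n * (a / 2) powr \<alpha>) * u n" by (simp add: power2_eq_square)
        also have "\<dots> \<le> \<epsilon>\<^sup>2 * \<xi> * 1 * u n" using Ma \<xi> n by (intro mult_right_mono mult_left_mono) auto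
        finally show ?thesis using Mpos R \<beta>pos by (simp add: pos_le_divide_eq mult_ac)
      qed
      then show "exp (- (\<epsilon>\<^sup>2 * (\<xi> * u n) / (2 * M n * R * \<beta> n))) \<le> exp (- (k2 * X n))" by simp
    qed auto
    finally show ?case .
  qed
  have X: "filterlim X at_top sequentially" using n_u_powr by (simp only: X_def[abs_def])
  have e: "(\<lambda>n. exp (- (k * X n))) \<longlonglongrightarrow> 0" if "0 < k" for k
  proof -
    have "filterlim (\<lambda>n. k * X n) at_top sequentially"
      by (rule filterlim_tendsto_pos_mult_at_top[OF tendsto_const that X])
    then have "filterlim (\<lambda>n. - (k * X n)) at_bot sequentially"
      unfolding filterlim_uminus_at_bot by simp
    then show ?thesis by (rule filterlim_compose[OF exp_at_bot])
  qed
  have "bound n = exp (1 / 10) * exp (- (a * C / 10 * X n)) + real (2 ^ R * R * (N + 2)) * exp (- (k2 * X n))" for n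
  proof -
    have "- ((a * C * X n - 1) / 10) = 1 / 10 + - (a * C / 10 * X n)" by (simp add: diff_divide_distrib)
    then show ?thesis unfolding bound_def mult_exp_exp by (simp only:)
  qed
  then have bound: "bound = (\<lambda>n. exp (1 / 10) * exp (- (a * C / 10 * X n)) + real (2 ^ R * R * (N + 2)) * exp (- (k2 * X n)))"
    by (rule ext)
  have aC: "0 < a * C / 10" using a C by simp
  have "(\<lambda>n. exp (1 / 10) * exp (- (a * C / 10 * X n)) + real (2 ^ R * R * (N + 2)) * exp (- (k2 * X n)))
      \<longlonglongrightarrow> exp (1 / 10) * 0 + real (2 ^ R * R * (N + 2)) * 0"
    by (intro tendsto_add tendsto_mult tendsto_const e[OF aC] e[OF k2])
  then have lim: "bound \<longlonglongrightarrow> 0" unfolding bound by simp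
  show ?thesis
    by (rule tendsto_sandwich[OF _ le_bound tendsto_const lim]) simp
qed

end

section \<open>Coupled component sizes\<close>

text \<open>Off the event \<open>bad\<close>, \<open>Z\<close> is at least
  \<open>(1 - \<kappa>) * s\<close>, while its mean is at most \<open>(1 + \<epsilon>) * s\<close>;
  Markov's inequality for the excess then makes \<open>Z > (1 + \<eta>) * s\<close> unlikely. Off
  both exceptional events the two largest components lie between \<open>(1 - \<kappa>) * s\<close>
  and \<open>Z\<close>, and a \<open>j\<close>-th component above the threshold has to fit into
  \<open>Z\<close> beside the largest one. As \<open>\<kappa> \<le> \<eta>\<close>, the room left is
  at most \<open>2 * \<eta> * s\<close>.\<close>

lemma coupled_component_sizes:
  fixes \<Omega> :: "'w measure" and s \<eta> \<epsilon> \<kappa> b :: real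
  assumes coupling: "NR_perc_coupling n w p \<Omega> G H"
    and sub: "set_pmf (map_pmf (\<lambda>G. fst ` G) (MNR_perc n w p)) \<subseteq> Pow (vertex_pairs n)"
      "set_pmf (SNR_perc n w p) \<subseteq> Pow (vertex_pairs n)"
    and s: "0 < s" and \<eta>: "0 < \<eta>" "\<eta> \<le> 1 / 2" and \<kappa>: "0 \<le> \<kappa>" "\<kappa> \<le> \<eta>" and eps: "0 \<le> \<epsilon>"
    and upper: "measure_pmf.expectation (map_pmf (\<lambda>G. fst ` G) (MNR_perc n w p))
        (\<lambda>E. card (large_vertices {1..n} E (nat \<lceil>\<eta> * s\<rceil>))) \<le> (1 + \<epsilon>) * s"
    and giant: "measure_pmf.prob (SNR_perc n w p)
        {E. \<not> (\<exists>v\<in>{1..n}. (1 - \<kappa>) * s \<le> card (reach {1..n} {v} E))} \<le> b"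
  shows "measure \<Omega> {\<omega> \<in> space \<Omega>. 2 * \<eta> * s < \<bar>real (multi_comp_size n (G \<omega>) 1) - real (simple_comp_size n (H \<omega>) 1)\<bar>}
      \<le> (\<epsilon> + \<kappa> + b) / \<eta> + b" (is "?A \<le> _")
    and "j \<ge> 2 \<Longrightarrow> measure \<Omega> {\<omega> \<in> space \<Omega>. 2 * \<eta> * s < real (simple_comp_size n (H \<omega>) j)}
      \<le> (\<epsilon> + \<kappa> + b) / \<eta> + b" (is "_ \<Longrightarrow> ?B \<le> _")
proof -
  let ?far = "{\<omega> \<in> space \<Omega>. 2 * \<eta> * s < \<bar>real (multi_comp_size n (G \<omega>) 1) - real (simple_comp_size n (H \<omega>) 1)\<bar>}" and ?second = "{\<omega> \<in> space \<Omega>. 2 * \<eta> * s < real (simple_comp_size n (H \<omega>) j)}"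
  let ?V = "{1..n}" and ?k = "nat \<lceil>\<eta> * s\<rceil>"
  let ?c = "comp_size ?V" and ?L = "\<lambda>g. card (large_vertices ?V g ?k)"
  have G: "G \<in> measurable \<Omega> (count_space UNIV)" "distr \<Omega> (count_space UNIV) G = measure_pmf (MNR_perc n w p)"
    and H: "H \<in> measurable \<Omega> (count_space UNIV)" "distr \<Omega> (count_space UNIV) H = measure_pmf (SNR_perc n w p)"
    and HG: "AE \<omega> in \<Omega>. H \<omega> \<subseteq> fst ` G \<omega>"
    using coupling by (auto simp: NR_perc_coupling_def)
  interpret prob_space \<Omega> using coupling by (simp add: NR_perc_coupling_def)
  define Z where "Z \<omega> = real (?L (fst ` G \<omega>))" for \<omega>
  define bad where "bad = {\<omega> \<in> space \<Omega>. \<not> (\<exists>v\<in>?V. (1 - \<kappa>) * s \<le> card (reach ?V {v} (H \<omega>)))}"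
  define many where "many = {\<omega> \<in> space \<Omega>. (1 + \<eta>) * s < Z \<omega>}"
  have Z_meas [measurable]: "Z \<in> borel_measurable \<Omega>"
    unfolding Z_def by (rule measurable_compose[OF G(1)]) simp
  have bad_sets: "bad \<in> sets \<Omega>"
  proof -
    have eq: "bad = H -` {E. \<not> (\<exists>v\<in>?V. (1 - \<kappa>) * s \<le> card (reach ?V {v} E))} \<inter> space \<Omega>"
      by (auto simp: bad_def)
    show ?thesis unfolding eq by (rule measurable_sets[OF H(1)]) simp
  qed
  have many_sets: "many \<in> sets \<Omega>" unfolding many_def by measurable
  have k: "0 < ?k" "\<eta> * s \<le> ?k" using s \<eta> by (auto simp: real_nat_ceiling_ge)
  have Zle: "Z \<omega> \<le> n" for \<omega>
  proof -
    have "?L (fst ` G \<omega>) \<le> card ?V"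
      by (intro card_mono) (auto simp: large_vertices_def)
    then show ?thesis by (simp add: Z_def)
  qed
  have Z_int: "integrable \<Omega> Z"
    using Zle by (intro integrable_const_bound[where B = n]) (auto simp: Z_def)
  have EZ: "expectation Z \<le> (1 + \<epsilon>) * s"
  proof -
    have "expectation Z = (\<integral>E. real (card (large_vertices ?V (fst ` E) ?k)) \<partial>distr \<Omega> (count_space UNIV) G)"
      unfolding Z_def by (rule integral_distr[OF G(1), symmetric]) simp
    then show ?thesis using upper by (simp add: G(2))
  qed
  have Pbad: "prob bad \<le> b"
  proof -
    have "prob bad = measure (distr \<Omega> (count_space UNIV) H) {E. \<not> (\<exists>v\<in>?V. (1 - \<kappa>) * s \<le> card (reach ?V {v} E))}"
      by (subst measure_distr[OF H(1)]) (auto simp: bad_def intro!: arg_cong[of _ _ prob])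
    then show ?thesis using giant by (simp add: H(2))
  qed
  have AEG: "AE \<omega> in \<Omega>. fst ` G \<omega> \<subseteq> vertex_pairs n"
  proof -
    have "AE g in distr \<Omega> (count_space UNIV) G. fst ` g \<subseteq> vertex_pairs n"
      unfolding G(2) using sub(1) by (intro AE_pmfI) auto
    then show ?thesis by (rule AE_distrD[OF G(1)])
  qed
  have AEH: "AE \<omega> in \<Omega>. H \<omega> \<subseteq> vertex_pairs n"
  proof -
    have "AE g in distr \<Omega> (count_space UNIV) H. g \<subseteq> vertex_pairs n"
      unfolding H(2) using sub(2) by (intro AE_pmfI) auto
    then show ?thesis by (rule AE_distrD[OF H(1)])
  qed
  have main: "(1 - \<kappa>) * s \<le> ?c h 1 \<and> ?c h 1 \<le> ?c g 1 \<and>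
      ?c g 1 \<le> ?L g \<and>
      (j \<ge> 2 \<longrightarrow> ?k \<le> ?c h j \<longrightarrow> ?c h 1 + ?c h j \<le> ?L g)"
    if v: "v \<in> ?V" "(1 - \<kappa>) * s \<le> card (reach ?V {v} h)"
      and hg: "h \<subseteq> g" "g \<subseteq> vertex_pairs n" for v h g j
  proof -
    have gV: "g \<subseteq> ?V \<times> ?V" using hg vertex_pairs_subset[of n] by blast
    then have hV: "h \<subseteq> ?V \<times> ?V" using hg by blast
    have 1: "(1 - \<kappa>) * s \<le> ?c h 1"
      using v card_reach_le_comp_size_1[OF _ hV v(1)] by simp
    have 2: "?c h 1 \<le> ?c g 1" using hg gV by (intro comp_size_1_mono) auto
    \<comment> \<open>\<open>\<kappa> \<le> \<eta> \<le> 1 / 2\<close> puts the largest component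
      above the threshold that defines \<open>Z\<close>.\<close>
    have "\<eta> * s \<le> (1 - \<kappa>) * s" using \<eta> \<kappa> s by (intro mult_right_mono) auto
    then have "\<eta> * s \<le> ?c h 1" using 1 by linarith
    then have kh: "?k \<le> ?c h 1" by (simp add: ceiling_le_iff nat_le_iff)
    have 3: "?c g 1 \<le> ?L g"
      using kh 2 k gV by (intro comp_size_1_le) auto
    have 4: "?c h 1 + ?c h j \<le> ?L g"
      if "j \<ge> 2" "?k \<le> ?c h j"
    proof -
      have "?c h 1 + ?c h j \<le> ?L h"
        using that kh k hV by (intro comp_size_sum_le) auto
      also have "\<dots> \<le> ?L g"
        using large_vertices_mono[of ?V h g ?k] hg by (intro card_mono) (auto simp: large_vertices_def)
      finally show ?thesis .
    qed
    show ?thesis using 1 2 3 4 by blast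
  qed
  have Pmany: "prob many \<le> (\<epsilon> + \<kappa> + b) / \<eta>"
  proof -
    \<comment> \<open>The indicator term restores nonnegativity on \<open>bad\<close>, at a cost of
      at most \<open>b * s\<close> in the mean.\<close>
    define W where "W \<omega> = Z \<omega> + (1 - \<kappa>) * s * indicator bad \<omega> - (1 - \<kappa>) * s" for \<omega>
    have "integrable \<Omega> (indicator bad :: 'w \<Rightarrow> real)"
      using bad_sets by (intro integrable_real_indicator) (auto simp: emeasure_eq_measure)
    then have bad_int: "integrable \<Omega> (\<lambda>\<omega>. (1 - \<kappa>) * s * indicator bad \<omega>)"
      by (rule integrable_mult_right)
    have W_int: "integrable \<Omega> W"
      unfolding W_def by (intro Bochner_Integration.integrable_diff Bochner_Integration.integrable_add Z_int bad_int) simp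
    have W0: "AE \<omega> in \<Omega>. 0 \<le> W \<omega>"
      using AE_space HG AEG
    proof eventually_elim
      case (elim \<omega>)
      show ?case
      proof (cases "\<omega> \<in> bad")
        case True
        then show ?thesis by (simp add: W_def Z_def)
      next
        case False
        then obtain v where "v \<in> ?V" "(1 - \<kappa>) * s \<le> card (reach ?V {v} (H \<omega>))"
          using elim(1) by (auto simp: bad_def)
        from main[OF this elim(2,3)]
        have "(1 - \<kappa>) * s \<le> ?c (H \<omega>) 1" "?c (H \<omega>) 1 \<le> ?c (fst ` G \<omega>) 1"
          "?c (fst ` G \<omega>) 1 \<le> ?L (fst ` G \<omega>)" by blast+
        then have "(1 - \<kappa>) * s \<le> Z \<omega>" unfolding Z_def by linarith
        then show ?thesis using False by (simp add: W_def)
      qed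
    qed
    have "expectation W = expectation Z + (1 - \<kappa>) * s * prob bad - (1 - \<kappa>) * s"
    proof -
      have "expectation W = expectation (\<lambda>\<omega>. Z \<omega> + (1 - \<kappa>) * s * indicator bad \<omega>) - (1 - \<kappa>) * s"
        unfolding W_def using Bochner_Integration.integrable_add[OF Z_int bad_int]
        by (subst Bochner_Integration.integral_diff) (simp_all add: prob_space)
      also have "expectation (\<lambda>\<omega>. Z \<omega> + (1 - \<kappa>) * s * indicator bad \<omega>)
          = expectation Z + expectation (\<lambda>\<omega>. (1 - \<kappa>) * s * indicator bad \<omega>)"
        by (rule Bochner_Integration.integral_add[OF Z_int bad_int])
      also have "expectation (\<lambda>\<omega>. (1 - \<kappa>) * s * indicator bad \<omega>) = (1 - \<kappa>) * s * prob bad"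
        using bad_sets by simp
      finally show ?thesis .
    qed
    also have "\<dots> \<le> (1 + \<epsilon>) * s + (1 * s * b) - (1 - \<kappa>) * s"
      using EZ Pbad \<kappa> \<eta> s by (intro diff_right_mono add_mono mult_mono) auto
    also have "\<dots> = (\<epsilon> + \<kappa> + b) * s" by (simp add: algebra_simps)
    finally have EW: "expectation W \<le> (\<epsilon> + \<kappa> + b) * s" .
    have "prob many \<le> prob {\<omega> \<in> space \<Omega>. \<eta> * s \<le> W \<omega>}"
    proof (rule finite_measure_mono)
      show "many \<subseteq> {\<omega> \<in> space \<Omega>. \<eta> * s \<le> W \<omega>}"
      proof
        fix \<omega> assume "\<omega> \<in> many"
        then have \<omega>: "\<omega> \<in> space \<Omega>" "(1 + \<eta>) * s < Z \<omega>" by (auto simp: many_def)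
        have "0 \<le> (1 - \<kappa>) * s * indicator bad \<omega>" "0 \<le> \<kappa> * s" using \<kappa> \<eta> s by auto
        then have "\<eta> * s \<le> W \<omega>" using \<omega> by (simp add: W_def algebra_simps)
        then show "\<omega> \<in> {\<omega> \<in> space \<Omega>. \<eta> * s \<le> W \<omega>}" using \<omega> by simp
      qed
      show "{\<omega> \<in> space \<Omega>. \<eta> * s \<le> W \<omega>} \<in> events"
        using borel_measurable_integrable[OF W_int] by measurable
    qed
    also have "\<dots> \<le> expectation W / (\<eta> * s)"
      using W_int W0 \<eta> s by (intro integral_Markov_inequality_measure[where A = "{}"]) auto
    also have "\<dots> \<le> (\<epsilon> + \<kappa> + b) * s / (\<eta> * s)" using EW \<eta> s by (intro divide_right_mono) auto
    also have "\<dots> = (\<epsilon> + \<kappa> + b) / \<eta>" using s by simp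
    finally show ?thesis .
  qed
  have total: "prob (many \<union> bad) \<le> (\<epsilon> + \<kappa> + b) / \<eta> + b"
    using Pmany Pbad measure_Un_le[OF many_sets bad_sets] by linarith
  have \<kappa>s: "\<kappa> * s \<le> \<eta> * s" using \<kappa> s by (intro mult_right_mono) auto
  have "?A \<le> prob (many \<union> bad)"
  proof (rule finite_measure_mono_AE)
    show "AE \<omega> in \<Omega>. \<omega> \<in> ?far
        \<longrightarrow> \<omega> \<in> many \<union> bad"
      using HG AEG
    proof eventually_elim
      case (elim \<omega>)
      show ?case
      proof (intro impI, rule ccontr)
        assume *: "\<omega> \<in> ?far"
          and no: "\<omega> \<notin> many \<union> bad"
        then obtain v where "v \<in> ?V" "(1 - \<kappa>) * s \<le> card (reach ?V {v} (H \<omega>))" by (auto simp: bad_def)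
        from main[OF this elim]
        have m: "(1 - \<kappa>) * s \<le> ?c (H \<omega>) 1" "?c (H \<omega>) 1 \<le> ?c (fst ` G \<omega>) 1"
          "?c (fst ` G \<omega>) 1 \<le> ?L (fst ` G \<omega>)" by blast+
        have "Z \<omega> \<le> (1 + \<eta>) * s" using no * by (auto simp: many_def)
        then have "Z \<omega> \<le> s + \<eta> * s" by (simp add: algebra_simps)
        moreover have "s - \<kappa> * s \<le> ?c (H \<omega>) 1" using m(1) by (simp add: algebra_simps)
        moreover have "2 * (\<eta> * s) < real (?c (fst ` G \<omega>) 1) - ?c (H \<omega>) 1"
          using * m(2) by (simp add: multi_comp_size_def simple_comp_size_def)
        ultimately show False using m(3) \<kappa>s unfolding Z_def by linarith
      qed
    qed
  qed (use many_sets bad_sets in auto)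
  with total show "?A \<le> (\<epsilon> + \<kappa> + b) / \<eta> + b" by linarith
  assume j: "j \<ge> 2"
  have "?B \<le> prob (many \<union> bad)"
  proof (rule finite_measure_mono_AE)
    show "AE \<omega> in \<Omega>. \<omega> \<in> ?second \<longrightarrow> \<omega> \<in> many \<union> bad"
      using HG AEG
    proof eventually_elim
      case (elim \<omega>)
      show ?case
      proof (intro impI, rule ccontr)
        assume *: "\<omega> \<in> ?second"
          and no: "\<omega> \<notin> many \<union> bad"
        then obtain v where "v \<in> ?V" "(1 - \<kappa>) * s \<le> card (reach ?V {v} (H \<omega>))" by (auto simp: bad_def)
        note m = main[OF this elim, of j]
        then have m1: "(1 - \<kappa>) * s \<le> ?c (H \<omega>) 1" by blast
        have "Z \<omega> \<le> (1 + \<eta>) * s" using no * by (auto simp: many_def)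
        moreover have "\<eta> * s \<le> 2 * \<eta> * s" using \<eta> s by simp
        then have "\<eta> * s \<le> ?c (H \<omega>) j" using * by (simp add: simple_comp_size_def)
        then have "?k \<le> ?c (H \<omega>) j" by (simp add: ceiling_le_iff nat_le_iff)
        then have "?c (H \<omega>) 1 + ?c (H \<omega>) j \<le> ?L (fst ` G \<omega>)"
          using m j by blast
        then have "real (?c (H \<omega>) 1) + ?c (H \<omega>) j \<le> Z \<omega>"
          unfolding Z_def by linarith
        moreover have "s - \<kappa> * s \<le> ?c (H \<omega>) 1" using m1 by (simp add: algebra_simps)
        moreover have "2 * (\<eta> * s) < ?c (H \<omega>) j" using * by (simp add: simple_comp_size_def)
        ultimately show False using \<kappa>s by (simp add: algebra_simps)
      qed
    qed
  qed (use many_sets bad_sets in auto)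
  with total show "?B \<le> (\<epsilon> + \<kappa> + b) / \<eta> + b" by linarith
qed

section \<open>From the scale s to the normalisation by n and p\<close>

context percolation_regime
begin

lemma s_le: "eventually (\<lambda>n. s n \<le> (C * J / c) powr (1 / (3 - \<tau>)) * (c / (1 - \<alpha>)) * (real n * p n powr (1 / (3 - \<tau>)))) sequentially"
  using ev_pos
proof eventually_elim
  case (elim n)
  define k where "k = C * J / c"
  have k: "0 < k" using C J_pos c_pos by (simp add: k_def)
  have "u n \<le> (p n * k) powr (1 / (3 - \<tau>))" using u_bounds(2)[of n] elim by (simp add: k_def)
  then have "s n \<le> (p n * k) powr (1 / (3 - \<tau>)) * (c * real n / (1 - \<alpha>))"
    unfolding s_def using elim ell_le[of n] by (intro mult_mono) auto
  also have "\<dots> = k powr (1 / (3 - \<tau>)) * (c / (1 - \<alpha>)) * (real n * p n powr (1 / (3 - \<tau>)))"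
    using elim k by (simp add: powr_mult)
  finally show ?case by (simp only: k_def)
qed

text \<open>Deviations are controlled in units of \<open>s n\<close>. By \<open>s_le\<close> this is
  at most a constant \<open>A\<close> times the normalisation, so \<eta> is chosen with
  \<open>2 * \<eta> * A \<le> \<epsilon>\<close>.\<close>

lemma small_o_P_if_eventually_le:
  fixes Y :: "nat \<Rightarrow> 'w \<Rightarrow> real"
  assumes Y: "\<And>n \<omega>. 0 \<le> Y n \<omega>"
    and prob: "eventually (\<lambda>n. prob_space (\<Omega> n)) sequentially"
    and meas: "eventually (\<lambda>n. Y n \<in> borel_measurable (\<Omega> n)) sequentially"
    and small: "\<And>\<eta> \<gamma>. 0 < \<eta> \<Longrightarrow> \<eta> \<le> 1 / 2 \<Longrightarrow> 0 < \<gamma> \<Longrightarrow>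
      eventually (\<lambda>n. measure (\<Omega> n) {\<omega> \<in> space (\<Omega> n). 2 * \<eta> * s n < Y n \<omega>} \<le> \<gamma>) sequentially"
  shows "small_o_P \<Omega> Y (\<lambda>n. real n * p n powr (1 / (3 - \<tau>)))"
  unfolding small_o_P_def
proof (intro allI impI)
  fix \<epsilon> :: real assume eps: "0 < \<epsilon>"
  define A where "A = (C * J / c) powr (1 / (3 - \<tau>)) * (c / (1 - \<alpha>))"
  have A: "0 < A" using C J_pos c_pos alpha by (simp add: A_def)
  define \<eta> where "\<eta> = min (1 / 2) (\<epsilon> / (2 * A))"
  have \<eta>: "0 < \<eta>" "\<eta> \<le> 1 / 2" "2 * \<eta> * A \<le> \<epsilon>"
  proof -
    show "0 < \<eta>" "\<eta> \<le> 1 / 2" using eps A by (auto simp: \<eta>_def)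
    have "\<eta> \<le> \<epsilon> / (2 * A)" by (simp add: \<eta>_def)
    then show "2 * \<eta> * A \<le> \<epsilon>" using A by (simp add: field_simps)
  qed
  let ?b = "\<lambda>n. real n * p n powr (1 / (3 - \<tau>))"
  show "(\<lambda>n. measure (\<Omega> n) {\<omega> \<in> space (\<Omega> n). \<epsilon> < \<bar>Y n \<omega> / ?b n\<bar>}) \<longlonglongrightarrow> 0"
  proof (rule tendstoI)
    fix \<gamma> :: real assume \<gamma>: "0 < \<gamma>"
    then have "0 < \<gamma> / 2" by simp
    from small[OF \<eta>(1,2) this] prob meas ev_pos s_le
    show "eventually (\<lambda>n. dist (measure (\<Omega> n) {\<omega> \<in> space (\<Omega> n). \<epsilon> < \<bar>Y n \<omega> / ?b n\<bar>}) 0 < \<gamma>) sequentially"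
    proof eventually_elim
      case (elim n)
      interpret prob_space "\<Omega> n" by fact
      have [measurable]: "Y n \<in> borel_measurable (\<Omega> n)" by fact
      have b: "0 < ?b n" using elim(4) by simp
      have "2 * \<eta> * s n \<le> 2 * \<eta> * (A * ?b n)" using elim(5) \<eta> unfolding A_def by (intro mult_left_mono) auto
      also have "\<dots> = 2 * \<eta> * A * ?b n" by simp
      also have "\<dots> \<le> \<epsilon> * ?b n" using \<eta>(3) b by (intro mult_right_mono) auto
      finally have sb: "2 * \<eta> * s n \<le> \<epsilon> * ?b n" .
      have "prob {\<omega> \<in> space (\<Omega> n). \<epsilon> < \<bar>Y n \<omega> / ?b n\<bar>} \<le> prob {\<omega> \<in> space (\<Omega> n). 2 * \<eta> * s n < Y n \<omega>}"
      proof (rule finite_measure_mono)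
        show "{\<omega> \<in> space (\<Omega> n). \<epsilon> < \<bar>Y n \<omega> / ?b n\<bar>} \<subseteq> {\<omega> \<in> space (\<Omega> n). 2 * \<eta> * s n < Y n \<omega>}"
        proof safe
          fix \<omega> assume "\<epsilon> < \<bar>Y n \<omega> / ?b n\<bar>"
          then have "\<epsilon> < Y n \<omega> / ?b n" using Y[of n \<omega>] b by (simp only: abs_of_nonneg divide_nonneg_pos)
          then have "\<epsilon> * ?b n < Y n \<omega>" using b by (simp only: pos_less_divide_eq)
          with sb show "2 * \<eta> * s n < Y n \<omega>" by linarith
        qed
      qed measurable
      also have "\<dots> \<le> \<gamma> / 2" using elim(1) .
      finally show ?case using \<gamma> by simp
    qed
  qed
qed

lemma MNR_law: "eventually (\<lambda>n. map_pmf (\<lambda>G. fst ` G) (MNR_perc n (w n) (p n)) =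
    multi_edges n) sequentially"
  using ev_pos
proof eventually_elim
  case (elim n)
  show ?case unfolding ell_def vertex_pairs_eq_pairs[symmetric]
    using elim w_pos by (intro map_fst_MNR_perc) (auto simp: vertex_pairs_def ell_def[symmetric])
qed

lemma SNR_law: "eventually (\<lambda>n. SNR_perc n (w n) (p n) = simple_edges n) sequentially"
  using ev_pos
proof eventually_elim
  case (elim n)
  show ?case unfolding ell_def vertex_pairs_eq_pairs[symmetric]
    using elim w_pos by (intro SNR_perc_eq_random_subset) (auto simp: vertex_pairs_def ell_def[symmetric])
qed

lemma component_sizes_close:
  assumes coupling: "eventually (\<lambda>n. NR_perc_coupling n (w n) (p n) (\<Omega> n) (G n) (H n)) sequentially"
    and \<eta>: "0 < \<eta>" "\<eta> \<le> 1 / 2" and \<gamma>: "0 < \<gamma>"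
  shows "eventually (\<lambda>n. measure (\<Omega> n) {\<omega> \<in> space (\<Omega> n). 2 * \<eta> * s n <
      \<bar>real (multi_comp_size n (G n \<omega>) 1) - real (simple_comp_size n (H n \<omega>) 1)\<bar>} \<le> \<gamma>) sequentially"
    and "j \<ge> 2 \<Longrightarrow> eventually (\<lambda>n. measure (\<Omega> n) {\<omega> \<in> space (\<Omega> n). 2 * \<eta> * s n <
      real (simple_comp_size n (H n \<omega>) j)} \<le> \<gamma>) sequentially"
proof -
  \<comment> \<open>With mean error \<open>e\<close>, failure probability \<open>e\<close> and
    \<open>\<kappa> = 5 * e\<close>, the coupled bound is
    \<open>(e + 5 * e + e) / \<eta> + e\<close>, at most \<open>8 * e / \<eta>\<close>. The first
    entry of the minimum guarantees \<open>\<kappa> \<le> \<eta>\<close>.\<close>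
  define e where "e = min (\<eta> / 5) (\<eta> * \<gamma> / 9)"
  have e: "0 < e" "5 * e \<le> \<eta>" "9 * e \<le> \<eta> * \<gamma>" using \<eta> \<gamma> by (auto simp: e_def)
  have small: "(e + 5 * e + e) / \<eta> + e \<le> \<gamma>"
  proof -
    have "e \<le> e / \<eta>" using e \<eta> by (simp add: field_simps)
    then have "(e + 5 * e + e) / \<eta> + e \<le> (8 * e) / \<eta>" by (simp add: add_divide_distrib)
    also have "\<dots> \<le> \<gamma>" using e \<eta> by (simp add: field_simps)
    finally show ?thesis .
  qed
  have "e \<le> 1 / 5" using e \<eta> by linarith
  from order_tendstoD(2)[OF giant_component[OF e(1) this] e(1)]
  have giant: "eventually (\<lambda>n. measure_pmf.prob (simple_edges n)
      {E. \<not> (\<exists>v\<in>{1..n}. (1 - 5 * e) * s n \<le> card (reach {1..n} {v} E))} < e) sequentially" .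
  have both: "eventually (\<lambda>n.
      measure (\<Omega> n) {\<omega> \<in> space (\<Omega> n). 2 * \<eta> * s n <
        \<bar>real (multi_comp_size n (G n \<omega>) 1) - real (simple_comp_size n (H n \<omega>) 1)\<bar>} \<le> \<gamma> \<and>
      (j \<ge> 2 \<longrightarrow> measure (\<Omega> n) {\<omega> \<in> space (\<Omega> n). 2 * \<eta> * s n <
        real (simple_comp_size n (H n \<omega>) j)} \<le> \<gamma>)) sequentially"
    using coupling giant expected_large_vertices[OF e(1) \<eta>(1)] s_pos MNR_law SNR_law
  proof eventually_elim
    case (elim n)
    have sub: "set_pmf (map_pmf (\<lambda>G. fst ` G) (MNR_perc n (w n) (p n))) \<subseteq> Pow (vertex_pairs n)"
      "set_pmf (SNR_perc n (w n) (p n)) \<subseteq> Pow (vertex_pairs n)"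
      unfolding elim(5,6) vertex_pairs_eq_pairs by (rule set_random_subset)+
    note c = coupled_component_sizes[OF elim(1) sub elim(4) \<eta>, where \<kappa> = "5 * e" and \<epsilon> = e and b = e,
        unfolded elim(5,6)]
    show ?case
      using c(1)[OF _ e(2) _ elim(3)] c(2)[OF _ e(2) _ elim(3)] elim(2) e(1) small
      by (meson less_imp_le mult_pos_pos order_trans zero_less_numeral)
  qed
  then show "eventually (\<lambda>n. measure (\<Omega> n) {\<omega> \<in> space (\<Omega> n). 2 * \<eta> * s n <
      \<bar>real (multi_comp_size n (G n \<omega>) 1) - real (simple_comp_size n (H n \<omega>) 1)\<bar>} \<le> \<gamma>) sequentially"
    by eventually_elim simp
  assume j: "j \<ge> 2"
  from both show "eventually (\<lambda>n. measure (\<Omega> n) {\<omega> \<in> space (\<Omega> n). 2 * \<eta> * s n <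
      real (simple_comp_size n (H n \<omega>) j)} \<le> \<gamma>) sequentially"
    by eventually_elim (use j in simp)
qed

end

theorem theorem1p5:
  fixes \<tau> C :: real
    and lam p :: "nat \<Rightarrow> real"
    and \<Omega> :: "nat \<Rightarrow> 'w measure"
    and G :: "nat \<Rightarrow> 'w \<Rightarrow> ((nat \<times> nat) \<times> nat) set"
    and H :: "nat \<Rightarrow> 'w \<Rightarrow> (nat \<times> nat) set"
  assumes tau: "2 < \<tau>" "\<tau> < 3"
    and C: "C > 0"
    and lam_infinity: "filterlim lam at_top sequentially"
    and lam_small: "lam \<in> o(\<lambda>n. real n powr ((3 - \<tau>) / 2))"
    and p: "\<And>n. p n = lam n * real n powr (- ((3 - \<tau>) / 2))"
    and coupling: "\<And>n. n \<ge> 1 \<Longrightarrow> 0 \<le> p n \<Longrightarrow> p n \<le> 1 \<Longrightarrow>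
          NR_perc_coupling n (pareto_weight \<tau> C n) (p n) (\<Omega> n) (G n) (H n)"
  shows "small_o_P \<Omega>
           (\<lambda>n \<omega>. \<bar>real (multi_comp_size n (G n \<omega>) 1) - real (simple_comp_size n (H n \<omega>) 1)\<bar>)
           (\<lambda>n. real n * p n powr (1 / (3 - \<tau>))) \<and>
         (\<forall>j\<ge>2. small_o_P \<Omega>
           (\<lambda>n \<omega>. real (simple_comp_size n (H n \<omega>) j))
           (\<lambda>n. real n * p n powr (1 / (3 - \<tau>))))"
proof -
  have lam_pos: "eventually (\<lambda>n. 0 < lam n) sequentially"
    using lam_infinity by (auto simp: filterlim_at_top_dense)
  interpret percolation_regime \<tau> C p
  proof
    show "eventually (\<lambda>n. 0 < p n) sequentially"
      using lam_pos eventually_gt_at_top[of 0] by eventually_elim (simp add: p)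
    show "p \<longlonglongrightarrow> 0"
    proof -
      have "(\<lambda>n. lam n / real n powr ((3 - \<tau>) / 2)) \<longlonglongrightarrow> 0" using lam_small by (rule smalloD_tendsto)
      moreover have "p = (\<lambda>n. lam n / real n powr ((3 - \<tau>) / 2))"
        unfolding p powr_minus divide_inverse by (simp add: p powr_minus fun_eq_iff)
      ultimately show ?thesis by simp
    qed
    have "filterlim (\<lambda>n. lam n powr (2 / (3 - \<tau>))) at_top sequentially"
    proof (rule filterlim_compose[OF _ lam_infinity])
      show "filterlim (\<lambda>x. x powr (2 / (3 - \<tau>))) at_top (at_top :: real filter)"
        using tau by (intro real_powr_at_top) auto
    qed
    \<comment> \<open>The exponents \<open>- ((3 - \<tau>) / 2)\<close> and
      \<open>2 / (3 - \<tau>)\<close> multiply to -1, which cancels the factor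
      \<open>n\<close>.\<close>
    moreover have "eventually (\<lambda>n. lam n powr (2 / (3 - \<tau>)) = real n * p n powr (2 / (3 - \<tau>))) sequentially"
      using lam_pos eventually_gt_at_top[of 0]
    proof eventually_elim
      case (elim n)
      have "p n powr (2 / (3 - \<tau>)) = lam n powr (2 / (3 - \<tau>)) * (real n powr (- ((3 - \<tau>) / 2))) powr (2 / (3 - \<tau>))"
        using elim unfolding p by (intro powr_mult)
      also have "(real n powr (- ((3 - \<tau>) / 2))) powr (2 / (3 - \<tau>)) = real n powr (- ((3 - \<tau>) / 2) * (2 / (3 - \<tau>)))"
        by (rule powr_powr)
      also have "- ((3 - \<tau>) / 2) * (2 / (3 - \<tau>)) = -1" using tau by simp
      finally have "p n powr (2 / (3 - \<tau>)) = lam n powr (2 / (3 - \<tau>)) * real n powr (- 1)" .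
      then show ?case using elim by (simp add: powr_minus_divide)
    qed
    ultimately show "filterlim (\<lambda>n. real n * p n powr (2 / (3 - \<tau>))) at_top sequentially"
      by (simp add: filterlim_cong[OF refl refl])
  qed (use tau C in auto)
  \<comment> \<open>The coupling is given where \<open>p n\<close> is a probability, which holds for
    all large \<open>n\<close>.\<close>
  have cpl: "eventually (\<lambda>n. NR_perc_coupling n (w n) (p n) (\<Omega> n) (G n) (H n)) sequentially"
    using ev_pos by eventually_elim (rule coupling; simp)
  have prob: "eventually (\<lambda>n. prob_space (\<Omega> n)) sequentially"
    using cpl by eventually_elim (simp add: NR_perc_coupling_def)
  have measG: "eventually (\<lambda>n. (\<lambda>\<omega>. f n (G n \<omega>)) \<in> borel_measurable (\<Omega> n)) sequentially"
    for f :: "nat \<Rightarrow> ((nat \<times> nat) \<times> nat) set \<Rightarrow> real"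
    using cpl by eventually_elim (auto simp: NR_perc_coupling_def intro: measurable_compose)
  have measH: "eventually (\<lambda>n. (\<lambda>\<omega>. f n (H n \<omega>)) \<in> borel_measurable (\<Omega> n)) sequentially"
    for f :: "nat \<Rightarrow> (nat \<times> nat) set \<Rightarrow> real"
    using cpl by eventually_elim (auto simp: NR_perc_coupling_def intro: measurable_compose)
  show ?thesis
  proof (intro conjI allI impI)
    show "small_o_P \<Omega>
           (\<lambda>n \<omega>. \<bar>real (multi_comp_size n (G n \<omega>) 1) - real (simple_comp_size n (H n \<omega>) 1)\<bar>)
           (\<lambda>n. real n * p n powr (1 / (3 - \<tau>)))"
    proof (rule small_o_P_if_eventually_le[OF _ prob])
      show "eventually (\<lambda>n. (\<lambda>\<omega>. \<bar>real (multi_comp_size n (G n \<omega>) 1) - real (simple_comp_size n (H n \<omega>) 1)\<bar>)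
          \<in> borel_measurable (\<Omega> n)) sequentially"
        using measG[of "\<lambda>n g. real (multi_comp_size n g 1)"] measH[of "\<lambda>n h. real (simple_comp_size n h 1)"]
        by eventually_elim (rule borel_measurable_abs[OF borel_measurable_diff])
    qed (use component_sizes_close(1)[OF cpl] in auto)
    fix j :: nat assume "2 \<le> j"
    then show "small_o_P \<Omega> (\<lambda>n \<omega>. real (simple_comp_size n (H n \<omega>) j)) (\<lambda>n. real n * p n powr (1 / (3 - \<tau>)))"
      using measH[of "\<lambda>n h. real (simple_comp_size n h j)"] component_sizes_close(2)[OF cpl]
      by (intro small_o_P_if_eventually_le[OF _ prob]) auto
  qed
qed

end
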